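(* Let $n\geq 2$ and $m\geq 1$ be integers and let $\boldsymbol{k}$ be a finite field of characteristic $p$ with at least $4$ elements, such that $\boldsymbol{k}\neq\mathbb{F}_5$ if $n=2$ and $\boldsymbol{k}\neq\mathbb{F}_4$ if $n=3$. Put $W_m:=W(\boldsymbol{k})/p^m$ and $G:=SL_n(W_m)$, let $\rho:G\to SL_n(W_m)$ be the natural representation, and let $\overline\rho:=\rho\bmod p: G\to SL_n(\boldsymbol{k})$. Then $W_m$, together with $\rho$, is the universal deformation ring for deformations of $\overline\rho$ in the category of complete local Noetherian rings with residue field $\boldsymbol{k}$; that is, for every complete local Noetherian ring $A$ with residue field $\boldsymbol{k}$ and every homomorphism $\rho_A:G\to GL_n(A)$ lifting $\overline\rho$, there is a unique morphism $i_A:W_m\to A$ in this category such that $i_A\circ\rho$ is strictly equivalent to $\rho_A$.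
   Context: $W(\boldsymbol{k})$ is the ring of Witt vectors of $\boldsymbol{k}$. Morphisms in the category of complete local Noetherian rings with residue field $\boldsymbol{k}$ are local ring homomorphisms inducing the identity on $\boldsymbol{k}$. A lift of $\overline\rho$ to $A$ is a homomorphism $G\to GL_n(A)$ whose reduction modulo $\mathfrak{m}_A$ is $\overline\rho$. Two lifts to $A$ are strictly equivalent if they are conjugate by an element of $GL_n(A)$ reducing to the identity modulo $\mathfrak{m}_A$. *)

theory Defs
  imports
    "HOL-Algebra.Algebra"
    "HOL-Combinatorics.Permutations"
    "HOL-Library.Poly_Mapping"
begin

section \<open>Witt vectors\<close>

text \<open>Integral polynomials in the two sequences of indeterminates
  X(0), X(1), \dots (tagged \<open>Inl\<close>) and Y(0), Y(1), \dots (tagged \<open>Inr\<close>):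
  finitely supported functions from monomials to coefficients.\<close>

type_synonym witt_poly = "((nat + nat) \<Rightarrow>\<^sub>0 nat) \<Rightarrow>\<^sub>0 int"

definition indet :: "nat + nat \<Rightarrow> witt_poly" where
  "indet v = Poly_Mapping.single (Poly_Mapping.single v 1) 1"

definition ghost :: "nat \<Rightarrow> nat \<Rightarrow> (nat \<Rightarrow> witt_poly) \<Rightarrow> witt_poly" where
  "ghost p n Z = (\<Sum>i\<le>n. of_nat p ^ i * Z i ^ (p ^ (n - i)))"

text \<open>For prime \<open>p\<close>, Witt's theorem says that each of the following two descriptions is
  satisfied by exactly one sequence of polynomials with integer coefficients.\<close>

definition witt_sum :: "nat \<Rightarrow> nat \<Rightarrow> witt_poly" where
  "witt_sum p = (THE S. \<forall>n. ghost p n S =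
     ghost p n (\<lambda>i. indet (Inl i)) + ghost p n (\<lambda>i. indet (Inr i)))"

definition witt_prod :: "nat \<Rightarrow> nat \<Rightarrow> witt_poly" where
  "witt_prod p = (THE P. \<forall>n. ghost p n P =
     ghost p n (\<lambda>i. indet (Inl i)) * ghost p n (\<lambda>i. indet (Inr i)))"

definition eval_poly :: "('k, 'c) ring_scheme \<Rightarrow> (nat + nat \<Rightarrow> 'k) \<Rightarrow> witt_poly \<Rightarrow> 'k" where
  "eval_poly K f q = (\<Oplus>\<^bsub>K\<^esub>\<mu>\<in>Poly_Mapping.keys q. add_pow K (Poly_Mapping.lookup q \<mu>)
     (\<Otimes>\<^bsub>K\<^esub>v\<in>Poly_Mapping.keys \<mu>. f v [^]\<^bsub>K\<^esub> Poly_Mapping.lookup \<mu> v))"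

definition witt :: "nat \<Rightarrow> ('k, 'c) ring_scheme \<Rightarrow> (nat \<Rightarrow> 'k) ring" where
  "witt p K = \<lparr>carrier = {x. \<forall>i. x i \<in> carrier K},
     monoid.mult = (\<lambda>x y n. eval_poly K (case_sum x y) (witt_prod p n)),
     one = (\<lambda>n. if n = 0 then \<one>\<^bsub>K\<^esub> else \<zero>\<^bsub>K\<^esub>),
     ring.zero = (\<lambda>n. \<zero>\<^bsub>K\<^esub>),
     add = (\<lambda>x y n. eval_poly K (case_sum x y) (witt_sum p n))\<rparr>"

definition witt_quot :: "nat \<Rightarrow> nat \<Rightarrow> ('k, 'c) ring_scheme \<Rightarrow> (nat \<Rightarrow> 'k) set ring" where
  "witt_quot p m K = witt p K Quot (PIdl\<^bsub>witt p K\<^esub> (add_pow (witt p K) (p ^ m) \<one>\<^bsub>witt p K\<^esub>))"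

text \<open>Reduction modulo \<open>p\<close>, with values in \<open>K\<close>: all representatives of a residue class modulo
  \<open>p ^ m\<close> with \<open>m \<ge> 1\<close> have the same zeroth Witt component.\<close>

definition witt_red :: "(nat \<Rightarrow> 'k) set \<Rightarrow> 'k" where
  "witt_red C = the_elem ((\<lambda>x. x 0) ` C)"


section \<open>Complete local Noetherian rings with residue field \<open>K\<close>\<close>

definition has_char :: "('a, 'c) ring_scheme \<Rightarrow> nat \<Rightarrow> bool" where
  "has_char R p \<longleftrightarrow> (\<forall>n::nat. add_pow R n \<one>\<^bsub>R\<^esub> = \<zero>\<^bsub>R\<^esub> \<longleftrightarrow> p dvd n)"

definition local_ring :: "('a, 'c) ring_scheme \<Rightarrow> bool" where
  "local_ring R \<longleftrightarrow> cring R \<and> (\<exists>!I. maximalideal I R)"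

definition max_ideal :: "('a, 'c) ring_scheme \<Rightarrow> 'a set" where
  "max_ideal R = (THE I. maximalideal I R)"

text \<open>Bijectivity of the canonical map from \<open>R\<close> to the inverse limit of the quotients of \<open>R\<close>
  by the powers of \<open>I\<close>.\<close>

definition adic_complete :: "('a, 'c) ring_scheme \<Rightarrow> 'a set \<Rightarrow> bool" where
  "adic_complete R I \<longleftrightarrow>
     (\<forall>x\<in>carrier R. (\<forall>i::nat. x \<in> I [^]\<^bsub>ideals_set R\<^esub> i) \<longrightarrow> x = \<zero>\<^bsub>R\<^esub>) \<and>
     (\<forall>a. (\<forall>i. a i \<in> carrier R) \<and>
          (\<forall>i::nat. a (Suc i) \<ominus>\<^bsub>R\<^esub> a i \<in> I [^]\<^bsub>ideals_set R\<^esub> i) \<longrightarrow>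
          (\<exists>x\<in>carrier R. \<forall>i. x \<ominus>\<^bsub>R\<^esub> a i \<in> I [^]\<^bsub>ideals_set R\<^esub> i))"

text \<open>An object of the category is a ring \<open>R\<close> together with an identification of its residue
  field with \<open>K\<close>, given as the reduction map \<open>\<pi>\<close> from \<open>R\<close> onto \<open>K\<close> with kernel the maximal
  ideal.\<close>

definition cln_ring :: "('k, 'c) ring_scheme \<Rightarrow> ('a, 'd) ring_scheme \<Rightarrow> ('a \<Rightarrow> 'k) \<Rightarrow> bool" where
  "cln_ring K R \<pi> \<longleftrightarrow>
     local_ring R \<and> noetherian_ring R \<and> adic_complete R (max_ideal R) \<and>
     \<pi> \<in> ring_hom R K \<and> \<pi> ` carrier R = carrier K \<and> a_kernel R K \<pi> = max_ideal R"

text \<open>Morphisms are taken extensional, so that equality of functions is equality of morphisms.\<close>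

definition cln_hom ::
  "('a, 'c) ring_scheme \<Rightarrow> ('a \<Rightarrow> 'k) \<Rightarrow> ('b, 'd) ring_scheme \<Rightarrow> ('b \<Rightarrow> 'k) \<Rightarrow> ('a \<Rightarrow> 'b) set" where
  "cln_hom R \<pi> A \<pi>' = {f \<in> ring_hom R A. f \<in> extensional (carrier R) \<and>
     f ` max_ideal R \<subseteq> max_ideal A \<and> (\<forall>x\<in>carrier R. \<pi>' (f x) = \<pi> x)}"


section \<open>Matrix groups\<close>

type_synonym 'a matr = "nat \<times> nat \<Rightarrow> 'a"

definition mat_monoid :: "nat \<Rightarrow> ('a, 'c) ring_scheme \<Rightarrow> 'a matr monoid" where
  "mat_monoid n R = \<lparr>carrier = ({..<n} \<times> {..<n}) \<rightarrow>\<^sub>E carrier R,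
     monoid.mult = (\<lambda>M N. \<lambda>(i, j)\<in>{..<n} \<times> {..<n}. \<Oplus>\<^bsub>R\<^esub>l\<in>{..<n}. M (i, l) \<otimes>\<^bsub>R\<^esub> N (l, j)),
     one = (\<lambda>(i, j)\<in>{..<n} \<times> {..<n}. if i = j then \<one>\<^bsub>R\<^esub> else \<zero>\<^bsub>R\<^esub>)\<rparr>"

definition mat_det :: "nat \<Rightarrow> ('a, 'c) ring_scheme \<Rightarrow> 'a matr \<Rightarrow> 'a" where
  "mat_det n R M = (\<Oplus>\<^bsub>R\<^esub>\<sigma>\<in>{\<sigma>. \<sigma> permutes {..<n}}.
     add_pow R (sign \<sigma>) (\<Otimes>\<^bsub>R\<^esub>i\<in>{..<n}. M (i, \<sigma> i)))"

definition GL :: "nat \<Rightarrow> ('a, 'c) ring_scheme \<Rightarrow> 'a matr monoid" where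
  "GL n R = units_of (mat_monoid n R)"

definition SL :: "nat \<Rightarrow> ('a, 'c) ring_scheme \<Rightarrow> 'a matr monoid" where
  "SL n R = (mat_monoid n R)
     \<lparr>carrier := {M \<in> carrier (mat_monoid n R). mat_det n R M = \<one>\<^bsub>R\<^esub>}\<rparr>"

definition mat_map :: "nat \<Rightarrow> ('a \<Rightarrow> 'b) \<Rightarrow> 'a matr \<Rightarrow> 'b matr" where
  "mat_map n f M = (\<lambda>ij\<in>{..<n} \<times> {..<n}. f (M ij))"


section \<open>Deformations\<close>

definition is_lift :: "nat \<Rightarrow> ('g, 'e) monoid_scheme \<Rightarrow> ('g \<Rightarrow> 'k matr) \<Rightarrow>
    ('a, 'c) ring_scheme \<Rightarrow> ('a \<Rightarrow> 'k) \<Rightarrow> ('g \<Rightarrow> 'a matr) \<Rightarrow> bool" where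
  "is_lift n G \<rho>bar A \<pi> \<rho> \<longleftrightarrow>
     \<rho> \<in> hom G (GL n A) \<and> (\<forall>g\<in>carrier G. mat_map n \<pi> (\<rho> g) = \<rho>bar g)"

definition strictly_equiv :: "nat \<Rightarrow> ('g, 'e) monoid_scheme \<Rightarrow> ('k, 'd) ring_scheme \<Rightarrow>
    ('a, 'c) ring_scheme \<Rightarrow> ('a \<Rightarrow> 'k) \<Rightarrow> ('g \<Rightarrow> 'a matr) \<Rightarrow> ('g \<Rightarrow> 'a matr) \<Rightarrow> bool" where
  "strictly_equiv n G K A \<pi> \<rho> \<rho>' \<longleftrightarrow>
     (\<exists>P\<in>carrier (GL n A). mat_map n \<pi> P = \<one>\<^bsub>GL n K\<^esub> \<and>
        (\<forall>g\<in>carrier G. \<rho>' g = P \<otimes>\<^bsub>GL n A\<^esub> \<rho> g \<otimes>\<^bsub>GL n A\<^esub> inv\<^bsub>GL n A\<^esub> P))"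

text \<open>The first argument names the type over which the carriers of the test rings \<open>A\<close> range; a
  theorem about \<open>TYPE('a)\<close> with \<open>'a\<close> a type variable covers test rings on every type.\<close>

definition universal_deformation_ring :: "'a itself \<Rightarrow> nat \<Rightarrow> ('g, 'e) monoid_scheme \<Rightarrow>
    'k ring \<Rightarrow> ('g \<Rightarrow> 'k matr) \<Rightarrow> 'r ring \<Rightarrow> ('r \<Rightarrow> 'k) \<Rightarrow> ('g \<Rightarrow> 'r matr) \<Rightarrow> bool" where
  "universal_deformation_ring T n G K \<rho>bar R \<pi> \<rho> \<longleftrightarrow>
     cln_ring K R \<pi> \<and> is_lift n G \<rho>bar R \<pi> \<rho> \<and>
     (\<forall>(A :: 'a ring) \<pi>A \<rho>A. cln_ring K A \<pi>A \<longrightarrow> is_lift n G \<rho>bar A \<pi>A \<rho>A \<longrightarrow>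
        (\<exists>!f. f \<in> cln_hom R \<pi> A \<pi>A \<and>
              strictly_equiv n G K A \<pi>A (\<lambda>g. mat_map n f (\<rho> g)) \<rho>A))"

end

theory Submission
  imports Defs "Jordan_Normal_Form.Determinant"
begin

text \<open>Write \<open>k\<close> for the residue field, \<open>q\<close> for its order and \<open>W\<close> for the ring of Witt vectors modulo \<open>p ^ m\<close>.
The proof is by generators and relations.  All that enters about
\<open>W\<close> is that it is a commutative ring with a homomorphism onto \<open>k\<close> whose kernel is \<open>p W\<close>, and
that \<open>p ^ m = 0\<close> in it (locale \<open>p_residue\<close>).  Establishing this needs Witt's theorem: the
polynomials that define the ring operations are obtained from Dwork's criterion for a sequence to
consist of ghost components (\<open>ghost_realizable\<close>), and the kernel of the zeroth component is
\<open>p W\<close> because in characteristic \<open>p\<close> multiplication by \<open>p\<close> is Verschiebung after Frobenius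
(\<open>witt_add_pow_p\<close>) and \<open>k\<close> is perfect.

Every complete local ring \<open>A\<close> with residue field \<open>k\<close> has Teichmueller representatives
\<open>\<tau> a\<close>, the unique solutions of \<open>x ^ q = x\<close> (\<open>teichmueller_ex1\<close>).  In \<open>k\<close> every element is a sum
of two squares, so every \<open>r\<close> in \<open>W\<close> has the form \<open>\<tau>(a a) + \<tau>(b b) + p s\<close>.  As \<open>p\<close> is nilpotent
in \<open>W\<close>, an additive map on \<open>W\<close> is determined by its values at the \<open>\<tau>(a a)\<close>
(\<open>additive_eq\<close>).  This gives at once that there is at most one morphism from \<open>W\<close> to \<open>A\<close>.

For the existence, let \<open>\<rho>\<close> be a lift to \<open>A\<close>.  The diagonal matrices with entries \<open>\<tau> (t i)\<close>, where
the product of the \<open>t i\<close> is 1, form a finite group \<open>T\<close> of order prime to \<open>p\<close>.  Averaging over \<open>T\<close>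
yields a matrix, congruent to the identity, that conjugates \<open>\<rho>\<close> to a lift which sends these diagonal
matrices to the diagonal matrices with the same Teichmueller entries over \<open>A\<close> (\<open>diagonalize\<close>).
Now conjugation by \<open>T\<close> acts on the matrix entries of the image of an elementary matrix \<open>E i j r\<close>
by explicit characters, and comparing characters shows that the image is again elementary,
say \<open>E i j (\<phi> i j r)\<close> (\<open>E_eq\<close>).  The hypotheses on \<open>n\<close> and \<open>k\<close> make enough
characters distinct (\<open>separate\<close>, \<open>ratio_big\<close>).  The maps \<open>\<phi> i j\<close> are additive and satisfy
\<open>\<phi> i j (\<tau>(a a) r) = \<tau>(a a) \<phi> i j r\<close>, so by the uniqueness of additive maps they are all multiples
\<open>u i j f\<close> of one ring homomorphism \<open>f\<close>.  Relations between elementary matrices show that the units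
\<open>u i j\<close> form a coboundary \<open>V i / V j\<close>, hence conjugating with the diagonal matrix of the \<open>V i\<close>
turns the lift into \<open>f\<close> on elementary matrices.  Over a local ring these generate the special
linear group (\<open>SL_induct\<close>), so the lift is strictly equivalent to the one induced by \<open>f\<close>.\<close>

(* Keeps the name for the set of homomorphisms between rings with a carrier. *)
hide_const (open) Ring_Hom.ring_hom

section \<open>Polynomials and their evaluation in rings with a carrier\<close>

text \<open>Homomorphisms from a ring type to a ring with a carrier are expressed through this record.
Polynomial identities are proved over types, where commutative algebra is automated, and are then
transported along such homomorphisms.\<close>

definition type_ring :: "'a::comm_ring_1 ring" where
  "type_ring = \<lparr>carrier = UNIV, monoid.mult = (*), one = 1, ring.zero = 0, add = (+)\<rparr>"

lemma type_ring_simps [simp]: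
  "carrier type_ring = UNIV" "x \<otimes>\<^bsub>type_ring\<^esub> y = x * y" "\<one>\<^bsub>type_ring\<^esub> = 1"
  "\<zero>\<^bsub>type_ring\<^esub> = 0" "x \<oplus>\<^bsub>type_ring\<^esub> y = x + y"
  by (simp_all add: type_ring_def)

lemma cring_type_ring: "cring (type_ring :: 'a::comm_ring_1 ring)"
proof (rule cringI)
  show "abelian_group (type_ring :: 'a ring)"
    by (rule abelian_groupI) (auto simp: algebra_simps intro: exI[of _ "- x" for x])
  show "Group.comm_monoid (type_ring :: 'a ring)"
    by (rule comm_monoidI) (auto simp: algebra_simps)
qed (auto simp: algebra_simps)

lemma type_ring_a_inv [simp]: "\<ominus>\<^bsub>type_ring\<^esub> (x::'a::comm_ring_1) = - x"
proof -
  interpret cring "type_ring :: 'a ring" by (rule cring_type_ring)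
  show ?thesis by (rule minus_equality) auto
qed

lemma type_ring_minus [simp]: "x \<ominus>\<^bsub>type_ring\<^esub> (y::'a::comm_ring_1) = x - y"
  by (simp add: a_minus_def)

lemma type_ring_nat_pow [simp]: "x [^]\<^bsub>type_ring\<^esub> (n::nat) = (x::'a::comm_ring_1) ^ n"
  by (induction n) (simp_all add: nat_pow_def mult.commute)

lemma type_ring_add_pow [simp]: "add_pow type_ring (n::nat) (x::'a::comm_ring_1) = of_nat n * x"
  by (induction n) (simp_all add: add_pow_def nat_pow_def algebra_simps)

lemma type_ring_finsum [simp]: "finsum type_ring f S = sum f S" for f :: "'b \<Rightarrow> 'a::comm_ring_1"
proof -
  interpret cring "type_ring :: 'a ring" by (rule cring_type_ring)
  show ?thesis by (induction S rule: infinite_finite_induct) auto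
qed

lemma poly_mapping_single_induct [case_names zero single add]:
  assumes "P 0" "\<And>k v. P (Poly_Mapping.single k v)" "\<And>q r. P q \<Longrightarrow> P r \<Longrightarrow> P (q + r)"
  shows "P (q :: 'a \<Rightarrow>\<^sub>0 'b::comm_monoid_add)"
proof -
  have q: "q = (\<Sum>k\<in>Poly_Mapping.keys q. Poly_Mapping.single k (Poly_Mapping.lookup q k))"
    by (rule poly_mapping_eqI)
      (auto simp: lookup_sum lookup_single when_def in_keys_iff sum.delta)
  have "P (\<Sum>k\<in>S. Poly_Mapping.single k (Poly_Mapping.lookup q k))" if "finite S" for S
    using that by induction (auto intro: assms)
  with q show ?thesis by (metis finite_keys)
qed

lemma witt_poly_induct [case_names indet one diff mult]:
  assumes indet: "\<And>v. P (indet v)" and one: "P 1"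
    and diff: "\<And>q r. P q \<Longrightarrow> P r \<Longrightarrow> P (q - r)" and mult: "\<And>q r. P q \<Longrightarrow> P r \<Longrightarrow> P (q * r)"
  shows "P q"
proof -
  have zero: "P 0" using diff[OF one one] by simp
  have add: "P (q + r)" if "P q" "P r" for q r using diff[OF that(1) diff[OF zero that(2)]] by simp
  have nat: "P (of_nat n)" for n by (induction n) (auto intro: zero one add)
  have int: "P (of_int c)" for c
    by (cases c rule: int_cases2) (auto intro: nat diff[OF zero, simplified])
  have pow: "P (q ^ n)" if "P q" for q n by (induction n) (auto intro: one mult that)
  have single_pow: "Poly_Mapping.single (Poly_Mapping.single v n) 1 = indet v ^ n" for v n
  proof (induction n)
    case (Suc n)
    have "Poly_Mapping.single v (Suc n) = Poly_Mapping.single v 1 + Poly_Mapping.single v n"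
      by (simp flip: single_add)
    then have "Poly_Mapping.single (Poly_Mapping.single v (Suc n)) (1::int) =
        indet v * Poly_Mapping.single (Poly_Mapping.single v n) 1"
      by (simp only: indet_def mult_single) simp
    with Suc show ?case by simp
  qed simp
  have mon: "P (Poly_Mapping.single \<mu> 1)" for \<mu>
  proof (induction \<mu> rule: poly_mapping_single_induct)
    case (add \<mu> \<nu>)
    have "Poly_Mapping.single (\<mu> + \<nu>) (1::int) = Poly_Mapping.single \<mu> 1 * Poly_Mapping.single \<nu> 1"
      by (simp add: mult_single)
    then show ?case using add mult by metis
  qed (auto simp: one single_pow pow indet)
  show ?thesis
  proof (induction q rule: poly_mapping_single_induct)
    case (single \<mu> c)
    have "Poly_Mapping.single \<mu> c = of_int c * Poly_Mapping.single \<mu> (1::int)"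
      using single_of_int[of c, where ?'a = "nat + nat \<Rightarrow>\<^sub>0 nat" and ?'b = int]
      by (simp flip: single_of_int add: mult_single)
    then show ?case using mult[OF int[of c] mon[of \<mu>]] by simp
  qed (auto intro: zero add)
qed

definition monom_eval :: "('k, 'c) ring_scheme \<Rightarrow> (nat + nat \<Rightarrow> 'k) \<Rightarrow> ((nat + nat) \<Rightarrow>\<^sub>0 nat) \<Rightarrow> 'k" where
  "monom_eval K f \<mu> = (\<Otimes>\<^bsub>K\<^esub>v\<in>Poly_Mapping.keys \<mu>. f v [^]\<^bsub>K\<^esub> Poly_Mapping.lookup \<mu> v)"

context cring
begin

context
  fixes f :: "nat + nat \<Rightarrow> 'a"
  assumes f: "\<And>v. f v \<in> carrier R"
begin

lemma monom_eval_closed [simp]: "monom_eval R f \<mu> \<in> carrier R"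
  unfolding monom_eval_def using f by (intro finprod_closed) auto

lemma monom_eval_superset:
  assumes "finite V" "Poly_Mapping.keys \<mu> \<subseteq> V"
  shows "monom_eval R f \<mu> = (\<Otimes>v\<in>V. f v [^] Poly_Mapping.lookup \<mu> v)"
  unfolding monom_eval_def using assms f
  by (intro finprod_mono_neutral_cong_left) (auto simp: in_keys_iff)

lemma monom_eval_add: "monom_eval R f (\<mu> + \<nu>) = monom_eval R f \<mu> \<otimes> monom_eval R f \<nu>"
proof -
  let ?V = "Poly_Mapping.keys \<mu> \<union> Poly_Mapping.keys \<nu>"
  have "monom_eval R f (\<mu> + \<nu>) = (\<Otimes>v\<in>?V. f v [^] Poly_Mapping.lookup (\<mu> + \<nu>) v)"
    by (rule monom_eval_superset) (auto dest!: subsetD[OF Poly_Mapping.keys_add])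
  also have "\<dots> = (\<Otimes>v\<in>?V. f v [^] Poly_Mapping.lookup \<mu> v \<otimes> f v [^] Poly_Mapping.lookup \<nu> v)"
    using f by (simp add: lookup_add nat_pow_mult)
  also have "\<dots> = monom_eval R f \<mu> \<otimes> monom_eval R f \<nu>"
    using f by (simp add: monom_eval_superset[of ?V] finprod_multf)
  finally show ?thesis .
qed

lemma eval_poly_alt:
  "eval_poly R f q = (\<Oplus>\<mu>\<in>Poly_Mapping.keys q. add_pow R (Poly_Mapping.lookup q \<mu>) (monom_eval R f \<mu>))"
  by (simp add: eval_poly_def monom_eval_def)

lemma eval_poly_closed [simp]: "eval_poly R f q \<in> carrier R"
  unfolding eval_poly_alt by (intro finsum_closed) auto

lemma eval_poly_superset:
  assumes "finite V" "Poly_Mapping.keys q \<subseteq> V"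
  shows "eval_poly R f q = (\<Oplus>\<mu>\<in>V. add_pow R (Poly_Mapping.lookup q \<mu>) (monom_eval R f \<mu>))"
  unfolding eval_poly_alt using assms
  by (intro add.finprod_mono_neutral_cong_left) (auto simp: in_keys_iff add_pow_int_ge)

lemma eval_poly_add: "eval_poly R f (q + r) = eval_poly R f q \<oplus> eval_poly R f r"
proof -
  let ?V = "Poly_Mapping.keys q \<union> Poly_Mapping.keys r"
  have "eval_poly R f (q + r) =
      (\<Oplus>\<mu>\<in>?V. add_pow R (Poly_Mapping.lookup (q + r) \<mu>) (monom_eval R f \<mu>))"
    by (rule eval_poly_superset) (auto dest!: subsetD[OF Poly_Mapping.keys_add])
  also have "\<dots> = (\<Oplus>\<mu>\<in>?V. add_pow R (Poly_Mapping.lookup q \<mu>) (monom_eval R f \<mu>)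
      \<oplus> add_pow R (Poly_Mapping.lookup r \<mu>) (monom_eval R f \<mu>))"
    by (simp add: lookup_add add.int_pow_mult)
  also have "\<dots> = eval_poly R f q \<oplus> eval_poly R f r"
    by (simp add: eval_poly_superset[of ?V] finsum_addf)
  finally show ?thesis .
qed

lemma eval_poly_single: "eval_poly R f (Poly_Mapping.single \<mu> c) = add_pow R c (monom_eval R f \<mu>)"
  by (subst eval_poly_superset[of "{\<mu>}"]) (auto simp: keys_single)

lemma eval_poly_mult: "eval_poly R f (q * r) = eval_poly R f q \<otimes> eval_poly R f r"
proof (induction q rule: poly_mapping_single_induct)
  case zero
  have "eval_poly R f 0 = \<zero>" by (simp add: eval_poly_def)
  then show ?case by simp
next
  case (add q r)
  then show ?case by (simp add: algebra_simps eval_poly_add l_distr)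
next
  case (single \<mu> c)
  show ?case
  proof (induction r rule: poly_mapping_single_induct)
    case zero
    have "eval_poly R f 0 = \<zero>" by (simp add: eval_poly_def)
    then show ?case by simp
  next
    case (add q r)
    then show ?case by (simp add: algebra_simps eval_poly_add r_distr)
  next
    case (single \<nu> d)
    show ?case
      by (simp add: mult_single eval_poly_single monom_eval_add add_pow_ldistr_int
          add_pow_rdistr_int add.int_pow_pow mult.commute)
  qed
qed

lemma eval_poly_indet: "eval_poly R f (indet v) = f v"
  using f by (simp add: indet_def eval_poly_single monom_eval_def)

lemma eval_poly_hom: "eval_poly R f \<in> ring_hom type_ring R"
proof (rule ring_hom_memI)
  have "eval_poly R f 1 = \<one>"
    using eval_poly_single[of 0 1] by (simp add: monom_eval_def)
  then show "eval_poly R f \<one>\<^bsub>type_ring\<^esub> = \<one>" by simp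
qed (auto simp: eval_poly_add eval_poly_mult)

end
end

text \<open>The polynomial ring is free, so a homomorphism is the evaluation at the images of the
indeterminates.\<close>

lemma hom_eq_eval_poly:
  assumes "cring K" and h: "h \<in> ring_hom (type_ring :: witt_poly ring) K"
  shows "h q = eval_poly K (\<lambda>v. h (indet v)) q"
proof -
  interpret K: cring K by fact
  interpret h: ring_hom_cring type_ring K h
    using h by (simp add: ring_hom_cring_def ring_hom_cring_axioms_def cring_type_ring assms)
  have f: "h (indet v) \<in> carrier K" for v by simp
  interpret e: ring_hom_cring type_ring K "eval_poly K (\<lambda>v. h (indet v))"
    using K.eval_poly_hom[of "\<lambda>v. h (indet v)"] f
    by (simp add: ring_hom_cring_def ring_hom_cring_axioms_def cring_type_ring assms)
  show ?thesis
  proof (induction q rule: witt_poly_induct)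
    case (indet v)
    show ?case using K.eval_poly_indet[of "\<lambda>v. h (indet v)"] f by simp
  next
    case one
    then show ?case using h.hom_one e.hom_one by simp
  next
    case (diff q r)
    have "h (q - r) = h q \<ominus>\<^bsub>K\<^esub> h r" 
      using h.hom_sub[of q r] by simp
    moreover have "eval_poly K (\<lambda>v. h (indet v)) (q - r) = eval_poly K (\<lambda>v. h (indet v)) q \<ominus>\<^bsub>K\<^esub> eval_poly K (\<lambda>v. h (indet v)) r" 
      using e.hom_sub[of q r] by simp
    ultimately show ?case using diff by simp
  next
    case (mult q r)
    then show ?case using h.hom_mult[of q r] e.hom_mult[of q r] by simp
  qed
qed

text \<open>This is the transport principle: elements of any commutative ring are simultaneous
specializations of polynomials, so an identity that holds in the polynomial ring holds for them.\<close>

lemma generic_lift: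
  fixes x :: "'c::countable \<Rightarrow> 'k"
  assumes "cring K" "\<And>c. x c \<in> carrier K"
  shows "\<exists>h\<in>ring_hom (type_ring :: witt_poly ring) K. \<exists>Z. \<forall>c. h (Z c) = x c"
proof -
  interpret K: cring K by fact
  let ?f = "case_sum (\<lambda>i. x (from_nat i)) (\<lambda>_. \<zero>\<^bsub>K\<^esub>)"
  have f: "?f v \<in> carrier K" for v using assms(2) by (cases v) auto
  have "eval_poly K ?f (indet (Inl (to_nat c))) = x c" for c
    by (subst K.eval_poly_indet) (simp_all add: f)
  then show ?thesis
    by (intro bexI[OF _ K.eval_poly_hom[of ?f]] exI[of _ "\<lambda>c. indet (Inl (to_nat c))"])
      (auto simp: f)
qed

section \<open>Witt's theorem and the ring of Witt vectors\<close>

abbreviation PR :: "witt_poly ring" where "PR \<equiv> type_ring"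

text \<open>Coefficients are integers, so the ring of polynomials has no torsion; ghost components can
therefore be divided by powers of \<open>p\<close>.\<close>

lemma of_nat_mult_cancel:
  fixes q r :: witt_poly
  assumes "n > 0" "of_nat n * q = of_nat n * r"
  shows "q = r"
proof (rule poly_mapping_eqI)
  have lookup: "Poly_Mapping.lookup (of_nat k * s) \<mu> = int k * Poly_Mapping.lookup s \<mu>"
    for k and s :: witt_poly and \<mu>
    by (induction k) (simp_all add: lookup_add algebra_simps)
  fix \<mu>
  have "int n * Poly_Mapping.lookup q \<mu> = int n * Poly_Mapping.lookup r \<mu>"
    using arg_cong[OF assms(2), of "\<lambda>s. Poly_Mapping.lookup s \<mu>"] by (simp add: lookup)
  then show "Poly_Mapping.lookup q \<mu> = Poly_Mapping.lookup r \<mu>" using assms(1) by simp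
qed

text \<open>The quotient of \<open>a ^ q - b ^ q\<close> by \<open>a - b\<close>, expanded to first order at \<open>a = b\<close>.  It explains why
raising to a power that is divisible by \<open>p\<close> improves a congruence by one step.\<close>

lemma power_diff_factor:
  fixes a b :: "'a::comm_ring_1"
  shows "\<exists>c. a ^ q - b ^ q = (a - b) * (of_nat q * b ^ (q - 1) + (a - b) * c)"
proof (induction q)
  case 0
  show ?case by (intro exI[of _ 0]) simp
next
  case (Suc q)
  then obtain c where c: "a ^ q - b ^ q = (a - b) * (of_nat q * b ^ (q - 1) + (a - b) * c)" ..
  have q: "of_nat q * b ^ (q - 1) * b = of_nat q * b ^ q"
    by (cases q) (simp_all add: mult_ac)
  have "a ^ Suc q - b ^ Suc q = (a - b) * b ^ q + (a ^ q - b ^ q) * a"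
    by (simp add: algebra_simps)
  also have "\<dots> = (a - b) * b ^ q + (a - b) * (of_nat q * b ^ (q - 1) + (a - b) * c) * a"
    unfolding c ..
  also have "\<dots> = (a - b) * (b ^ q + of_nat q * b ^ (q - 1) * b
      + (a - b) * (of_nat q * b ^ (q - 1) + c * a))"
    by (simp add: algebra_simps)
  finally have "a ^ Suc q - b ^ Suc q = (a - b) * (of_nat (Suc q) * b ^ (Suc q - 1)
      + (a - b) * (of_nat q * b ^ (q - 1) + c * a))"
    unfolding q by (simp add: algebra_simps)
  then show ?case ..
qed

lemma dvd_power_diff_Suc:
  fixes a b :: "'a::comm_ring_1"
  assumes "of_nat p ^ Suc k dvd a - b"
  shows "of_nat p ^ Suc (Suc k) dvd a ^ p - b ^ p"
proof -
  obtain c where c: "a ^ p - b ^ p = (a - b) * (of_nat p * b ^ (p - 1) + (a - b) * c)"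
    using power_diff_factor by blast
  have "of_nat p dvd a - b" using assms by (metis dvd_trans dvd_triv_left power_Suc)
  then have "of_nat p dvd of_nat p * b ^ (p - 1) + (a - b) * c"
    by (intro dvd_add dvd_triv_left dvd_mult2)
  then have "of_nat p ^ Suc k * of_nat p dvd a ^ p - b ^ p"
    unfolding c by (rule mult_dvd_mono[OF assms])
  then show ?thesis unfolding power_Suc2[of _ "Suc k"] .
qed

lemma dvd_power_power_diff:
  fixes a b :: "'a::comm_ring_1"
  assumes "of_nat p dvd a - b"
  shows "of_nat p ^ Suc j dvd a ^ (p ^ j) - b ^ (p ^ j)"
proof (induction j)
  case (Suc j)
  then show ?case
    using dvd_power_diff_Suc[of p j "a ^ (p ^ j)" "b ^ (p ^ j)"]
    by (simp add: mult.commute flip: power_mult)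
qed (use assms in simp)

lemma dvd_power_add:
  fixes a b :: "'a::comm_ring_1"
  assumes p: "Factorial_Ring.prime p"
  shows "of_nat p dvd (a + b) ^ p - (a ^ p + b ^ p)"
proof -
  have "p > 0" using p by (simp add: prime_gt_0_nat)
  then have *: "{..p} = insert 0 (insert p {0<..<p})" by auto
  have "(a + b) ^ p = (\<Sum>k\<le>p. of_nat (p choose k) * a ^ k * b ^ (p - k))"
    by (rule binomial_ring)
  also have "\<dots> = a ^ p + b ^ p + (\<Sum>k\<in>{0<..<p}. of_nat (p choose k) * a ^ k * b ^ (p - k))"
    using \<open>p > 0\<close> unfolding * by simp
  finally have "(a + b) ^ p - (a ^ p + b ^ p) = (\<Sum>k\<in>{0<..<p}. of_nat (p choose k) * a ^ k * b ^ (p - k))"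
    by simp
  moreover have "of_nat p dvd (of_nat (p choose k) :: 'a)" if "k \<in> {0<..<p}" for k
  proof -
    have "p dvd p choose k" using that p by (intro dvd_choose_prime) auto
    then obtain c where "p choose k = p * c" by (elim dvdE)
    then show ?thesis by simp
  qed
  ultimately show ?thesis by (auto intro!: dvd_sum dvd_mult2)
qed

lemma type_ring_homD:
  fixes h :: "'a::comm_ring_1 \<Rightarrow> 'b::comm_ring_1"
  assumes "h \<in> ring_hom type_ring type_ring"
  shows "h (x + y) = h x + h y" "h (x * y) = h x * h y" "h 1 = 1" "h 0 = 0"
    "h (x - y) = h x - h y" "h (x ^ n) = h x ^ n" "h (sum g S) = (\<Sum>s\<in>S. h (g s))"
    "h (of_nat n) = of_nat n"
proof -
  show add: "h (x + y) = h x + h y" for x y using ring_hom_add[OF assms, of x y] by simp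
  show mult: "h (x * y) = h x * h y" for x y using ring_hom_mult[OF assms, of x y] by simp
  show one: "h 1 = 1" using ring_hom_one[OF assms] by simp
  show zero: "h 0 = 0" using add[of 0 0] by simp
  show "h (x - y) = h x - h y" using add[of "x - y" y] by (simp add: algebra_simps)
  show "h (x ^ n) = h x ^ n" by (induction n) (auto simp: mult one)
  show "h (sum g S) = (\<Sum>s\<in>S. h (g s))" by (induction S rule: infinite_finite_induct) (auto simp: add zero)
  show "h (of_nat n) = of_nat n" by (induction n) (auto simp: add zero one)
qed

lemma eval_type_ring_hom: "eval_poly (type_ring :: 'a::comm_ring_1 ring) f \<in> ring_hom type_ring type_ring"
  by (rule cring.eval_poly_hom[OF cring_type_ring]) simp

lemma eval_type_ring_indet [simp]: "eval_poly (type_ring :: 'a::comm_ring_1 ring) f (indet v) = f v"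
  by (rule cring.eval_poly_indet[OF cring_type_ring]) simp

text \<open>A lift of the Frobenius endomorphism from characteristic \<open>p\<close> to integral polynomials.\<close>

definition frob :: "nat \<Rightarrow> witt_poly \<Rightarrow> witt_poly" where
  "frob p = eval_poly type_ring (\<lambda>v. indet v ^ p)"

lemmas frob_hom = type_ring_homD[OF eval_type_ring_hom[of "\<lambda>v. indet v ^ p" for p], folded frob_def]

text \<open>The polynomials for which the congruence holds form a subring by the binomial theorem, and they
contain the indeterminates.\<close>

lemma frob_cong:
  assumes p: "Factorial_Ring.prime p"
  shows "of_nat p dvd frob p q - q ^ p"
proof (induction q rule: witt_poly_induct)
  case (diff q r)
  have "frob p (q - r) - (q - r) ^ p =
      (frob p q - q ^ p) - (frob p r - r ^ p) + ((q - r + r) ^ p - ((q - r) ^ p + r ^ p))"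
    by (simp add: frob_hom)
  moreover have "of_nat p dvd \<dots>"
    by (intro dvd_add[OF dvd_diff] diff dvd_power_add[OF p])
  ultimately show ?case by (simp only:)
next
  case (mult q r)
  have "frob p (q * r) - (q * r) ^ p = (frob p q - q ^ p) * frob p r + q ^ p * (frob p r - r ^ p)"
    by (simp add: frob_hom algebra_simps)
  then show ?case using mult by (auto intro: dvd_add dvd_mult dvd_mult2)
next
  case (indet v)
  show ?case by (simp add: frob_def)
next
  case one
  show ?case by (simp add: frob_hom)
qed

lemma ghost_hom:
  assumes "h \<in> ring_hom type_ring type_ring"
  shows "h (ghost p n Z) = ghost p n (\<lambda>i. h (Z i))"
  by (simp add: ghost_def type_ring_homD[OF assms])

lemma ghost_split:
  "ghost p n Z = (\<Sum>i<n. of_nat p ^ i * Z i ^ (p ^ (n - i))) + of_nat p ^ n * Z n"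
  by (simp add: ghost_def flip: lessThan_Suc_atMost)

lemma ghost_frob:
  assumes p: "Factorial_Ring.prime p"
  shows "of_nat p ^ Suc m dvd
    (\<Sum>i<Suc m. of_nat p ^ i * Z i ^ (p ^ (Suc m - i))) - frob p (ghost p m Z)"
proof -
  have "of_nat p ^ Suc m dvd
      of_nat p ^ i * Z i ^ (p ^ (Suc m - i)) - of_nat p ^ i * frob p (Z i) ^ (p ^ (m - i))"
    if "i \<le> m" for i
  proof -
    have "of_nat p ^ Suc (m - i) dvd (Z i ^ p) ^ (p ^ (m - i)) - frob p (Z i) ^ (p ^ (m - i))"
      using frob_cong[OF p, of "Z i"] by (intro dvd_power_power_diff) (metis dvd_minus_iff minus_diff_eq)
    then have "of_nat p ^ i * of_nat p ^ Suc (m - i) dvd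
        of_nat p ^ i * ((Z i ^ p) ^ (p ^ (m - i)) - frob p (Z i) ^ (p ^ (m - i)))"
      by (rule mult_dvd_mono[OF dvd_refl])
    moreover have "of_nat p ^ i * of_nat p ^ Suc (m - i) = (of_nat p ^ Suc m :: witt_poly)"
      unfolding power_add[symmetric] using that by simp
    moreover have "(Z i ^ p) ^ (p ^ (m - i)) = Z i ^ (p ^ (Suc m - i))"
      unfolding power_mult[symmetric] using that by (simp add: Suc_diff_le)
    ultimately show ?thesis by (simp only: right_diff_distrib)
  qed
  then have "of_nat p ^ Suc m dvd (\<Sum>i\<le>m. of_nat p ^ i * Z i ^ (p ^ (Suc m - i))
      - of_nat p ^ i * frob p (Z i) ^ (p ^ (m - i)))"
    by (intro dvd_sum) auto
  then show ?thesis
    by (simp only: lessThan_Suc_atMost ghost_def frob_hom sum_subtractf)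
qed

text \<open>Necessity in Dwork's criterion: the ghost components of any sequence are compatible with the
lift of Frobenius.\<close>

lemma ghost_frob_cong:
  assumes p: "Factorial_Ring.prime p"
  shows "of_nat p ^ Suc m dvd ghost p (Suc m) Z - frob p (ghost p m Z)"
proof -
  let ?s = "\<Sum>i<Suc m. of_nat p ^ i * Z i ^ (p ^ (Suc m - i))"
  have "ghost p (Suc m) Z - frob p (ghost p m Z) =
     (?s - frob p (ghost p m Z)) + of_nat p ^ Suc m * Z (Suc m)"
    unfolding ghost_split[of p "Suc m" Z] by (rule diff_add_eq[symmetric])
  moreover have "of_nat p ^ Suc m dvd \<dots>"
    by (rule dvd_add[OF ghost_frob[OF p] dvd_triv_left])
  ultimately show ?thesis by (simp only:)
qed

text \<open>Sufficiency in Dwork's criterion.  The components are found one after the other; the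
congruence for \<open>w\<close> and the one for the ghost components already constructed make the next
remainder divisible by the power of \<open>p\<close> in front of the new component.\<close>

lemma ghost_realizable:
  assumes p: "Factorial_Ring.prime p"
    and w: "\<And>n. of_nat p ^ Suc n dvd w (Suc n) - frob p (w n)"
  shows "\<exists>Z. \<forall>n. ghost p n Z = w n"
proof -
  have step: "\<exists>r. ghost p n (Z(n := r)) = w n"
    if IH: "\<And>m. m < n \<Longrightarrow> ghost p m (Z(m := Z m)) = w m" for n Z
  proof -
    let ?s = "\<Sum>i<n. of_nat p ^ i * Z i ^ (p ^ (n - i))"
    have "of_nat p ^ n dvd w n - ?s"
    proof (cases n)
      case (Suc m)
      have "ghost p m Z = w m" using IH[of m] Suc by simp
      then have "of_nat p ^ Suc m dvd (w (Suc m) - frob p (w m)) -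
          ((\<Sum>i<Suc m. of_nat p ^ i * Z i ^ (p ^ (Suc m - i))) - frob p (w m))"
        using ghost_frob[OF p, of m Z] by - (rule dvd_diff[OF w], simp only:)
      then show ?thesis by (simp only: Suc diff_diff_eq2 diff_add_cancel)
    qed simp
    then obtain r where "w n - ?s = of_nat p ^ n * r" by (elim dvdE)
    then have "ghost p n (Z(n := r)) = w n" by (simp add: ghost_split algebra_simps)
    then show ?thesis ..
  qed
  have "\<exists>Z. \<forall>n. ghost p n (Z(n := Z n)) = w n"
  proof (rule dependent_wellorder_choice)
    fix r and f g :: "nat \<Rightarrow> witt_poly" and n
    assume "\<And>y. y < n \<Longrightarrow> f y = g y"
    then show "(ghost p n (f(n := r)) = w n) = (ghost p n (g(n := r)) = w n)"
      by (simp add: ghost_split)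
  qed (rule step)
  then show ?thesis by simp
qed

lemma ghost_inj:
  assumes "p > 0" "\<And>n. ghost p n Y = ghost p n Z"
  shows "Y = Z"
proof (rule ext)
  fix n show "Y n = Z n"
  proof (induction n rule: less_induct)
    case (less n)
    have "of_nat p ^ n * Y n = of_nat p ^ n * Z n"
      using assms(2)[of n] less by (simp add: ghost_split)
    then show ?case using of_nat_mult_cancel[of "p ^ n"] assms(1) by simp
  qed
qed

text \<open>An analogue of \<open>ghost_inj\<close> modulo \<open>p\<close>, proved by the same recursion: the summands
before the last one agree modulo the required power of \<open>p\<close> because powers improve congruences.\<close>

lemma ghost_cong:
  assumes "p > 0" "\<And>n. of_nat p ^ Suc n dvd ghost p n Y - ghost p n Z"
  shows "of_nat p dvd Y n - Z n"
proof (induction n rule: less_induct)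
  case (less n)
  have "of_nat p ^ Suc n dvd of_nat p ^ i * Y i ^ (p ^ (n - i)) - of_nat p ^ i * Z i ^ (p ^ (n - i))"
    if "i < n" for i
  proof -
    have "of_nat p ^ i * of_nat p ^ Suc (n - i) dvd
        of_nat p ^ i * (Y i ^ (p ^ (n - i)) - Z i ^ (p ^ (n - i)))"
      using less[OF that] by (intro mult_dvd_mono dvd_power_power_diff) auto
    moreover have "of_nat p ^ i * of_nat p ^ Suc (n - i) = (of_nat p ^ Suc n :: witt_poly)"
      unfolding power_add[symmetric] using that by simp
    ultimately show ?thesis by (simp only: right_diff_distrib)
  qed
  then have "of_nat p ^ Suc n dvd (\<Sum>i<n. of_nat p ^ i * Y i ^ (p ^ (n - i)) - of_nat p ^ i * Z i ^ (p ^ (n - i)))"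
    by (intro dvd_sum) auto
  then have "of_nat p ^ Suc n dvd ghost p n Y - ghost p n Z -
     (\<Sum>i<n. of_nat p ^ i * Y i ^ (p ^ (n - i)) - of_nat p ^ i * Z i ^ (p ^ (n - i)))"
    by (rule dvd_diff[OF assms(2)])
  also have "\<dots> = of_nat p ^ n * (Y n - Z n)"
    by (simp add: ghost_split sum_subtractf algebra_simps)
  finally obtain c where "of_nat p ^ n * (Y n - Z n) = of_nat p ^ Suc n * c" by (elim dvdE)
  then have "of_nat (p ^ n) * (Y n - Z n) = of_nat (p ^ n) * (of_nat p * c)"
    by (simp add: mult_ac)
  then have "Y n - Z n = of_nat p * c"
    by (rule of_nat_mult_cancel[rotated]) (use assms(1) in simp)
  then show ?case by simp
qed

lemma ghost_realize:
  assumes p: "Factorial_Ring.prime p"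
    and w: "\<And>n. of_nat p ^ Suc n dvd w (Suc n) - frob p (w n)"
  shows "\<exists>!Z. \<forall>n. ghost p n Z = w n"
  using ghost_realizable[OF p, of w] w ghost_inj[OF prime_gt_0_nat[OF p]] by auto

lemma ghost_witt_sum:
  assumes p: "Factorial_Ring.prime p"
  shows "ghost p n (witt_sum p) = ghost p n (\<lambda>i. indet (Inl i)) + ghost p n (\<lambda>i. indet (Inr i))"
proof -
  let ?a = "\<lambda>n. ghost p n (\<lambda>i. indet (Inl i))" and ?b = "\<lambda>n. ghost p n (\<lambda>i. indet (Inr i))"
  have "of_nat p ^ Suc n dvd (?a (Suc n) + ?b (Suc n)) - frob p (?a n + ?b n)" for n
  proof -
    have "(?a (Suc n) + ?b (Suc n)) - frob p (?a n + ?b n)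
       = (?a (Suc n) - frob p (?a n)) + (?b (Suc n) - frob p (?b n))"
      by (simp add: frob_hom)
    moreover have "of_nat p ^ Suc n dvd \<dots>" by (intro dvd_add ghost_frob_cong[OF p])
    ultimately show ?thesis by (simp only:)
  qed
  from theI'[OF ghost_realize[OF p this]] show ?thesis unfolding witt_sum_def by blast
qed

lemma ghost_witt_prod:
  assumes p: "Factorial_Ring.prime p"
  shows "ghost p n (witt_prod p) = ghost p n (\<lambda>i. indet (Inl i)) * ghost p n (\<lambda>i. indet (Inr i))"
proof -
  let ?a = "\<lambda>n. ghost p n (\<lambda>i. indet (Inl i))" and ?b = "\<lambda>n. ghost p n (\<lambda>i. indet (Inr i))"
  have "of_nat p ^ Suc n dvd (?a (Suc n) * ?b (Suc n)) - frob p (?a n * ?b n)" for n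
  proof -
    have "(?a (Suc n) * ?b (Suc n)) - frob p (?a n * ?b n)
       = (?a (Suc n) - frob p (?a n)) * ?b (Suc n) + frob p (?a n) * (?b (Suc n) - frob p (?b n))"
      by (simp add: frob_hom algebra_simps)
    moreover have "of_nat p ^ Suc n dvd \<dots>"
      by (intro dvd_add dvd_mult2[OF ghost_frob_cong[OF p]] dvd_mult[OF ghost_frob_cong[OF p]])
    ultimately show ?thesis by (simp only:)
  qed
  from theI'[OF ghost_realize[OF p this]] show ?thesis unfolding witt_prod_def by blast
qed

abbreviation WP :: "nat \<Rightarrow> (nat \<Rightarrow> witt_poly) ring" where "WP p \<equiv> witt p type_ring"

lemma ghost_WP_add:
  assumes p: "Factorial_Ring.prime p"
  shows "ghost p n (Y \<oplus>\<^bsub>WP p\<^esub> Z) = ghost p n Y + ghost p n Z"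
  using arg_cong[OF ghost_witt_sum[OF p, of n], of "eval_poly type_ring (case_sum Y Z)"]
  by (simp add: witt_def ghost_hom[OF eval_type_ring_hom] type_ring_homD(1)[OF eval_type_ring_hom])

lemma ghost_WP_mult:
  assumes p: "Factorial_Ring.prime p"
  shows "ghost p n (Y \<otimes>\<^bsub>WP p\<^esub> Z) = ghost p n Y * ghost p n Z"
  using arg_cong[OF ghost_witt_prod[OF p, of n], of "eval_poly type_ring (case_sum Y Z)"]
  by (simp add: witt_def ghost_hom[OF eval_type_ring_hom] type_ring_homD(2)[OF eval_type_ring_hom])

lemma ghost_WP_zero:
  assumes p: "Factorial_Ring.prime p"
  shows "ghost p n \<zero>\<^bsub>WP p\<^esub> = 0"
  using prime_gt_0_nat[OF p] by (simp add: witt_def ghost_def zero_power)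

lemma ghost_WP_one:
  assumes p: "Factorial_Ring.prime p"
  shows "ghost p n \<one>\<^bsub>WP p\<^esub> = 1"
proof -
  have "ghost p n \<one>\<^bsub>WP p\<^esub> = (\<Sum>i\<le>n. if i = 0 then 1 else 0)"
    unfolding ghost_def using prime_gt_0_nat[OF p] by (intro sum.cong) (auto simp: witt_def zero_power)
  then show ?thesis by simp
qed

lemma carrier_WP [simp]: "carrier (WP p) = UNIV"
  by (simp add: witt_def)

text \<open>Over polynomials the ghost map is injective and turns the Witt operations into componentwise
ones, so the ring axioms are inherited.  Only negatives are not given by a formula; they come from
Dwork's criterion.\<close>

lemma cring_WP:
  assumes p: "Factorial_Ring.prime p"
  shows "cring (WP p)"
proof -
  note g = ghost_WP_add[OF p] ghost_WP_mult[OF p] ghost_WP_zero[OF p] ghost_WP_one[OF p]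
  have eq: "(\<And>n. ghost p n Y = ghost p n Z) \<Longrightarrow> Y = Z" for Y Z
    using ghost_inj[of p] prime_gt_0_nat[OF p] by blast
  have neg: "\<exists>Y. Y \<oplus>\<^bsub>WP p\<^esub> Z = \<zero>\<^bsub>WP p\<^esub>" for Z
  proof -
    have "of_nat p ^ Suc n dvd - ghost p (Suc n) Z - frob p (- ghost p n Z)" for n
    proof -
      have "- ghost p (Suc n) Z - frob p (- ghost p n Z) = - (ghost p (Suc n) Z - frob p (ghost p n Z))"
        using frob_hom(5)[of p 0 "ghost p n Z"] by (simp add: frob_hom)
      then show ?thesis using ghost_frob_cong[OF p, of n Z] by (simp only: dvd_minus_iff)
    qed
    from ghost_realize[OF p this] obtain Y where "\<And>n. ghost p n Y = - ghost p n Z" by blast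
    then have "Y \<oplus>\<^bsub>WP p\<^esub> Z = \<zero>\<^bsub>WP p\<^esub>" by (intro eq) (simp add: g)
    then show ?thesis by blast
  qed
  show ?thesis
  proof (rule cringI)
    show "abelian_group (WP p)"
      using neg by (intro abelian_groupI) (auto intro!: eq simp: g algebra_simps)
    show "Group.comm_monoid (WP p)"
      by (intro comm_monoidI) (auto intro!: eq simp: g algebra_simps)
  qed (auto intro!: eq simp: g algebra_simps)
qed

lemma witt_hom:
  assumes "cring K" and h: "h \<in> ring_hom PR K"
  shows "(\<lambda>Y i. h (Y i)) \<in> ring_hom (WP p) (witt p K)"
proof -
  interpret K: cring K by fact
  have cl: "h q \<in> carrier K" for q using ring_hom_closed[OF h] by simp
  have one: "h 1 = \<one>\<^bsub>K\<^esub>" using ring_hom_one[OF h] by simp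
  have zero: "h 0 = \<zero>\<^bsub>K\<^esub>"
  proof -
    interpret h: ring_hom_cring PR K h
      using h by (simp add: ring_hom_cring_def ring_hom_cring_axioms_def cring_type_ring assms)
    show ?thesis using h.hom_zero by simp
  qed
  have eval: "h (eval_poly type_ring f q) = eval_poly K (\<lambda>v. h (f v)) q" for f q
  proof -
    have "h \<circ> eval_poly type_ring f \<in> ring_hom PR K"
      by (rule ring_hom_trans[OF eval_type_ring_hom h])
    from hom_eq_eval_poly[OF assms(1) this] show ?thesis by simp
  qed
  have cs: "(\<lambda>v. h (case_sum Y Z v)) = case_sum (\<lambda>i. h (Y i)) (\<lambda>i. h (Z i))" for Y Z
    by (auto split: sum.splits)
  show ?thesis
    by (rule ring_hom_memI) (auto simp: witt_def cl eval cs one zero)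
qed

lemma witt_lift:
  assumes "cring K" "x \<in> carrier (witt p K)" "y \<in> carrier (witt p K)" "z \<in> carrier (witt p K)"
  obtains h Y1 Y2 Y3 where "h \<in> ring_hom PR K"
    "x = (\<lambda>i. h (Y1 i))" "y = (\<lambda>i. h (Y2 i))" "z = (\<lambda>i. h (Y3 i))"
proof -
  let ?u = "\<lambda>(c::nat, i). if c = 0 then x i else if c = 1 then y i else z i"
  have "?u c \<in> carrier K" for c using assms by (auto simp: witt_def split: prod.splits)
  from generic_lift[where x = ?u, OF assms(1) this] obtain h Y where
    h: "h \<in> ring_hom PR K" and Y: "\<forall>c. h (Y c) = ?u c" by auto
  show ?thesis
    by (rule that[OF h, of "\<lambda>i. Y (0, i)" "\<lambda>i. Y (1, i)" "\<lambda>i. Y (2, i)"]) (simp_all add: Y)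
qed

text \<open>Each axiom involves at most three vectors, which are specializations of vectors of polynomials,
where the axiom is known.\<close>

lemma cring_witt:
  assumes "cring K" and p: "Factorial_Ring.prime p"
  shows "cring (witt p K)"
proof -
  interpret K: cring K by fact
  interpret W: cring "WP p" by (rule cring_WP[OF p])
  let ?W = "witt p K"
  note H = witt_hom[OF assms(1), of _ p]
  have zero: "(\<lambda>i. h (\<zero>\<^bsub>WP p\<^esub> i)) = \<zero>\<^bsub>?W\<^esub>" if "h \<in> ring_hom PR K" for h
  proof -
    interpret h: ring_hom_cring PR K h
      using that by (simp add: ring_hom_cring_def ring_hom_cring_axioms_def cring_type_ring assms)
    show ?thesis using h.hom_zero by (simp add: witt_def)
  qed
  have closed: "x \<oplus>\<^bsub>?W\<^esub> y \<in> carrier ?W" "x \<otimes>\<^bsub>?W\<^esub> y \<in> carrier ?W"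
    if "x \<in> carrier ?W" "y \<in> carrier ?W" for x y
    using that by (auto simp: witt_def intro!: K.eval_poly_closed split: sum.splits)
  have op: "(\<lambda>i. h ((Y \<oplus>\<^bsub>WP p\<^esub> Z) i)) = (\<lambda>i. h (Y i)) \<oplus>\<^bsub>?W\<^esub> (\<lambda>i. h (Z i))"
    "(\<lambda>i. h ((Y \<otimes>\<^bsub>WP p\<^esub> Z) i)) = (\<lambda>i. h (Y i)) \<otimes>\<^bsub>?W\<^esub> (\<lambda>i. h (Z i))"
    "(\<lambda>i. h (\<one>\<^bsub>WP p\<^esub> i)) = \<one>\<^bsub>?W\<^esub>"
    if "h \<in> ring_hom PR K" for h Y Z
    using ring_hom_add[OF H[OF that]] ring_hom_mult[OF H[OF that]] ring_hom_one[OF H[OF that]] by auto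
  have el: "\<one>\<^bsub>?W\<^esub> \<in> carrier ?W" "\<zero>\<^bsub>?W\<^esub> \<in> carrier ?W" by (auto simp: witt_def)
  show ?thesis
  proof (rule cringI)
    show "abelian_group ?W"
    proof (rule abelian_groupI)
      fix x y z assume xyz: "x \<in> carrier ?W" "y \<in> carrier ?W" "z \<in> carrier ?W"
      obtain h X1 Y1 Z1 where h: "h \<in> ring_hom PR K" "x = (\<lambda>i. h (X1 i))"
        "y = (\<lambda>i. h (Y1 i))" "z = (\<lambda>i. h (Z1 i))" by (rule witt_lift[OF assms(1) xyz])
      show "x \<oplus>\<^bsub>?W\<^esub> y \<oplus>\<^bsub>?W\<^esub> z = x \<oplus>\<^bsub>?W\<^esub> (y \<oplus>\<^bsub>?W\<^esub> z)"
        unfolding h(2-) op[OF h(1), symmetric] by (simp add: W.a_assoc)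
    next
      fix x y assume xy: "x \<in> carrier ?W" "y \<in> carrier ?W"
      obtain h X1 Y1 Z1 where h: "h \<in> ring_hom PR K" "x = (\<lambda>i. h (X1 i))"
        "y = (\<lambda>i. h (Y1 i))" "y = (\<lambda>i. h (Z1 i))" by (rule witt_lift[OF assms(1) xy xy(2)])
      show "x \<oplus>\<^bsub>?W\<^esub> y = y \<oplus>\<^bsub>?W\<^esub> x"
        unfolding h(2-3) op[OF h(1), symmetric] by (simp add: W.a_comm)
    next
      fix x assume x: "x \<in> carrier ?W"
      obtain h X1 Y1 Z1 where h: "h \<in> ring_hom PR K" "x = (\<lambda>i. h (X1 i))"
        "x = (\<lambda>i. h (Y1 i))" "x = (\<lambda>i. h (Z1 i))" by (rule witt_lift[OF assms(1) x x x])
      show "\<zero>\<^bsub>?W\<^esub> \<oplus>\<^bsub>?W\<^esub> x = x"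
        unfolding h(2) op[OF h(1), symmetric] zero[OF h(1), symmetric] by simp
      show "\<exists>y\<in>carrier ?W. y \<oplus>\<^bsub>?W\<^esub> x = \<zero>\<^bsub>?W\<^esub>"
      proof (rule bexI)
        show "(\<lambda>i. h ((\<ominus>\<^bsub>WP p\<^esub> X1) i)) \<oplus>\<^bsub>?W\<^esub> x = \<zero>\<^bsub>?W\<^esub>"
          unfolding h(2) op[OF h(1), symmetric] zero[OF h(1), symmetric] by (simp add: W.l_neg)
        show "(\<lambda>i. h ((\<ominus>\<^bsub>WP p\<^esub> X1) i)) \<in> carrier ?W"
          using ring_hom_closed[OF h(1)] by (simp add: witt_def)
      qed
    qed (use closed el in auto)
    show "Group.comm_monoid ?W"
    proof (rule comm_monoidI)
      fix x y z assume xyz: "x \<in> carrier ?W" "y \<in> carrier ?W" "z \<in> carrier ?W"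
      obtain h X1 Y1 Z1 where h: "h \<in> ring_hom PR K" "x = (\<lambda>i. h (X1 i))"
        "y = (\<lambda>i. h (Y1 i))" "z = (\<lambda>i. h (Z1 i))" by (rule witt_lift[OF assms(1) xyz])
      show "x \<otimes>\<^bsub>?W\<^esub> y \<otimes>\<^bsub>?W\<^esub> z = x \<otimes>\<^bsub>?W\<^esub> (y \<otimes>\<^bsub>?W\<^esub> z)"
        unfolding h(2-) op[OF h(1), symmetric] by (simp add: W.m_assoc)
    next
      fix x y assume xy: "x \<in> carrier ?W" "y \<in> carrier ?W"
      obtain h X1 Y1 Z1 where h: "h \<in> ring_hom PR K" "x = (\<lambda>i. h (X1 i))"
        "y = (\<lambda>i. h (Y1 i))" "y = (\<lambda>i. h (Z1 i))" by (rule witt_lift[OF assms(1) xy xy(2)])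
      show "x \<otimes>\<^bsub>?W\<^esub> y = y \<otimes>\<^bsub>?W\<^esub> x"
        unfolding h(2-3) op[OF h(1), symmetric] by (simp add: W.m_comm)
      show "\<one>\<^bsub>?W\<^esub> \<otimes>\<^bsub>?W\<^esub> x = x"
        unfolding h(2) op[OF h(1), symmetric] by simp
    qed (use closed el in auto)
    fix x y z assume xyz: "x \<in> carrier ?W" "y \<in> carrier ?W" "z \<in> carrier ?W"
    obtain h X1 Y1 Z1 where h: "h \<in> ring_hom PR K" "x = (\<lambda>i. h (X1 i))"
      "y = (\<lambda>i. h (Y1 i))" "z = (\<lambda>i. h (Z1 i))" by (rule witt_lift[OF assms(1) xyz])
    show "(x \<oplus>\<^bsub>?W\<^esub> y) \<otimes>\<^bsub>?W\<^esub> z = x \<otimes>\<^bsub>?W\<^esub> z \<oplus>\<^bsub>?W\<^esub> y \<otimes>\<^bsub>?W\<^esub> z"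
      unfolding h(2-) op[OF h(1), symmetric] by (simp add: W.l_distr)
  qed
qed

section \<open>Multiplication by p on Witt vectors and the quotient modulo a power of p\<close>

lemma ring_hom_cringI:
  assumes "cring R" "cring S" "h \<in> ring_hom R S"
  shows "ring_hom_cring R S h"
  using assms by (simp add: ring_hom_cring_def ring_hom_cring_axioms_def)

lemma (in ring_hom_cring) hom_nat_pow:
  "x \<in> carrier R \<Longrightarrow> h (x [^] (n::nat)) = h x [^]\<^bsub>S\<^esub> n"
  by (induction n) simp_all

lemma ring_hom_add_pow:
  assumes "cring R" "cring S" "h \<in> ring_hom R S" "x \<in> carrier R"
  shows "h (add_pow R (n::nat) x) = add_pow S n (h x)"
proof -
  interpret ring_hom_cring R S h using assms by (intro ring_hom_cringI)
  show ?thesis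
    by (induction n) (simp_all add: assms(4))
qed

lemma prime_char:
  assumes "field K" "finite (carrier K)" "has_char K p"
  shows "Factorial_Ring.prime p"
proof -
  interpret K: field K by fact
  note ch = assms(3)[unfolded has_char_def, rule_format]
  have "add_pow K (card (carrier K)) \<one>\<^bsub>K\<^esub> = \<zero>\<^bsub>K\<^esub>"
    using K.add.pow_order_eq_1[of "\<one>\<^bsub>K\<^esub>"] assms(2) by (simp add: Coset.order_def)
  then have "p dvd card (carrier K)" using ch by simp
  moreover have "card (carrier K) > 0" using assms(2) K.one_closed by (auto simp: card_gt_0_iff)
  ultimately have "p \<noteq> 0" by auto
  have "p \<noteq> 1" using ch[of 1] by auto
  have "m = 1 \<or> m = p" if m: "m dvd p" for m
  proof -
    obtain k where k: "p = m * k" using m by blast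
    have "add_pow K m \<one>\<^bsub>K\<^esub> \<otimes>\<^bsub>K\<^esub> add_pow K k \<one>\<^bsub>K\<^esub> = add_pow K (m * k) \<one>\<^bsub>K\<^esub>"
      by (simp add: K.add_pow_ldistr K.add_pow_rdistr K.add.nat_pow_pow mult.commute)
    also have "\<dots> = \<zero>\<^bsub>K\<^esub>" using ch[of p] k by simp
    finally have "add_pow K m \<one>\<^bsub>K\<^esub> = \<zero>\<^bsub>K\<^esub> \<or> add_pow K k \<one>\<^bsub>K\<^esub> = \<zero>\<^bsub>K\<^esub>"
      by (intro K.integral) auto
    then have "p dvd m \<or> p dvd k" using ch by simp
    then show ?thesis using k \<open>p \<noteq> 0\<close> m by (auto simp: dvd_mult_cancel1 dvd_mult_cancel2 intro: dvd_antisym)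
  qed
  then show ?thesis using \<open>p \<noteq> 0\<close> \<open>p \<noteq> 1\<close> by (auto simp: prime_nat_iff)
qed

lemma (in domain) nat_pow_nonzero:
  assumes "x \<in> carrier R" "x \<noteq> \<zero>"
  shows "x [^] (n::nat) \<noteq> \<zero>"
proof (induction n)
  case (Suc n)
  then show ?case using assms integral[of "x [^] n" x] by auto
qed simp

lemma hom_cong_char:
  assumes "cring K" "h \<in> ring_hom PR K"
    and "add_pow K p \<one>\<^bsub>K\<^esub> = \<zero>\<^bsub>K\<^esub>" and "of_nat p dvd q - r"
  shows "h q = h r"
proof -
  interpret h: ring_hom_cring PR K h by (intro ring_hom_cringI cring_type_ring assms)
  obtain c where c: "q - r = of_nat p * c" using assms(4) by blast
  have "h (of_nat p * 1) = \<zero>\<^bsub>K\<^esub>"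
    using ring_hom_add_pow[OF cring_type_ring assms(1,2), of 1 p] assms(3) h.hom_one by simp
  then have "h (of_nat p * c) = \<zero>\<^bsub>K\<^esub>" using h.hom_mult[of "of_nat p" c] by simp
  moreover have "q = of_nat p * c + r" using c by (simp add: algebra_simps)
  ultimately show ?thesis using h.hom_add[of "of_nat p * c" r] by simp
qed

text \<open>Injectivity of the \<open>p\<close>-th power map on a field of characteristic \<open>p\<close> gives surjectivity since
the field is finite.\<close>

lemma frobenius_surj:
  assumes "field K" "finite (carrier K)" "has_char K p" "x \<in> carrier K"
  shows "\<exists>y\<in>carrier K. y [^]\<^bsub>K\<^esub> p = x"
proof -
  interpret K: field K by fact
  have p: "Factorial_Ring.prime p" by (rule prime_char[OF assms(1-3)])
  have p1: "add_pow K p \<one>\<^bsub>K\<^esub> = \<zero>\<^bsub>K\<^esub>" using assms(3) by (simp add: has_char_def)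
  have "x = y" if xy: "x \<in> carrier K" "y \<in> carrier K" and eq: "x [^]\<^bsub>K\<^esub> p = y [^]\<^bsub>K\<^esub> p" for x y
  proof -
    have "(if b then x else y) \<in> carrier K" for b using xy by simp
    from generic_lift[where x = "\<lambda>c. if c then x else y", OF K.is_cring this] obtain h Y where
      h: "h \<in> ring_hom PR K" and Y: "\<forall>c. h (Y c) = (if c then x else y)" by auto
    interpret h: ring_hom_cring PR K h by (intro ring_hom_cringI cring_type_ring K.is_cring h)
    have pow: "h (a ^ p) = h a [^]\<^bsub>K\<^esub> p" for a using h.hom_nat_pow[of a p] by simp
    have "h ((Y True - Y False + Y False) ^ p) = h ((Y True - Y False) ^ p + Y False ^ p)"
      by (rule hom_cong_char[OF K.is_cring h p1 dvd_power_add[OF p]])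
    also have "\<dots> = (x \<ominus>\<^bsub>K\<^esub> y) [^]\<^bsub>K\<^esub> p \<oplus>\<^bsub>K\<^esub> y [^]\<^bsub>K\<^esub> p"
      using h.hom_add[of "(Y True - Y False) ^ p" "Y False ^ p"] h.hom_sub[of "Y True" "Y False"]
      by (simp add: pow Y)
    finally have "y [^]\<^bsub>K\<^esub> p = (x \<ominus>\<^bsub>K\<^esub> y) [^]\<^bsub>K\<^esub> p \<oplus>\<^bsub>K\<^esub> y [^]\<^bsub>K\<^esub> p"
      by (simp add: pow Y eq)
    then have "(x \<ominus>\<^bsub>K\<^esub> y) [^]\<^bsub>K\<^esub> p = \<zero>\<^bsub>K\<^esub>"
      using xy K.add.r_cancel_one' by auto
    then have "x \<ominus>\<^bsub>K\<^esub> y = \<zero>\<^bsub>K\<^esub>"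
      using xy K.nat_pow_nonzero[of "x \<ominus>\<^bsub>K\<^esub> y" p] by auto
    then show ?thesis using xy by simp
  qed
  then have "inj_on (\<lambda>x. x [^]\<^bsub>K\<^esub> p) (carrier K)" by (auto intro: inj_onI)
  then have "(\<lambda>x. x [^]\<^bsub>K\<^esub> p) ` carrier K = carrier K"
    using assms(2) by (intro endo_inj_surj) auto
  then show ?thesis using assms(4) by (metis (no_types, lifting) image_iff)
qed

lemma ghost_ring_hom:
  assumes "Factorial_Ring.prime p"
  shows "ghost p n \<in> ring_hom (WP p) type_ring"
  by (rule ring_hom_memI) (simp_all add: ghost_WP_add ghost_WP_mult ghost_WP_one assms)

text \<open>Multiplication by \<open>p\<close> equals Verschiebung after Frobenius in characteristic \<open>p\<close>.  For a vector \<open>Y\<close>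
of polynomials, the \<open>n\<close>-th ghost components of \<open>p Y\<close> and of the shifted vector of \<open>p\<close>-th powers differ
by \<open>p ^ Suc n * Y n\<close>, so both vectors agree modulo \<open>p\<close>.\<close>

lemma witt_add_pow_p:
  assumes "cring K" and p: "Factorial_Ring.prime p" and p1: "add_pow K p \<one>\<^bsub>K\<^esub> = \<zero>\<^bsub>K\<^esub>"
    and x: "x \<in> carrier (witt p K)"
  shows "add_pow (witt p K) p x = (\<lambda>n. case n of 0 \<Rightarrow> \<zero>\<^bsub>K\<^esub> | Suc i \<Rightarrow> x i [^]\<^bsub>K\<^esub> p)"
proof -
  have p0: "p > 0" using p by (rule prime_gt_0_nat)
  obtain h Y Y2 Y3 where h: "h \<in> ring_hom PR K" and Y: "x = (\<lambda>i. h (Y i))"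
    "x = (\<lambda>i. h (Y2 i))" "x = (\<lambda>i. h (Y3 i))"
    by (rule witt_lift[OF assms(1) x x x])
  interpret h: ring_hom_cring PR K h by (intro ring_hom_cringI cring_type_ring assms(1) h)
  let ?V = "\<lambda>n. case n of 0 \<Rightarrow> 0 | Suc i \<Rightarrow> Y i ^ p"
  let ?D = "add_pow (WP p) p Y"
  have D: "ghost p n ?D = of_nat p * ghost p n Y" for n
    using ring_hom_add_pow[OF cring_WP[OF p] cring_type_ring ghost_ring_hom[OF p, of n], of Y p] by simp
  have V: "of_nat p ^ Suc n dvd ghost p n ?D - ghost p n ?V" for n
  proof (cases n)
    case 0
    have "ghost p 0 ?D - ghost p 0 ?V = of_nat p * Y 0"
      unfolding D by (simp add: ghost_def)
    then have "of_nat p dvd ghost p 0 ?D - ghost p 0 ?V" by (simp only: dvd_triv_left)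
    then show ?thesis unfolding 0 power_Suc power_0 mult_1_right .
  next
    case (Suc m)
    have "ghost p (Suc m) ?V = (\<Sum>i\<le>m. of_nat p ^ Suc i * (Y i ^ p) ^ (p ^ (m - i)))"
      using p0 by (simp add: ghost_def sum.atMost_Suc_shift zero_power del: sum.atMost_Suc)
    also have "\<dots> = of_nat p * (\<Sum>i\<le>m. of_nat p ^ i * Y i ^ (p ^ (Suc m - i)))"
      unfolding sum_distrib_left
      by (intro sum.cong refl) (simp add: Suc_diff_le mult_ac flip: power_mult)
    also have "\<dots> = of_nat p * ghost p (Suc m) Y - of_nat p ^ Suc (Suc m) * Y (Suc m)"
      unfolding ghost_split[of p "Suc m"] lessThan_Suc_atMost by (simp add: algebra_simps)
    finally show ?thesis unfolding D Suc by simp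
  qed
  have "h (?D n) = h (?V n)" for n
    by (rule hom_cong_char[OF assms(1) h p1 ghost_cong[OF p0 V]])
  then have "(\<lambda>n. h (?D n)) = (\<lambda>n. case n of 0 \<Rightarrow> \<zero>\<^bsub>K\<^esub> | Suc i \<Rightarrow> x i [^]\<^bsub>K\<^esub> p)"
    using h.hom_zero h.hom_nat_pow by (auto simp: Y(1) split: nat.splits)
  moreover have "(\<lambda>n. h (?D n)) = add_pow (witt p K) p x"
    using ring_hom_add_pow[OF cring_WP[OF p] cring_witt[OF assms(1) p] witt_hom[OF assms(1) h], of Y p]
    by (simp add: Y(1))
  ultimately show ?thesis by simp
qed

lemma witt_zeroth_hom:
  assumes "cring K" and p: "Factorial_Ring.prime p"
  shows "(\<lambda>x. x 0) \<in> ring_hom (witt p K) K"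
proof (rule ring_hom_memI)
  fix x y assume xy: "x \<in> carrier (witt p K)" "y \<in> carrier (witt p K)"
  then show "x 0 \<in> carrier K" by (simp add: witt_def)
  obtain h Y Z Z2 where h: "h \<in> ring_hom PR K" and Y: "x = (\<lambda>i. h (Y i))"
    "y = (\<lambda>i. h (Z i))" "y = (\<lambda>i. h (Z2 i))"
    by (rule witt_lift[OF assms(1) xy xy(2)])
  note H = witt_hom[OF assms(1) h, of p]
  have "(Y \<oplus>\<^bsub>WP p\<^esub> Z) 0 = Y 0 + Z 0" "(Y \<otimes>\<^bsub>WP p\<^esub> Z) 0 = Y 0 * Z 0"
    using ghost_WP_add[OF p, of 0 Y Z] ghost_WP_mult[OF p, of 0 Y Z] by (simp_all add: ghost_def)
  then show "(x \<oplus>\<^bsub>witt p K\<^esub> y) 0 = x 0 \<oplus>\<^bsub>K\<^esub> y 0" "(x \<otimes>\<^bsub>witt p K\<^esub> y) 0 = x 0 \<otimes>\<^bsub>K\<^esub> y 0"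
    using fun_cong[OF ring_hom_add[OF H, of Y Z], of 0] fun_cong[OF ring_hom_mult[OF H, of Y Z], of 0]
      ring_hom_add[OF h, of "Y 0" "Z 0"] ring_hom_mult[OF h, of "Y 0" "Z 0"]
    unfolding Y(1,2) by simp_all
qed (simp add: witt_def)

locale witt_quotient = 
  fixes K :: "'k ring" and m p :: nat
  assumes field: "field K" and finite: "finite (carrier K)" and char: "has_char K p" and m: "m \<ge> 1"
begin

lemma p_prime: "Factorial_Ring.prime p" by (rule prime_char[OF field finite char])

sublocale K: field K by (rule field)
sublocale W: cring "witt p K" by (rule cring_witt[OF K.is_cring p_prime])

abbreviation "I \<equiv> PIdl\<^bsub>witt p K\<^esub> (add_pow (witt p K) (p ^ m) \<one>\<^bsub>witt p K\<^esub>)"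

lemma gen: "add_pow (witt p K) (p ^ m) \<one>\<^bsub>witt p K\<^esub> \<in> carrier (witt p K)"
  by (rule W.add.nat_pow_closed[OF W.one_closed])

sublocale I: ideal I "witt p K" by (rule W.cgenideal_ideal[OF gen])

lemma I_zeroth: assumes "i \<in> I" shows "i 0 = \<zero>\<^bsub>K\<^esub>"
proof -
  note e = witt_zeroth_hom[OF K.is_cring p_prime]
  obtain a where a: "a \<in> carrier (witt p K)" "i = a \<otimes>\<^bsub>witt p K\<^esub> add_pow (witt p K) (p ^ m) \<one>\<^bsub>witt p K\<^esub>"
    using assms unfolding cgenideal_def by blast
  have "p dvd p ^ m" using m by (intro dvd_power) auto
  then have "add_pow K (p ^ m) \<one>\<^bsub>K\<^esub> = \<zero>\<^bsub>K\<^esub>" using char unfolding has_char_def by blast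
  then have "(add_pow (witt p K) (p ^ m) \<one>\<^bsub>witt p K\<^esub>) 0 = \<zero>\<^bsub>K\<^esub>"
    using ring_hom_add_pow[OF W.is_cring K.is_cring e W.one_closed, of "p ^ m"] ring_hom_one[OF e]
    by (simp only:)
  moreover have "a 0 \<in> carrier K" by (rule ring_hom_closed[OF e a(1)])
  ultimately show ?thesis
    unfolding a(2) ring_hom_mult[OF e a(1) gen] by (simp only: K.r_null)
qed

lemma witt_red_coset:
  assumes x: "x \<in> carrier (witt p K)"
  shows "witt_red (I +>\<^bsub>witt p K\<^esub> x) = x 0"
proof -
  have "(\<lambda>x. x 0) ` (I +>\<^bsub>witt p K\<^esub> x) = {x 0}"
  proof -
    have "(i \<oplus>\<^bsub>witt p K\<^esub> x) 0 = x 0" if "i \<in> I" for i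
      using ring_hom_add[OF witt_zeroth_hom[OF K.is_cring p_prime] I.Icarr[OF that] x] I_zeroth[OF that] x
      by (simp add: witt_def)
    moreover have "(\<lambda>x. x 0) ` (I +>\<^bsub>witt p K\<^esub> x) = (\<lambda>i. (i \<oplus>\<^bsub>witt p K\<^esub> x) 0) ` I"
      unfolding a_r_coset_def' by blast
    moreover have "I \<noteq> {}"
      using additive_subgroup.zero_closed[OF ideal.axioms(1)[OF I.is_ideal]] by blast
    ultimately show ?thesis by (simp only: image_constant_conv if_False cong: image_cong)
  qed
  then show ?thesis by (simp add: witt_red_def)
qed

abbreviation "R \<equiv> witt_quot p m K"

lemma R_cring: "cring R" unfolding witt_quot_def by (rule I.quotient_is_cring[OF W.is_cring])

lemma coset_hom: "(+>\<^bsub>witt p K\<^esub>) I \<in> ring_hom (witt p K) R"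
  unfolding witt_quot_def by (rule I.rcos_ring_hom)

lemma carrier_R: "carrier R = (\<lambda>x. I +>\<^bsub>witt p K\<^esub> x) ` carrier (witt p K)"
  by (auto simp: witt_quot_def FactRing_def A_RCOSETS_def')

lemma red_hom: "witt_red \<in> ring_hom R K"
proof (rule ring_hom_memI)
  note c = coset_hom and e = witt_zeroth_hom[OF K.is_cring p_prime]
  fix C D assume "C \<in> carrier R" "D \<in> carrier R"
  then obtain x y where xy: "x \<in> carrier (witt p K)" "y \<in> carrier (witt p K)"
    "C = I +>\<^bsub>witt p K\<^esub> x" "D = I +>\<^bsub>witt p K\<^esub> y" by (auto simp: carrier_R)
  show "witt_red C \<in> carrier K" using xy by (simp add: witt_red_coset ring_hom_closed[OF e])
  show "witt_red (C \<otimes>\<^bsub>R\<^esub> D) = witt_red C \<otimes>\<^bsub>K\<^esub> witt_red D"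
    using xy by (simp flip: ring_hom_mult[OF c] add: witt_red_coset ring_hom_mult[OF e])
  show "witt_red (C \<oplus>\<^bsub>R\<^esub> D) = witt_red C \<oplus>\<^bsub>K\<^esub> witt_red D"
    using xy by (simp flip: ring_hom_add[OF c] add: witt_red_coset ring_hom_add[OF e])
next
  show "witt_red \<one>\<^bsub>R\<^esub> = \<one>\<^bsub>K\<^esub>"
    using ring_hom_one[OF coset_hom] witt_red_coset[of "\<one>\<^bsub>witt p K\<^esub>"]
      ring_hom_one[OF witt_zeroth_hom[OF K.is_cring p_prime]] by simp
qed

lemma red_surj: "witt_red ` carrier R = carrier K"
proof
  show "carrier K \<subseteq> witt_red ` carrier R"
  proof
    fix a assume a: "a \<in> carrier K"
    then have "(\<lambda>_. a) \<in> carrier (witt p K)" by (simp add: witt_def)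
    then show "a \<in> witt_red ` carrier R"
      by (intro image_eqI[of _ _ "I +>\<^bsub>witt p K\<^esub> (\<lambda>_. a)"]) (auto simp: witt_red_coset carrier_R)
  qed
qed (use ring_hom_closed[OF red_hom] in auto)

text \<open>Shift the vector down by one place and take \<open>p\<close>-th roots, which exist as \<open>K\<close> is perfect; then
\<open>p\<close> times the resulting vector is the given one.\<close>

lemma red_ker:
  assumes "C \<in> carrier R" "witt_red C = \<zero>\<^bsub>K\<^esub>"
  shows "\<exists>D\<in>carrier R. C = add_pow R p D"
proof -
  obtain x where x: "x \<in> carrier (witt p K)" "C = I +>\<^bsub>witt p K\<^esub> x"
    using assms by (auto simp: carrier_R)
  then have x0: "x 0 = \<zero>\<^bsub>K\<^esub>" using assms witt_red_coset by simp
  have "\<forall>i. \<exists>y\<in>carrier K. y [^]\<^bsub>K\<^esub> p = x (Suc i)"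
    using x frobenius_surj[OF field finite char] by (simp add: witt_def)
  then obtain y where y: "\<And>i. y i \<in> carrier K" "\<And>i. y i [^]\<^bsub>K\<^esub> p = x (Suc i)" by metis
  then have yW: "y \<in> carrier (witt p K)" by (simp add: witt_def)
  have "add_pow K p \<one>\<^bsub>K\<^esub> = \<zero>\<^bsub>K\<^esub>" using char by (simp add: has_char_def)
  from witt_add_pow_p[OF K.is_cring p_prime this yW] have "add_pow (witt p K) p y = x"
    using x0 y by (auto simp: fun_eq_iff split: nat.splits)
  then have "C = add_pow R p (I +>\<^bsub>witt p K\<^esub> y)"
    using ring_hom_add_pow[OF W.is_cring R_cring coset_hom yW, of p] x by simp
  then show ?thesis using yW by (auto simp: carrier_R)
qed

lemma p_nilpotent: "add_pow R (p ^ m) \<one>\<^bsub>R\<^esub> = \<zero>\<^bsub>R\<^esub>"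
proof -
  have "add_pow R (p ^ m) \<one>\<^bsub>R\<^esub> = I +>\<^bsub>witt p K\<^esub> (add_pow (witt p K) (p ^ m) \<one>\<^bsub>witt p K\<^esub>)"
    using ring_hom_add_pow[OF W.is_cring R_cring coset_hom W.one_closed] ring_hom_one[OF coset_hom] by simp
  also have "\<dots> = I" by (intro I.a_rcos_const W.cgenideal_self) simp
  finally show ?thesis by (simp add: witt_quot_def FactRing_def)
qed

end

section \<open>Complete local rings and Teichmueller representatives\<close>

lemma (in field) finite_field_pow_card:
  assumes "finite (carrier R)" "a \<in> carrier R"
  shows "a [^] card (carrier R) = a"
proof (cases "a = \<zero>")
  case True
  have "card (carrier R) \<noteq> 0" using assms by (metis card_0_eq empty_iff)
  then show ?thesis unfolding True by (rule nat_pow_zero)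
next
  case False
  let ?M = "Multiplicative_Group.mult_of R"
  interpret M: group ?M by (rule field_mult_group)
  have "a [^]\<^bsub>?M\<^esub> Coset.order ?M = \<one>\<^bsub>?M\<^esub>"
    using assms(2) False by (intro M.pow_order_eq_1) simp
  then have "a [^] (card (carrier R) - 1) = \<one>"
    by (simp only: Coset.order_def Multiplicative_Group.mult_of_simps card_Diff_singleton[OF zero_closed])
  moreover have "card (carrier R) = Suc (card (carrier R) - 1)"
    using assms by (metis Suc_pred' card_gt_0_iff empty_iff)
  ultimately have "a [^] card (carrier R) = \<one> \<otimes> a" by (metis nat_pow_Suc)
  then show ?thesis using assms(2) by (simp only: l_one)
qed

text \<open>Pigeonhole: more than half of the elements are squares, so the sets of all \<open>a \<otimes> a\<close> and of all
\<open>x \<ominus> b \<otimes> b\<close> intersect.\<close>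

lemma (in field) two_squares:
  assumes fin: "finite (carrier R)" and x: "x \<in> carrier R"
  shows "\<exists>a\<in>carrier R. \<exists>b\<in>carrier R. x = a \<otimes> a \<oplus> b \<otimes> b"
proof -
  let ?sq = "\<lambda>a. a \<otimes> a"
  let ?S' = "?sq ` (carrier R - {\<zero>})"
  let ?S = "?sq ` carrier R"
  have finS: "finite ?S'" "finite ?S" using fin by auto
  have fib: "card {a \<in> carrier R. ?sq a = s} \<le> 2" if s: "s \<in> ?S'" for s
  proof -
    obtain b where b: "b \<in> carrier R" "s = ?sq b" using s by auto
    have "{a \<in> carrier R. ?sq a = s} \<subseteq> {b, \<ominus> b}"
    proof
      fix a assume "a \<in> {a \<in> carrier R. ?sq a = s}"
      then have a: "a \<in> carrier R" "?sq a = ?sq b" using b by auto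
      have "(a \<ominus> b) \<otimes> (a \<oplus> b) = ?sq a \<ominus> ?sq b" using a(1) b(1) by algebra
      also have "\<dots> = \<zero>" using a b by simp
      finally have "a \<ominus> b = \<zero> \<or> a \<oplus> b = \<zero>" using a b integral[of "a \<ominus> b" "a \<oplus> b"] by simp
      then show "a \<in> {b, \<ominus> b}" using a b by (auto simp: minus_equality)
    qed
    then have "card {a \<in> carrier R. ?sq a = s} \<le> card {b, \<ominus> b}" by (intro card_mono) auto
    also have "\<dots> \<le> 2" by (simp add: card_insert_if)
    finally show ?thesis .
  qed
  have "card (carrier R - {\<zero>}) \<le> card (\<Union>s\<in>?S'. {a \<in> carrier R. ?sq a = s})"
    using fin finS by (intro card_mono) auto
  also have "\<dots> \<le> (\<Sum>s\<in>?S'. card {a \<in> carrier R. ?sq a = s})"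
    using finS by (intro card_UN_le)
  also have "\<dots> \<le> (\<Sum>s\<in>?S'. 2)" using fib by (intro sum_mono) auto
  finally have 1: "card (carrier R - {\<zero>}) \<le> 2 * card ?S'" by simp
  have "?S = insert \<zero> ?S'" by (auto simp: image_iff intro!: bexI[of _ \<zero>])
  moreover have "\<zero> \<notin> ?S'"
  proof
    assume "\<zero> \<in> ?S'"
    then obtain a where a: "\<zero> = a \<otimes> a" "a \<in> carrier R" "a \<noteq> \<zero>" by blast
    from integral[OF a(1)[symmetric] a(2,2)] a(3) show False by blast
  qed
  ultimately have 2: "card ?S = Suc (card ?S')" using finS by simp
  have "card (carrier R) = Suc (card (carrier R - {\<zero>}))"
    by (rule card.remove[OF fin zero_closed])
  with 1 2 have 3: "card (carrier R) < 2 * card ?S" by linarith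
  let ?T = "(\<lambda>s. x \<ominus> s) ` ?S"
  have "inj_on (\<lambda>s. x \<ominus> s) ?S"
  proof (rule inj_onI)
    fix s t assume st: "s \<in> ?S" "t \<in> ?S" "x \<ominus> s = x \<ominus> t"
    have "s = x \<ominus> (x \<ominus> s)" "t = x \<ominus> (x \<ominus> t)" using st(1,2) x by (auto, algebra+)
    then show "s = t" using st(3) by simp
  qed
  then have "card ?T = card ?S" by (rule card_image)
  have "?S \<inter> ?T \<noteq> {}"
  proof
    assume "?S \<inter> ?T = {}"
    then have "card ?S + card ?T = card (?S \<union> ?T)" using finS by (simp add: card_Un_disjoint)
    also have "\<dots> \<le> card (carrier R)" using fin x by (intro card_mono) auto
    finally show False using 3 \<open>card ?T = card ?S\<close> by simp
  qed
  then obtain a b where ab: "a \<in> carrier R" "b \<in> carrier R" "?sq a = x \<ominus> ?sq b" by auto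
  have "x = (x \<ominus> ?sq b) \<oplus> ?sq b" using ab(2) x by algebra
  then show ?thesis using ab by metis
qed

lemma (in cring) sub_one_cancel:
  assumes "a \<in> carrier R" "z \<in> carrier R"
  shows "a \<oplus> (\<one> \<ominus> z) \<ominus> \<one> = a \<ominus> z"
proof -
  have "a \<oplus> (\<one> \<ominus> z) \<ominus> \<one> = a \<oplus> (\<one> \<oplus> (\<ominus> z \<oplus> \<ominus> \<one>))"
    using assms by (simp add: a_minus_def a_assoc)
  also have "\<ominus> z \<oplus> \<ominus> \<one> = \<ominus> \<one> \<oplus> \<ominus> z" using assms by (simp add: a_comm)
  finally show ?thesis using assms by (simp add: a_minus_def r_neg2)
qed

lemma (in cring) mult_sub_add:
  assumes "u \<in> carrier R" "y \<in> carrier R" "s \<in> carrier R"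
  shows "u \<otimes> (y \<ominus> s) \<oplus> u \<otimes> s = u \<otimes> y"
proof -
  have "y \<ominus> s \<oplus> s = y" using assms by (simp add: a_minus_def a_assoc l_neg)
  then show ?thesis using assms by (simp flip: r_distr)
qed

locale residue_map = A: cring A + K: field K
  for A :: "('a, 'c) ring_scheme" and K :: "('k, 'd) ring_scheme" +
  fixes \<pi> :: "'a \<Rightarrow> 'k"
  assumes hom: "\<pi> \<in> ring_hom A K" and surj: "\<pi> ` carrier A = carrier K"
begin

sublocale ring_hom_cring A K \<pi> by unfold_locales (rule hom)

abbreviation "\<mm> \<equiv> a_kernel A K \<pi>"

lemma mem_ker: "x \<in> \<mm> \<longleftrightarrow> x \<in> carrier A \<and> \<pi> x = \<zero>\<^bsub>K\<^esub>"
  unfolding a_kernel_def' by blast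

sublocale ker: ideal \<mm> A
proof -
  have "ring_hom_ring A K \<pi>"
    by (intro ring_hom_ringI2 A.ring_axioms K.ring_axioms hom)
  then show "ideal \<mm> A" by (rule ring_hom_ring.kernel_is_ideal)
qed

definition pw :: "nat \<Rightarrow> 'a set" where "pw i = \<mm> [^]\<^bsub>ideals_set A\<^esub> i"

lemma pw_0 [simp]: "pw 0 = carrier A"
  by (simp add: pw_def ideals_set_def)

lemma pw_Suc: "pw (Suc i) = ideal_prod A (pw i) \<mm>"
  by (simp add: pw_def ideals_set_def)

lemma pw_ideal: "ideal (pw i) A"
proof (induction i)
  case (Suc i)
  then show ?case unfolding pw_Suc by (rule A.ideal_prod_is_ideal) (rule ker.is_ideal)
qed (simp add: A.oneideal)

lemma pw_minus: "x \<in> pw i \<Longrightarrow> y \<in> pw i \<Longrightarrow> x \<ominus>\<^bsub>A\<^esub> y \<in> pw i"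
  and pw_add: "x \<in> pw i \<Longrightarrow> y \<in> pw i \<Longrightarrow> x \<oplus>\<^bsub>A\<^esub> y \<in> pw i"
  and pw_l: "x \<in> pw i \<Longrightarrow> a \<in> carrier A \<Longrightarrow> a \<otimes>\<^bsub>A\<^esub> x \<in> pw i"
proof -
  interpret P: ideal "pw i" A by (rule pw_ideal)
  show "x \<in> pw i \<Longrightarrow> y \<in> pw i \<Longrightarrow> x \<ominus>\<^bsub>A\<^esub> y \<in> pw i" by (simp add: a_minus_def P.a_closed P.a_inv_closed)
  show "x \<in> pw i \<Longrightarrow> y \<in> pw i \<Longrightarrow> x \<oplus>\<^bsub>A\<^esub> y \<in> pw i" by (rule P.a_closed)
  show "x \<in> pw i \<Longrightarrow> a \<in> carrier A \<Longrightarrow> a \<otimes>\<^bsub>A\<^esub> x \<in> pw i" by (rule P.I_l_closed)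
qed

lemma pw_mult: "x \<in> pw i \<Longrightarrow> y \<in> \<mm> \<Longrightarrow> x \<otimes>\<^bsub>A\<^esub> y \<in> pw (Suc i)"
  unfolding pw_Suc by (rule ideal_prod.prod)

lemma pw_Suc_subset: "pw (Suc i) \<subseteq> pw i"
  unfolding pw_Suc using A.ideal_prod_inter[OF pw_ideal ker.is_ideal] by blast

lemma pw_antimono: "i \<le> j \<Longrightarrow> pw j \<subseteq> pw i"
  by (rule lift_Suc_antimono_le[of pw, OF pw_Suc_subset])

lemma pw_1: "pw (Suc 0) = \<mm>"
proof
  show "pw (Suc 0) \<subseteq> \<mm>" unfolding pw_Suc using A.ideal_prod_inter[OF pw_ideal ker.is_ideal] by blast
  show "\<mm> \<subseteq> pw (Suc 0)"
  proof
    fix x assume x: "x \<in> \<mm>"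
    have "\<one>\<^bsub>A\<^esub> \<otimes>\<^bsub>A\<^esub> x \<in> pw (Suc 0)" using x by (intro pw_mult) auto
    then show "x \<in> pw (Suc 0)" using x by (simp add: mem_ker)
  qed
qed

lemma pw_nat_pow: "x \<in> \<mm> \<Longrightarrow> x [^]\<^bsub>A\<^esub> i \<in> pw i"
  by (induction i) (simp_all add: pw_mult)

end

locale complete_residue = residue_map +
  assumes complete: "adic_complete A \<mm>" and finK: "finite (carrier K)"
begin

lemma separated: "x \<in> carrier A \<Longrightarrow> (\<And>i. x \<in> pw i) \<Longrightarrow> x = \<zero>\<^bsub>A\<^esub>"
  using complete unfolding adic_complete_def pw_def by blast

lemma limit:
  assumes "\<And>i. a i \<in> carrier A" "\<And>i. a (Suc i) \<ominus>\<^bsub>A\<^esub> a i \<in> pw i"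
  obtains x where "x \<in> carrier A" "\<And>i. x \<ominus>\<^bsub>A\<^esub> a i \<in> pw i"
  using complete assms unfolding adic_complete_def pw_def by blast

text \<open>The inverse is the limit of the partial sums of the geometric series.\<close>

lemma unit_one_minus:
  assumes x: "x \<in> \<mm>"
  shows "\<one>\<^bsub>A\<^esub> \<ominus>\<^bsub>A\<^esub> x \<in> Units A"
proof -
  have xA: "x \<in> carrier A" using x by (simp add: mem_ker)
  define s where "s i = (\<Oplus>\<^bsub>A\<^esub>j\<in>{..<i}. x [^]\<^bsub>A\<^esub> j)" for i :: nat
  have s: "s i \<in> carrier A" for i unfolding s_def using xA by auto
  have s_Suc: "s (Suc i) = x [^]\<^bsub>A\<^esub> i \<oplus>\<^bsub>A\<^esub> s i" for i
    unfolding s_def lessThan_Suc using xA by simp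
  have s0: "s 0 = \<zero>\<^bsub>A\<^esub>" by (simp add: s_def)
  have "s (Suc i) \<ominus>\<^bsub>A\<^esub> s i = x [^]\<^bsub>A\<^esub> i" for i
  proof -
    have "x [^]\<^bsub>A\<^esub> i \<in> carrier A" using xA by simp
    then show ?thesis unfolding s_Suc using s[of i] by algebra
  qed
  then have "s (Suc i) \<ominus>\<^bsub>A\<^esub> s i \<in> pw i" for i using pw_nat_pow[OF x] by simp
  with s obtain y where y: "y \<in> carrier A" "\<And>i. y \<ominus>\<^bsub>A\<^esub> s i \<in> pw i" by (rule limit) auto
  have geo: "(\<one>\<^bsub>A\<^esub> \<ominus>\<^bsub>A\<^esub> x) \<otimes>\<^bsub>A\<^esub> s i = \<one>\<^bsub>A\<^esub> \<ominus>\<^bsub>A\<^esub> x [^]\<^bsub>A\<^esub> i" for i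
  proof (induction i)
    case 0
    show ?case using xA by (simp add: s0 a_minus_def A.r_neg)
  next
    case (Suc i)
    let ?z = "x [^]\<^bsub>A\<^esub> i"
    have z: "?z \<in> carrier A" using xA by simp
    have "(\<one>\<^bsub>A\<^esub> \<ominus>\<^bsub>A\<^esub> x) \<otimes>\<^bsub>A\<^esub> s (Suc i) = (\<one>\<^bsub>A\<^esub> \<ominus>\<^bsub>A\<^esub> x) \<otimes>\<^bsub>A\<^esub> ?z \<oplus>\<^bsub>A\<^esub> (\<one>\<^bsub>A\<^esub> \<ominus>\<^bsub>A\<^esub> x) \<otimes>\<^bsub>A\<^esub> s i"
      unfolding s_Suc using xA z s[of i] by (simp add: A.r_distr)
    also have "\<dots> = (\<one>\<^bsub>A\<^esub> \<ominus>\<^bsub>A\<^esub> x) \<otimes>\<^bsub>A\<^esub> ?z \<oplus>\<^bsub>A\<^esub> (\<one>\<^bsub>A\<^esub> \<ominus>\<^bsub>A\<^esub> ?z)" unfolding Suc ..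
    also have "\<dots> = \<one>\<^bsub>A\<^esub> \<ominus>\<^bsub>A\<^esub> ?z \<otimes>\<^bsub>A\<^esub> x" using z xA by algebra
    finally show ?case by simp
  qed
  have "(\<one>\<^bsub>A\<^esub> \<ominus>\<^bsub>A\<^esub> x) \<otimes>\<^bsub>A\<^esub> y \<ominus>\<^bsub>A\<^esub> \<one>\<^bsub>A\<^esub> \<in> pw i" for i
  proof -
    define z u where "z = x [^]\<^bsub>A\<^esub> i" and "u = \<one>\<^bsub>A\<^esub> \<ominus>\<^bsub>A\<^esub> x"
    have cl: "u \<in> carrier A" "z \<in> carrier A" "s i \<in> carrier A" using xA s by (simp_all add: z_def u_def)
    have us: "u \<otimes>\<^bsub>A\<^esub> s i = \<one>\<^bsub>A\<^esub> \<ominus>\<^bsub>A\<^esub> z" using geo[of i] by (simp add: z_def u_def)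
    have "u \<otimes>\<^bsub>A\<^esub> y = u \<otimes>\<^bsub>A\<^esub> (y \<ominus>\<^bsub>A\<^esub> s i) \<oplus>\<^bsub>A\<^esub> u \<otimes>\<^bsub>A\<^esub> s i"
      by (rule A.mult_sub_add[OF cl(1) y(1) cl(3), symmetric])
    then have "u \<otimes>\<^bsub>A\<^esub> y \<ominus>\<^bsub>A\<^esub> \<one>\<^bsub>A\<^esub> = u \<otimes>\<^bsub>A\<^esub> (y \<ominus>\<^bsub>A\<^esub> s i) \<oplus>\<^bsub>A\<^esub> (\<one>\<^bsub>A\<^esub> \<ominus>\<^bsub>A\<^esub> z) \<ominus>\<^bsub>A\<^esub> \<one>\<^bsub>A\<^esub>"
      by (simp only: us)
    also have "\<dots> = u \<otimes>\<^bsub>A\<^esub> (y \<ominus>\<^bsub>A\<^esub> s i) \<ominus>\<^bsub>A\<^esub> z"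
      using cl y(1) by (intro A.sub_one_cancel) simp_all
    also have "\<dots> \<in> pw i"
      unfolding z_def by (intro pw_minus pw_l y pw_nat_pow x cl)
    finally have "u \<otimes>\<^bsub>A\<^esub> y \<ominus>\<^bsub>A\<^esub> \<one>\<^bsub>A\<^esub> \<in> pw i" .
    then show ?thesis by (simp only: u_def)
  qed
  then have "(\<one>\<^bsub>A\<^esub> \<ominus>\<^bsub>A\<^esub> x) \<otimes>\<^bsub>A\<^esub> y \<ominus>\<^bsub>A\<^esub> \<one>\<^bsub>A\<^esub> = \<zero>\<^bsub>A\<^esub>"
    using xA y by (intro separated) auto
  then have "(\<one>\<^bsub>A\<^esub> \<ominus>\<^bsub>A\<^esub> x) \<otimes>\<^bsub>A\<^esub> y = \<one>\<^bsub>A\<^esub>" using xA y by simp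
  moreover then have "y \<otimes>\<^bsub>A\<^esub> (\<one>\<^bsub>A\<^esub> \<ominus>\<^bsub>A\<^esub> x) = \<one>\<^bsub>A\<^esub>" using xA y by (simp add: A.m_comm)
  ultimately show ?thesis using xA y by (auto simp: Units_def)
qed

lemma unit_iff:
  assumes x: "x \<in> carrier A"
  shows "x \<in> Units A \<longleftrightarrow> \<pi> x \<noteq> \<zero>\<^bsub>K\<^esub>"
proof
  assume "\<pi> x \<noteq> \<zero>\<^bsub>K\<^esub>"
  then have u: "\<pi> x \<in> Units K" using K.field_Units ring_hom_closed[OF hom x] by blast
  then have "inv\<^bsub>K\<^esub> (\<pi> x) \<in> \<pi> ` carrier A" unfolding surj by (rule K.Units_inv_closed)
  then obtain y where y: "y \<in> carrier A" "inv\<^bsub>K\<^esub> (\<pi> x) = \<pi> y" by blast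
  have xy: "\<pi> (x \<otimes>\<^bsub>A\<^esub> y) = \<one>\<^bsub>K\<^esub>"
    using K.Units_r_inv[OF u] unfolding y(2) ring_hom_mult[OF hom x y(1)] .
  have xyA: "x \<otimes>\<^bsub>A\<^esub> y \<in> carrier A" by (rule A.m_closed[OF x y(1)])
  have "\<pi> (\<one>\<^bsub>A\<^esub> \<ominus>\<^bsub>A\<^esub> x \<otimes>\<^bsub>A\<^esub> y) = \<pi> \<one>\<^bsub>A\<^esub> \<ominus>\<^bsub>K\<^esub> \<pi> (x \<otimes>\<^bsub>A\<^esub> y)"
    by (rule hom_sub[OF A.one_closed xyA])
  also have "\<dots> = \<zero>\<^bsub>K\<^esub>" unfolding xy ring_hom_one[OF hom] by (simp add: a_minus_def K.r_neg)
  finally have "\<one>\<^bsub>A\<^esub> \<ominus>\<^bsub>A\<^esub> x \<otimes>\<^bsub>A\<^esub> y \<in> \<mm>" unfolding mem_ker using A.minus_closed[OF A.one_closed xyA] by blast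
  from unit_one_minus[OF this] have "\<one>\<^bsub>A\<^esub> \<ominus>\<^bsub>A\<^esub> (\<one>\<^bsub>A\<^esub> \<ominus>\<^bsub>A\<^esub> x \<otimes>\<^bsub>A\<^esub> y) \<in> Units A" .
  moreover have "\<one>\<^bsub>A\<^esub> \<ominus>\<^bsub>A\<^esub> (\<one>\<^bsub>A\<^esub> \<ominus>\<^bsub>A\<^esub> x \<otimes>\<^bsub>A\<^esub> y) = x \<otimes>\<^bsub>A\<^esub> y" using x y by algebra
  ultimately have "x \<otimes>\<^bsub>A\<^esub> y \<in> Units A" by (simp only:)
  then show "x \<in> Units A" by (rule A.unit_factor[OF _ x y(1)])
next
  assume u: "x \<in> Units A"
  have "\<pi> x \<otimes>\<^bsub>K\<^esub> \<pi> (inv\<^bsub>A\<^esub> x) = \<one>\<^bsub>K\<^esub>"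
    using ring_hom_mult[OF hom x A.Units_inv_closed[OF u]] A.Units_r_inv[OF u] ring_hom_one[OF hom]
    by (simp only:)
  moreover have "\<pi> (inv\<^bsub>A\<^esub> x) \<in> carrier K" by (rule ring_hom_closed[OF hom A.Units_inv_closed[OF u]])
  ultimately show "\<pi> x \<noteq> \<zero>\<^bsub>K\<^esub>" using K.l_null K.one_not_zero by metis
qed

text \<open>The second factor of \<open>x ^ q - y ^ q\<close> in \<open>power_diff_factor\<close> lies in the maximal ideal, since
\<open>q\<close> vanishes in the residue field and so does \<open>x \<ominus> y\<close>.\<close>

lemma pow_card_diff:
  assumes xy: "x \<in> carrier A" "y \<in> carrier A" "x \<ominus>\<^bsub>A\<^esub> y \<in> pw (Suc i)"
  shows "x [^]\<^bsub>A\<^esub> card (carrier K) \<ominus>\<^bsub>A\<^esub> y [^]\<^bsub>A\<^esub> card (carrier K) \<in> pw (Suc (Suc i))"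
proof -
  let ?q = "card (carrier K)"
  have "(if b then x else y) \<in> carrier A" for b using xy by simp
  from generic_lift[where x = "\<lambda>b. if b then x else y", OF A.is_cring this] obtain h Y where
    h: "h \<in> ring_hom PR A" and Y: "\<forall>b. h (Y b) = (if b then x else y)" by auto
  interpret h: ring_hom_cring PR A h
    using h by (simp add: ring_hom_cring_def ring_hom_cring_axioms_def cring_type_ring A.is_cring)
  obtain c where c: "Y True ^ ?q - Y False ^ ?q = (Y True - Y False) * (of_nat ?q * Y False ^ (?q - 1)
      + (Y True - Y False) * c)" using power_diff_factor by blast
  let ?n = "h (of_nat ?q)"
  have d: "h (Y True - Y False) = x \<ominus>\<^bsub>A\<^esub> y" using h.hom_sub[of "Y True" "Y False"] Y by simp
  have pow: "h (a ^ n) = h a [^]\<^bsub>A\<^esub> n" for a n using h.hom_nat_pow[of a n] by simp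
  have "h (Y True ^ ?q - Y False ^ ?q) = x [^]\<^bsub>A\<^esub> ?q \<ominus>\<^bsub>A\<^esub> y [^]\<^bsub>A\<^esub> ?q"
    using h.hom_sub[of "Y True ^ ?q" "Y False ^ ?q"] Y by (simp add: pow)
  moreover have "h ((Y True - Y False) * (of_nat ?q * Y False ^ (?q - 1) + (Y True - Y False) * c)) =
     (x \<ominus>\<^bsub>A\<^esub> y) \<otimes>\<^bsub>A\<^esub> (?n \<otimes>\<^bsub>A\<^esub> y [^]\<^bsub>A\<^esub> (?q - 1) \<oplus>\<^bsub>A\<^esub> (x \<ominus>\<^bsub>A\<^esub> y) \<otimes>\<^bsub>A\<^esub> h c)"
    using h.hom_mult[of "Y True - Y False" "of_nat ?q * Y False ^ (?q - 1) + (Y True - Y False) * c"]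
      h.hom_add[of "of_nat ?q * Y False ^ (?q - 1)" "(Y True - Y False) * c"]
      h.hom_mult[of "of_nat ?q" "Y False ^ (?q - 1)"] h.hom_mult[of "Y True - Y False" c] d Y
    by (simp add: pow)
  ultimately have eq: "x [^]\<^bsub>A\<^esub> ?q \<ominus>\<^bsub>A\<^esub> y [^]\<^bsub>A\<^esub> ?q =
     (x \<ominus>\<^bsub>A\<^esub> y) \<otimes>\<^bsub>A\<^esub> (?n \<otimes>\<^bsub>A\<^esub> y [^]\<^bsub>A\<^esub> (?q - 1) \<oplus>\<^bsub>A\<^esub> (x \<ominus>\<^bsub>A\<^esub> y) \<otimes>\<^bsub>A\<^esub> h c)"
    using c by simp
  have hom_n: "h (of_nat n) = add_pow A n \<one>\<^bsub>A\<^esub>" for n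
  proof (induction n)
    case 0
    show ?case using h.hom_zero by simp
  next
    case (Suc n)
    then show ?case using h.hom_add[of "of_nat n" 1] h.hom_one by (simp add: add.commute)
  qed
  have pi_n: "\<pi> (add_pow A n \<one>\<^bsub>A\<^esub>) = add_pow K n \<one>\<^bsub>K\<^esub>" for n :: nat
    by (induction n) simp_all
  have "add_pow K ?q \<one>\<^bsub>K\<^esub> = \<zero>\<^bsub>K\<^esub>"
    using K.add.pow_order_eq_1[of "\<one>\<^bsub>K\<^esub>"] finK by (simp add: Coset.order_def)
  then have "?n \<in> \<mm>" by (simp add: mem_ker hom_n pi_n)
  moreover have "x \<ominus>\<^bsub>A\<^esub> y \<in> \<mm>" using xy(3) pw_antimono[of "Suc 0" "Suc i"] pw_1 by auto
  moreover have "h c \<in> carrier A" using h.hom_closed[of c] by simp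
  ultimately have "?n \<otimes>\<^bsub>A\<^esub> y [^]\<^bsub>A\<^esub> (?q - 1) \<oplus>\<^bsub>A\<^esub> (x \<ominus>\<^bsub>A\<^esub> y) \<otimes>\<^bsub>A\<^esub> h c \<in> \<mm>"
    using xy by (intro ker.a_closed ker.I_r_closed) auto
  then show ?thesis unfolding eq by (rule pw_mult[OF xy(3)])
qed

text \<open>The \<open>q ^ i\<close>-th powers of any preimage converge by \<open>pow_card_diff\<close>.  The same estimate shows that
two solutions that are congruent modulo the maximal ideal are congruent modulo all its powers.\<close>

lemma teichmueller_ex1:
  assumes a: "a \<in> carrier K"
  shows "\<exists>!x. x \<in> carrier A \<and> \<pi> x = a \<and> x [^]\<^bsub>A\<^esub> card (carrier K) = x"
proof (rule ex_ex1I)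
  let ?q = "card (carrier K)"
  obtain x0 where x0: "x0 \<in> carrier A" "\<pi> x0 = a" using a surj by (metis imageE)
  define b where "b i = x0 [^]\<^bsub>A\<^esub> (?q ^ i)" for i :: nat
  have b: "b i \<in> carrier A" for i using x0 by (simp add: b_def)
  have b_Suc: "b (Suc i) = b i [^]\<^bsub>A\<^esub> ?q" for i
    using x0 by (simp add: b_def A.nat_pow_pow mult.commute)
  have b_diff: "b (Suc i) \<ominus>\<^bsub>A\<^esub> b i \<in> pw (Suc i)" for i
  proof (induction i)
    case 0
    have "b 0 = x0" using x0 by (simp add: b_def)
    moreover have "\<pi> (x0 [^]\<^bsub>A\<^esub> ?q \<ominus>\<^bsub>A\<^esub> x0) = \<zero>\<^bsub>K\<^esub>"
      using x0 a K.finite_field_pow_card[OF finK a] by (simp add: hom_nat_pow a_minus_def K.r_neg)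
    ultimately show ?case unfolding b_Suc pw_1 using x0 by (simp add: mem_ker)
  next
    case (Suc i)
    then show ?case using pow_card_diff[OF b b, of "Suc i" i] by (simp add: b_Suc)
  qed
  then have "b (Suc i) \<ominus>\<^bsub>A\<^esub> b i \<in> pw i" for i using pw_Suc_subset by blast
  with b obtain x where x: "x \<in> carrier A" "\<And>i. x \<ominus>\<^bsub>A\<^esub> b i \<in> pw i" by (rule limit) auto
  have "\<pi> (b i) = a" for i
    by (induction i) (use x0 in \<open>simp add: b_def\<close>, use b K.finite_field_pow_card[OF finK a] in \<open>simp add: b_Suc hom_nat_pow\<close>)
  moreover have "\<pi> (x \<ominus>\<^bsub>A\<^esub> b (Suc 0)) = \<zero>\<^bsub>K\<^esub>" using x(2)[of "Suc 0"] by (simp only: pw_1 mem_ker)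
  ultimately have pix: "\<pi> x = a" using x(1) b a by simp
  have "x [^]\<^bsub>A\<^esub> ?q \<ominus>\<^bsub>A\<^esub> x \<in> pw i" for i
  proof -
    have "x [^]\<^bsub>A\<^esub> ?q \<ominus>\<^bsub>A\<^esub> b (Suc i) [^]\<^bsub>A\<^esub> ?q \<in> pw (Suc (Suc i))"
      by (rule pow_card_diff[OF x(1) b x(2)])
    then have 1: "x [^]\<^bsub>A\<^esub> ?q \<ominus>\<^bsub>A\<^esub> b (Suc (Suc i)) \<in> pw (Suc (Suc i))" by (simp only: b_Suc)
    have "x [^]\<^bsub>A\<^esub> ?q \<ominus>\<^bsub>A\<^esub> x = (x [^]\<^bsub>A\<^esub> ?q \<ominus>\<^bsub>A\<^esub> b (Suc (Suc i))) \<ominus>\<^bsub>A\<^esub> (x \<ominus>\<^bsub>A\<^esub> b (Suc (Suc i)))"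
    proof -
      have "x [^]\<^bsub>A\<^esub> ?q \<in> carrier A" using x by simp
      then show ?thesis using x(1) b[of "Suc (Suc i)"] by algebra
    qed
    also have "\<dots> \<in> pw (Suc (Suc i))" by (rule pw_minus[OF 1 x(2)])
    finally show ?thesis using pw_antimono[of i "Suc (Suc i)"] by auto
  qed
  then have "x [^]\<^bsub>A\<^esub> ?q \<ominus>\<^bsub>A\<^esub> x = \<zero>\<^bsub>A\<^esub>" using x by (intro separated) auto
  then have "x [^]\<^bsub>A\<^esub> ?q = x" using x by simp
  then show "\<exists>x. x \<in> carrier A \<and> \<pi> x = a \<and> x [^]\<^bsub>A\<^esub> ?q = x" using x pix by blast
next
  let ?q = "card (carrier K)"
  fix x y
  assume x: "x \<in> carrier A \<and> \<pi> x = a \<and> x [^]\<^bsub>A\<^esub> ?q = x"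
    and y: "y \<in> carrier A \<and> \<pi> y = a \<and> y [^]\<^bsub>A\<^esub> ?q = y"
  have "x \<ominus>\<^bsub>A\<^esub> y \<in> pw (Suc i)" for i
  proof (induction i)
    case 0
    show ?case unfolding pw_1 using x y a by (simp add: mem_ker)
  next
    case (Suc i)
    then show ?case using pow_card_diff[of x y i] x y by simp
  qed
  then have "x \<ominus>\<^bsub>A\<^esub> y = \<zero>\<^bsub>A\<^esub>" using x y pw_Suc_subset by (intro separated) auto
  then show "x = y" using x y by simp
qed

definition tau :: "'c \<Rightarrow> 'a" where
  "tau a = (THE x. x \<in> carrier A \<and> \<pi> x = a \<and> x [^]\<^bsub>A\<^esub> card (carrier K) = x)"

end

section \<open>Additive maps on rings whose maximal ideal is generated by a nilpotent p\<close>

context complete_residue begin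

lemma tau:
  assumes "a \<in> carrier K"
  shows tau_closed: "tau a \<in> carrier A" and pi_tau: "\<pi> (tau a) = a"
    and tau_pow: "tau a [^]\<^bsub>A\<^esub> card (carrier K) = tau a"
  using theI'[OF teichmueller_ex1[OF assms]] unfolding tau_def by blast+

lemma tau_eqI:
  assumes "x \<in> carrier A" "x [^]\<^bsub>A\<^esub> card (carrier K) = x" "\<pi> x = a"
  shows "tau a = x"
  unfolding tau_def
proof (rule the1_equality)
  show "\<exists>!x. x \<in> carrier A \<and> \<pi> x = a \<and> x [^]\<^bsub>A\<^esub> card (carrier K) = x"
    by (rule teichmueller_ex1) (use ring_hom_closed[OF hom assms(1)] assms(3) in blast)
qed (use assms in blast)

lemma tau_mult:
  assumes a: "a \<in> carrier K" and b: "b \<in> carrier K"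
  shows "tau (a \<otimes>\<^bsub>K\<^esub> b) = tau a \<otimes>\<^bsub>A\<^esub> tau b"
proof (rule tau_eqI)
  show "tau a \<otimes>\<^bsub>A\<^esub> tau b \<in> carrier A" using tau_closed a b by blast
  show "(tau a \<otimes>\<^bsub>A\<^esub> tau b) [^]\<^bsub>A\<^esub> card (carrier K) = tau a \<otimes>\<^bsub>A\<^esub> tau b"
    unfolding A.nat_pow_distrib[OF tau_closed[OF a] tau_closed[OF b]] tau_pow[OF a] tau_pow[OF b] ..
  show "\<pi> (tau a \<otimes>\<^bsub>A\<^esub> tau b) = a \<otimes>\<^bsub>K\<^esub> b"
    unfolding ring_hom_mult[OF hom tau_closed[OF a] tau_closed[OF b]] pi_tau[OF a] pi_tau[OF b] ..
qed

lemma tau_one: "tau \<one>\<^bsub>K\<^esub> = \<one>\<^bsub>A\<^esub>"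
  by (rule tau_eqI) (simp_all add: ring_hom_one[OF hom])

lemma tau_zero: "tau \<zero>\<^bsub>K\<^esub> = \<zero>\<^bsub>A\<^esub>"
proof (rule tau_eqI)
  have "card (carrier K) \<noteq> 0" using finK K.one_closed by (metis card_0_eq empty_iff)
  then show "\<zero>\<^bsub>A\<^esub> [^]\<^bsub>A\<^esub> card (carrier K) = \<zero>\<^bsub>A\<^esub>" by (rule A.nat_pow_zero)
qed simp_all

lemma tau_diff_unit:
  assumes c: "c \<in> carrier K" and d: "d \<in> carrier K" and "c \<noteq> d"
  shows "tau c \<ominus>\<^bsub>A\<^esub> tau d \<in> Units A"
proof -
  have "\<pi> (tau c \<ominus>\<^bsub>A\<^esub> tau d) = c \<ominus>\<^bsub>K\<^esub> d"
    using hom_sub[OF tau_closed[OF c] tau_closed[OF d]] unfolding pi_tau[OF c] pi_tau[OF d] .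
  moreover have "c \<ominus>\<^bsub>K\<^esub> d \<noteq> \<zero>\<^bsub>K\<^esub>" using assms by simp
  moreover have "tau c \<ominus>\<^bsub>A\<^esub> tau d \<in> carrier A" using tau_closed c d by blast
  ultimately show ?thesis using unit_iff by metis
qed

lemma unit_mult_zero:
  assumes "u \<in> Units A" "x \<in> carrier A" "u \<otimes>\<^bsub>A\<^esub> x = \<zero>\<^bsub>A\<^esub>"
  shows "x = \<zero>\<^bsub>A\<^esub>"
  using assms A.Units_l_cancel[of u x "\<zero>\<^bsub>A\<^esub>"] A.Units_closed[of u] by simp

text \<open>The difference of two Teichmueller representatives is a unit, so an entry on which the torus acts
by two different scalars is zero.\<close>

lemma tau_cancel:
  assumes c: "c \<in> carrier K" and d: "d \<in> carrier K" and "c \<noteq> d"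
    and x: "x \<in> carrier A" and eq: "tau c \<otimes>\<^bsub>A\<^esub> x = tau d \<otimes>\<^bsub>A\<^esub> x"
  shows "x = \<zero>\<^bsub>A\<^esub>"
proof (rule unit_mult_zero[OF tau_diff_unit[OF assms(1-3)] x])
  have cl: "tau c \<in> carrier A" "tau d \<in> carrier A" using tau_closed c d by blast+
  have "(tau c \<ominus>\<^bsub>A\<^esub> tau d) \<otimes>\<^bsub>A\<^esub> x = tau c \<otimes>\<^bsub>A\<^esub> x \<ominus>\<^bsub>A\<^esub> tau d \<otimes>\<^bsub>A\<^esub> x"
    using cl x by algebra
  also have "\<dots> = \<zero>\<^bsub>A\<^esub>" unfolding eq using cl x by simp
  finally show "(tau c \<ominus>\<^bsub>A\<^esub> tau d) \<otimes>\<^bsub>A\<^esub> x = \<zero>\<^bsub>A\<^esub>" .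
qed

lemma tau_unit:
  assumes "a \<in> carrier K" "a \<noteq> \<zero>\<^bsub>K\<^esub>"
  shows "tau a \<in> Units A"
  using assms unit_iff[OF tau_closed] pi_tau by metis

lemma maximal: "maximalideal I A \<longleftrightarrow> I = \<mm>"
proof -
  have sub: "I \<subseteq> \<mm>" if I: "ideal I A" "I \<noteq> carrier A" for I
  proof
    interpret I: ideal I A by fact
    fix x assume x: "x \<in> I"
    have "x \<notin> Units A"
    proof
      assume u: "x \<in> Units A"
      have "inv\<^bsub>A\<^esub> x \<otimes>\<^bsub>A\<^esub> x \<in> I" by (rule I.I_l_closed[OF x A.Units_inv_closed[OF u]])
      then have "\<one>\<^bsub>A\<^esub> \<in> I" unfolding A.Units_l_inv[OF u] .
      then show False using I.one_imp_carrier I(2) by blast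
    qed
    then show "x \<in> \<mm>" unfolding mem_ker using unit_iff I.Icarr[OF x] by metis
  qed
  have ne: "\<mm> \<noteq> carrier A"
  proof
    assume "\<mm> = carrier A"
    then have "\<pi> \<one>\<^bsub>A\<^esub> = \<zero>\<^bsub>K\<^esub>" using mem_ker[of "\<one>\<^bsub>A\<^esub>"] by blast
    then show False using ring_hom_one[OF hom] K.one_not_zero by metis
  qed
  have max: "maximalideal \<mm> A"
  proof (rule maximalidealI)
    show "ideal \<mm> A" by (rule ker.is_ideal)
    show "carrier A \<noteq> \<mm>" using ne by blast
    show "J = \<mm> \<or> J = carrier A" if "ideal J A" "\<mm> \<subseteq> J" "J \<subseteq> carrier A" for J
      using sub[OF that(1)] that by blast
  qed
  show ?thesis
  proof
    assume I: "maximalideal I A"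
    then have "ideal I A" "I \<noteq> carrier A"
      using maximalideal.axioms(1) maximalideal.I_notcarr by blast+
    then have "I \<subseteq> \<mm>" by (rule sub)
    then show "I = \<mm>"
      using maximalideal.I_maximal[OF I ker.is_ideal] ne ker.a_subset by blast
  qed (use max in blast)
qed

end

lemma complete_residue_cln_ring:
  assumes "field K" "finite (carrier K)" "cln_ring K A \<pi>"
  shows "complete_residue A K \<pi>" "a_kernel A K \<pi> = max_ideal A"
proof -
  have A: "cring A" "adic_complete A (max_ideal A)" "\<pi> \<in> ring_hom A K" "\<pi> ` carrier A = carrier K"
    "a_kernel A K \<pi> = max_ideal A"
    using assms(3) unfolding cln_ring_def local_ring_def by blast+
  then show "a_kernel A K \<pi> = max_ideal A" by blast
  show "complete_residue A K \<pi>"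
    using A assms by (simp add: complete_residue_def residue_map_def residue_map_axioms_def complete_residue_axioms_def)
qed

lemma hom_tau:
  assumes R: "complete_residue R K \<pi>" and A: "complete_residue A K \<pi>'"
    and f: "f \<in> ring_hom R A" and pi: "\<And>x. x \<in> carrier R \<Longrightarrow> \<pi>' (f x) = \<pi> x"
    and a: "a \<in> carrier K"
  shows "f (complete_residue.tau R K \<pi> a) = complete_residue.tau A K \<pi>' a"
proof -
  interpret R: complete_residue R K \<pi> by (rule R)
  interpret A: complete_residue A K \<pi>' by (rule A)
  interpret f: ring_hom_cring R A f by (rule ring_hom_cringI[OF R.A.is_cring A.A.is_cring f])
  show ?thesis
  proof (rule A.tau_eqI[symmetric])
    show "f (R.tau a) \<in> carrier A" by (rule ring_hom_closed[OF f R.tau_closed[OF a]])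
    show "f (R.tau a) [^]\<^bsub>A\<^esub> card (carrier K) = f (R.tau a)"
      using f.hom_nat_pow[OF R.tau_closed[OF a], of "card (carrier K)"] unfolding R.tau_pow[OF a] by (rule sym)
    show "\<pi>' (f (R.tau a)) = a" unfolding pi[OF R.tau_closed[OF a]] by (rule R.pi_tau[OF a])
  qed
qed

text \<open>The properties of the Witt vectors modulo \<open>p ^ m\<close> on which the rest of the proof rests.\<close>

locale p_residue = residue_map +
  fixes p m :: nat
  assumes ker_p: "\<And>x. x \<in> \<mm> \<Longrightarrow> \<exists>y\<in>carrier A. x = add_pow A p y"
    and p_nil: "add_pow A (p ^ m) \<one>\<^bsub>A\<^esub> = \<zero>\<^bsub>A\<^esub>"
    and finite_K: "finite (carrier K)"
begin

lemma p_pow_zero: "x \<in> carrier A \<Longrightarrow> add_pow A (p ^ m) x = \<zero>\<^bsub>A\<^esub>"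
  using A.add_pow_ldistr[of "\<one>\<^bsub>A\<^esub>" x "p ^ m"] p_nil by simp

lemma pw_p: "x \<in> pw i \<Longrightarrow> \<exists>y\<in>carrier A. x = add_pow A (p ^ i) y"
proof (induction i arbitrary: x)
  case 0
  then show ?case by (intro bexI[of _ x]) simp_all
next
  case (Suc i)
  have "x \<in> ideal_prod A (pw i) \<mm>" using Suc.prems by (simp only: pw_Suc)
  then show ?case
  proof induction
    case (prod u v)
    obtain y where y: "y \<in> carrier A" "u = add_pow A (p ^ i) y" using Suc.IH[OF prod(1)] by blast
    obtain z where z: "z \<in> carrier A" "v = add_pow A p z" using ker_p[OF prod(2)] by blast
    have "u \<otimes>\<^bsub>A\<^esub> v = add_pow A (p ^ i) (y \<otimes>\<^bsub>A\<^esub> add_pow A p z)"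
      unfolding y z by (rule A.add_pow_ldistr) (use y z in simp_all)
    also have "y \<otimes>\<^bsub>A\<^esub> add_pow A p z = add_pow A p (y \<otimes>\<^bsub>A\<^esub> z)"
      by (rule A.add_pow_rdistr) (use y z in simp_all)
    also have "add_pow A (p ^ i) (add_pow A p (y \<otimes>\<^bsub>A\<^esub> z)) = add_pow A (p * p ^ i) (y \<otimes>\<^bsub>A\<^esub> z)"
      by (rule A.add.nat_pow_pow) (use y z in simp)
    finally show ?case using y z by (intro bexI[of _ "y \<otimes>\<^bsub>A\<^esub> z"]) simp_all
  next
    case (sum s1 s2)
    then obtain y z where "y \<in> carrier A" "s1 = add_pow A (p ^ Suc i) y"
      "z \<in> carrier A" "s2 = add_pow A (p ^ Suc i) z" by blast
    then have "s1 \<oplus>\<^bsub>A\<^esub> s2 = add_pow A (p ^ Suc i) (y \<oplus>\<^bsub>A\<^esub> z)"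
      by (simp only: A.add.nat_pow_distrib)
    then show ?case using \<open>y \<in> carrier A\<close> \<open>z \<in> carrier A\<close> by blast
  qed
qed

lemma pw_m: "x \<in> pw m \<Longrightarrow> x = \<zero>\<^bsub>A\<^esub>"
  using pw_p p_pow_zero by blast

text \<open>The \<open>m\<close>-th power of the maximal ideal is zero, so a compatible sequence is constant from \<open>m\<close> on.\<close>

lemma p_complete: "adic_complete A \<mm>"
  unfolding adic_complete_def pw_def[symmetric]
proof (intro conjI ballI impI allI)
  fix x assume "\<forall>i. x \<in> pw i"
  then show "x = \<zero>\<^bsub>A\<^esub>" using pw_m by blast
next
  fix a assume a: "(\<forall>i. a i \<in> carrier A) \<and> (\<forall>i. a (Suc i) \<ominus>\<^bsub>A\<^esub> a i \<in> pw i)"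
  have diff: "a (i + k) \<ominus>\<^bsub>A\<^esub> a i \<in> pw i" for i k
  proof (induction k)
    case 0
    have "a i \<ominus>\<^bsub>A\<^esub> a i = \<zero>\<^bsub>A\<^esub>" using a by (simp add: a_minus_def A.r_neg)
    then show ?case using additive_subgroup.zero_closed[OF ideal.axioms(1)[OF pw_ideal[of i]]] by simp
  next
    case (Suc k)
    have cl: "a (Suc (i + k)) \<in> carrier A" "a (i + k) \<in> carrier A" "a i \<in> carrier A" using a by blast+
    have "a (Suc (i + k)) \<ominus>\<^bsub>A\<^esub> a (i + k) \<in> pw (i + k)" using a by blast
    then have "a (Suc (i + k)) \<ominus>\<^bsub>A\<^esub> a (i + k) \<in> pw i" using pw_antimono[of i "i + k"] by auto
    then have "(a (Suc (i + k)) \<ominus>\<^bsub>A\<^esub> a (i + k)) \<oplus>\<^bsub>A\<^esub> (a (i + k) \<ominus>\<^bsub>A\<^esub> a i) \<in> pw i"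
      using Suc by (rule pw_add)
    moreover have "(a (Suc (i + k)) \<ominus>\<^bsub>A\<^esub> a (i + k)) \<oplus>\<^bsub>A\<^esub> (a (i + k) \<ominus>\<^bsub>A\<^esub> a i)
       = a (Suc (i + k)) \<ominus>\<^bsub>A\<^esub> a i" using cl by algebra
    ultimately show ?case by (simp only: add_Suc_right)
  qed
  have "a m \<ominus>\<^bsub>A\<^esub> a i \<in> pw i" for i
  proof (cases "i \<le> m")
    case True
    then show ?thesis using diff[of i "m - i"] by simp
  next
    case False
    then have "a i \<ominus>\<^bsub>A\<^esub> a m = \<zero>\<^bsub>A\<^esub>" using diff[of m "i - m"] pw_m by simp
    then have "a i = a m" using a by simp
    then show ?thesis using diff[of i 0] by simp
  qed
  then show "\<exists>x\<in>carrier A. \<forall>i. x \<ominus>\<^bsub>A\<^esub> a i \<in> pw i" using a by blast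
qed

sublocale complete_residue A K \<pi>
  by unfold_locales (rule p_complete finite_K)+

lemma tau_squares_decomp:
  assumes r: "r \<in> carrier A"
  obtains a b s where "a \<in> carrier K" "b \<in> carrier K" "s \<in> carrier A"
    "r = tau (a \<otimes>\<^bsub>K\<^esub> a) \<oplus>\<^bsub>A\<^esub> tau (b \<otimes>\<^bsub>K\<^esub> b) \<oplus>\<^bsub>A\<^esub> add_pow A p s"
proof -
  have "\<pi> r \<in> carrier K" by (rule ring_hom_closed[OF hom r])
  from K.two_squares[OF finite_K this] obtain a b where ab: "a \<in> carrier K" "b \<in> carrier K"
    "\<pi> r = a \<otimes>\<^bsub>K\<^esub> a \<oplus>\<^bsub>K\<^esub> b \<otimes>\<^bsub>K\<^esub> b" by blast
  let ?t = "tau (a \<otimes>\<^bsub>K\<^esub> a) \<oplus>\<^bsub>A\<^esub> tau (b \<otimes>\<^bsub>K\<^esub> b)"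
  have aa: "a \<otimes>\<^bsub>K\<^esub> a \<in> carrier K" "b \<otimes>\<^bsub>K\<^esub> b \<in> carrier K" using ab by simp_all
  have cl: "tau (a \<otimes>\<^bsub>K\<^esub> a) \<in> carrier A" "tau (b \<otimes>\<^bsub>K\<^esub> b) \<in> carrier A" using aa tau_closed by blast+
  then have t: "?t \<in> carrier A" by simp
  have "\<pi> ?t = \<pi> r"
    unfolding ring_hom_add[OF hom cl] pi_tau[OF aa(1)] pi_tau[OF aa(2)] ab(3) ..
  then have "\<pi> (r \<ominus>\<^bsub>A\<^esub> ?t) = \<zero>\<^bsub>K\<^esub>"
    unfolding hom_sub[OF r t] using ring_hom_closed[OF hom r] by (simp add: a_minus_def K.r_neg)
  then have "r \<ominus>\<^bsub>A\<^esub> ?t \<in> \<mm>" using r t mem_ker by (metis A.minus_closed)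
  then obtain s where s: "s \<in> carrier A" "r \<ominus>\<^bsub>A\<^esub> ?t = add_pow A p s" using ker_p by blast
  have "r = ?t \<oplus>\<^bsub>A\<^esub> (r \<ominus>\<^bsub>A\<^esub> ?t)" using r t by (simp add: a_minus_def A.a_lcomm A.r_neg)
  then show ?thesis using that[OF ab(1,2) s(1)] unfolding s(2) by blast
qed

text \<open>Write the argument as \<open>\<tau>(a a) + \<tau>(b b) + p s\<close>: the value at \<open>r\<close> is the value at \<open>p s\<close>, hence after \<open>m\<close>
such steps the value at a multiple of \<open>p ^ m\<close>, which is zero.\<close>

lemma additive_eq_zero:
  assumes B: "abelian_group B"
    and d: "\<And>x. x \<in> carrier A \<Longrightarrow> d x \<in> carrier B"
    and add: "\<And>x y. x \<in> carrier A \<Longrightarrow> y \<in> carrier A \<Longrightarrow> d (x \<oplus>\<^bsub>A\<^esub> y) = d x \<oplus>\<^bsub>B\<^esub> d y"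
    and tau: "\<And>a. a \<in> carrier K \<Longrightarrow> d (tau (a \<otimes>\<^bsub>K\<^esub> a)) = \<zero>\<^bsub>B\<^esub>"
    and r: "r \<in> carrier A"
  shows "d r = \<zero>\<^bsub>B\<^esub>"
proof -
  interpret B: abelian_group B by (rule B)
  have d0: "d \<zero>\<^bsub>A\<^esub> = \<zero>\<^bsub>B\<^esub>"
  proof -
    have "d \<zero>\<^bsub>A\<^esub> \<oplus>\<^bsub>B\<^esub> d \<zero>\<^bsub>A\<^esub> = d \<zero>\<^bsub>A\<^esub>" using add[of "\<zero>\<^bsub>A\<^esub>" "\<zero>\<^bsub>A\<^esub>"] by simp
    then show ?thesis using B.add.r_cancel_one[of "d \<zero>\<^bsub>A\<^esub>" "d \<zero>\<^bsub>A\<^esub>"] d[of "\<zero>\<^bsub>A\<^esub>"] by simp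
  qed
  have pow: "d (add_pow A n x) = add_pow B n (d x)" if "x \<in> carrier A" for n :: nat and x
    using that by (induction n) (simp_all add: d0 add)
  have step: "\<exists>s\<in>carrier A. d r = d (add_pow A p s)" if r: "r \<in> carrier A" for r
  proof -
    obtain a b s where ab: "a \<in> carrier K" "b \<in> carrier K" and s: "s \<in> carrier A"
      and req: "r = tau (a \<otimes>\<^bsub>K\<^esub> a) \<oplus>\<^bsub>A\<^esub> tau (b \<otimes>\<^bsub>K\<^esub> b) \<oplus>\<^bsub>A\<^esub> add_pow A p s"
      by (rule tau_squares_decomp[OF r])
    have cl: "tau (a \<otimes>\<^bsub>K\<^esub> a) \<in> carrier A" "tau (b \<otimes>\<^bsub>K\<^esub> b) \<in> carrier A" "add_pow A p s \<in> carrier A"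
      using ab s tau_closed by simp_all
    have "d r = d (add_pow A p s)" unfolding req using cl d[OF cl(3)] ab by (simp add: add tau)
    then show ?thesis using s by blast
  qed
  have "\<exists>s\<in>carrier A. d r = d (add_pow A (p ^ i) s)" for i
  proof (induction i)
    case 0
    show ?case using r by (intro bexI[of _ r]) simp_all
  next
    case (Suc i)
    then obtain s where s: "s \<in> carrier A" "d r = d (add_pow A (p ^ i) s)" by blast
    obtain t where t: "t \<in> carrier A" "d s = d (add_pow A p t)" using step[OF s(1)] by blast
    have "d r = add_pow B (p ^ i) (d (add_pow A p t))" using s t pow by simp
    also have "\<dots> = d (add_pow A (p ^ i) (add_pow A p t))" using t pow by simp
    also have "add_pow A (p ^ i) (add_pow A p t) = add_pow A (p ^ Suc i) t"
      using A.add.nat_pow_pow[OF t(1), of "p ^ i" p] by simp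
    finally show ?case using t by blast
  qed
  from this[of m] show ?thesis using p_pow_zero d0 by auto
qed

lemma additive_eq:
  assumes B: "abelian_group B"
    and f: "\<And>x. x \<in> carrier A \<Longrightarrow> f x \<in> carrier B" and g: "\<And>x. x \<in> carrier A \<Longrightarrow> g x \<in> carrier B"
    and fadd: "\<And>x y. x \<in> carrier A \<Longrightarrow> y \<in> carrier A \<Longrightarrow> f (x \<oplus>\<^bsub>A\<^esub> y) = f x \<oplus>\<^bsub>B\<^esub> f y"
    and gadd: "\<And>x y. x \<in> carrier A \<Longrightarrow> y \<in> carrier A \<Longrightarrow> g (x \<oplus>\<^bsub>A\<^esub> y) = g x \<oplus>\<^bsub>B\<^esub> g y"
    and tau: "\<And>a. a \<in> carrier K \<Longrightarrow> f (tau (a \<otimes>\<^bsub>K\<^esub> a)) = g (tau (a \<otimes>\<^bsub>K\<^esub> a))"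
    and r: "r \<in> carrier A"
  shows "f r = g r"
proof -
  interpret B: abelian_group B by (rule B)
  have "f r \<ominus>\<^bsub>B\<^esub> g r = \<zero>\<^bsub>B\<^esub>"
  proof (rule additive_eq_zero[OF B _ _ _ r, of "\<lambda>x. f x \<ominus>\<^bsub>B\<^esub> g x"])
    fix x y assume xy: "x \<in> carrier A" "y \<in> carrier A"
    show "f (x \<oplus>\<^bsub>A\<^esub> y) \<ominus>\<^bsub>B\<^esub> g (x \<oplus>\<^bsub>A\<^esub> y) = f x \<ominus>\<^bsub>B\<^esub> g x \<oplus>\<^bsub>B\<^esub> (f y \<ominus>\<^bsub>B\<^esub> g y)"
      unfolding fadd[OF xy] gadd[OF xy] using f[OF xy(1)] f[OF xy(2)] g[OF xy(1)] g[OF xy(2)]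
      by (simp add: a_minus_def B.minus_add B.a_ac)
  next
    fix a assume a: "a \<in> carrier K"
    have "tau (a \<otimes>\<^bsub>K\<^esub> a) \<in> carrier A" using a tau_closed by simp
    then show "f (tau (a \<otimes>\<^bsub>K\<^esub> a)) \<ominus>\<^bsub>B\<^esub> g (tau (a \<otimes>\<^bsub>K\<^esub> a)) = \<zero>\<^bsub>B\<^esub>"
      unfolding tau[OF a] using g by (simp add: a_minus_def B.r_neg)
  qed (use f g in simp)
  moreover have "f r = (f r \<ominus>\<^bsub>B\<^esub> g r) \<oplus>\<^bsub>B\<^esub> g r"
    using f[OF r] g[OF r] by (simp add: a_minus_def B.a_assoc B.l_neg)
  ultimately show ?thesis using g[OF r] by simp
qed

text \<open>By descending induction on \<open>i\<close> the ideal generated by \<open>p ^ i\<close> is finite, as representatives modulo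
the next one can be taken from the finitely many sums of two Teichmueller elements.\<close>

lemma finite_carrier: "finite (carrier A)"
proof -
  have "finite ((\<lambda>x. add_pow A (p ^ i) x) ` carrier A)" if "i \<le> m" for i
    using that
  proof (induction i rule: inc_induct)
    case base
    have "(\<lambda>x. add_pow A (p ^ m) x) ` carrier A \<subseteq> {\<zero>\<^bsub>A\<^esub>}" using p_pow_zero by blast
    then show ?case by (rule finite_subset) simp
  next
    case (step i)
    let ?F = "(\<lambda>x. add_pow A (p ^ Suc i) x) ` carrier A"
    let ?g = "\<lambda>(a, b, y). add_pow A (p ^ i) (tau (a \<otimes>\<^bsub>K\<^esub> a) \<oplus>\<^bsub>A\<^esub> tau (b \<otimes>\<^bsub>K\<^esub> b)) \<oplus>\<^bsub>A\<^esub> y"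
    have "(\<lambda>x. add_pow A (p ^ i) x) ` carrier A \<subseteq> ?g ` (carrier K \<times> carrier K \<times> ?F)"
    proof
      fix z assume "z \<in> (\<lambda>x. add_pow A (p ^ i) x) ` carrier A"
      then obtain r where r: "r \<in> carrier A" "z = add_pow A (p ^ i) r" by blast
      obtain a b s where ab: "a \<in> carrier K" "b \<in> carrier K" and s: "s \<in> carrier A"
        and req: "r = tau (a \<otimes>\<^bsub>K\<^esub> a) \<oplus>\<^bsub>A\<^esub> tau (b \<otimes>\<^bsub>K\<^esub> b) \<oplus>\<^bsub>A\<^esub> add_pow A p s"
        by (rule tau_squares_decomp[OF r(1)])
      have "tau (a \<otimes>\<^bsub>K\<^esub> a) \<oplus>\<^bsub>A\<^esub> tau (b \<otimes>\<^bsub>K\<^esub> b) \<in> carrier A" using ab tau_closed by simp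
      moreover have "add_pow A (p ^ i) (add_pow A p s) = add_pow A (p ^ Suc i) s"
        using A.add.nat_pow_pow[OF s, of "p ^ i" p] by simp
      ultimately have "z = ?g (a, b, add_pow A (p ^ Suc i) s)"
        unfolding r(2) req using s by (simp add: A.add.nat_pow_distrib)
      then show "z \<in> ?g ` (carrier K \<times> carrier K \<times> ?F)" using ab s by blast
    qed
    then show ?case
      by (rule finite_subset) (intro finite_imageI finite_cartesian_product finite_K step.IH)
  qed
  from this[of 0] show ?thesis by simp
qed

lemma cln_ring: "cln_ring K A \<pi>"
proof -
  have "\<exists>!I. maximalideal I A" unfolding maximal by blast
  then have "local_ring A" unfolding local_ring_def using A.is_cring by blast
  moreover have me: "max_ideal A = \<mm>" unfolding max_ideal_def maximal by simp
  moreover have "noetherian_ring A"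
  proof (rule noetherian_ring.intro[OF A.ring_axioms], unfold_locales)
    fix I assume I: "ideal I A"
    have "I \<subseteq> carrier A" using ideal.Icarr[OF I] by blast
    moreover have "I = Idl\<^bsub>A\<^esub> I"
      using A.genideal_minimal[OF I order_refl] A.genideal_self[OF calculation] by blast
    ultimately show "\<exists>B\<subseteq>carrier A. finite B \<and> I = Idl\<^bsub>A\<^esub> B"
      using finite_subset[OF _ finite_carrier] by blast
  qed
  ultimately show ?thesis unfolding cln_ring_def using p_complete hom surj by simp
qed

end

section \<open>Matrices over a commutative ring\<close>

definition dmat :: "nat \<Rightarrow> ('a, 'c) ring_scheme \<Rightarrow> (nat \<Rightarrow> 'a) \<Rightarrow> 'a matr" where
  "dmat n R t = (\<lambda>(i, j)\<in>{..<n} \<times> {..<n}. if i = j then t i else \<zero>\<^bsub>R\<^esub>)"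

text \<open>Elementary only for \<open>i \<noteq> j\<close>; the entry at \<open>(i, j)\<close> is \<open>r\<close> and not \<open>r\<close> plus a diagonal entry.\<close>

definition emat :: "nat \<Rightarrow> ('a, 'c) ring_scheme \<Rightarrow> nat \<Rightarrow> nat \<Rightarrow> 'a \<Rightarrow> 'a matr" where
  "emat n R i j r = (\<lambda>(k, l)\<in>{..<n} \<times> {..<n}.
     if k = i \<and> l = j then r else if k = l then \<one>\<^bsub>R\<^esub> else \<zero>\<^bsub>R\<^esub>)"

lemma mat_map_entry [simp]: "i < n \<Longrightarrow> j < n \<Longrightarrow> mat_map n f M (i, j) = f (M (i, j))"
  by (simp add: mat_map_def)

lemma dmat_entry [simp]: "i < n \<Longrightarrow> j < n \<Longrightarrow> dmat n R t (i, j) = (if i = j then t i else \<zero>\<^bsub>R\<^esub>)"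
  by (simp add: dmat_def)

lemma emat_entry [simp]: "k < n \<Longrightarrow> l < n \<Longrightarrow> emat n R i j r (k, l) =
    (if k = i \<and> l = j then r else if k = l then \<one>\<^bsub>R\<^esub> else \<zero>\<^bsub>R\<^esub>)"
  by (simp add: emat_def)

lemma mat_one_entry [simp]: "i < n \<Longrightarrow> j < n \<Longrightarrow>
    \<one>\<^bsub>mat_monoid n R\<^esub> (i, j) = (if i = j then \<one>\<^bsub>R\<^esub> else \<zero>\<^bsub>R\<^esub>)"
  by (simp add: mat_monoid_def)

lemma mat_mult_entry: "i < n \<Longrightarrow> j < n \<Longrightarrow>
    (M \<otimes>\<^bsub>mat_monoid n R\<^esub> N) (i, j) = (\<Oplus>\<^bsub>R\<^esub>l\<in>{..<n}. M (i, l) \<otimes>\<^bsub>R\<^esub> N (l, j))"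
  by (simp add: mat_monoid_def)

lemma mat_closedI:
  assumes "\<And>i j. i < n \<Longrightarrow> j < n \<Longrightarrow> M (i, j) \<in> carrier R" "M \<in> extensional ({..<n} \<times> {..<n})"
  shows "M \<in> carrier (mat_monoid n R)"
  using assms by (auto simp: mat_monoid_def PiE_def Pi_def)

lemma mat_entry [simp]:
  assumes "M \<in> carrier (mat_monoid n R)" "i < n" "j < n"
  shows "M (i, j) \<in> carrier R"
  using assms by (auto simp: mat_monoid_def PiE_def Pi_def)

lemma mat_eqI:
  assumes "M \<in> carrier (mat_monoid n R)" "N \<in> carrier (mat_monoid n R)"
    "\<And>i j. i < n \<Longrightarrow> j < n \<Longrightarrow> M (i, j) = N (i, j)"
  shows "M = N"
  using assms(1,2) unfolding mat_monoid_def partial_object.simps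
  by (rule PiE_ext) (use assms(3) in auto)

context cring begin

lemma mat_mult_closed [simp]:
  assumes "M \<in> carrier (mat_monoid n R)" "N \<in> carrier (mat_monoid n R)"
  shows "M \<otimes>\<^bsub>mat_monoid n R\<^esub> N \<in> carrier (mat_monoid n R)"
proof (rule mat_closedI)
  fix i j assume "i < n" "j < n"
  then show "(M \<otimes>\<^bsub>mat_monoid n R\<^esub> N) (i, j) \<in> carrier R"
    unfolding mat_mult_entry[OF \<open>i < n\<close> \<open>j < n\<close>] using assms by (intro finsum_closed) auto
qed (simp add: mat_monoid_def)

lemma mat_one_closed [simp]: "\<one>\<^bsub>mat_monoid n R\<^esub> \<in> carrier (mat_monoid n R)"
  by (rule mat_closedI) (simp_all, simp add: mat_monoid_def)

lemma dmat_closed: "(\<And>i. i < n \<Longrightarrow> t i \<in> carrier R) \<Longrightarrow> dmat n R t \<in> carrier (mat_monoid n R)"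
  by (rule mat_closedI) (simp_all add: dmat_def)

lemma emat_closed: "r \<in> carrier R \<Longrightarrow> emat n R i j r \<in> carrier (mat_monoid n R)"
  by (rule mat_closedI) (simp_all add: emat_def)

lemma mat_map_closed:
  assumes "\<And>x. x \<in> carrier R \<Longrightarrow> h x \<in> carrier S" "M \<in> carrier (mat_monoid n R)"
  shows "mat_map n h M \<in> carrier (mat_monoid n S)"
  by (rule mat_closedI) (use assms in \<open>simp_all add: mat_map_def\<close>)

lemma finsum_delta:
  fixes k n :: nat
  assumes "k < n" "\<And>l. l < n \<Longrightarrow> f l \<in> carrier R"
  shows "(\<Oplus>l\<in>{..<n}. if l = k then f l else \<zero>) = f k"
  using add.finprod_singleton[of k "{..<n}" f] assms by (simp add: eq_commute[of k])

lemma dmat_mult_entry: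
  assumes "M \<in> carrier (mat_monoid n R)" "\<And>i. i < n \<Longrightarrow> t i \<in> carrier R" "i < n" "j < n"
  shows "(dmat n R t \<otimes>\<^bsub>mat_monoid n R\<^esub> M) (i, j) = t i \<otimes> M (i, j)"
proof -
  have "(\<Oplus>l\<in>{..<n}. dmat n R t (i, l) \<otimes> M (l, j)) = (\<Oplus>l\<in>{..<n}. if l = i then t i \<otimes> M (l, j) else \<zero>)"
    using assms by (intro finsum_cong') auto
  also have "\<dots> = t i \<otimes> M (i, j)" using assms by (intro finsum_delta) auto
  finally show ?thesis using assms by (simp add: mat_mult_entry)
qed

lemma mult_dmat_entry:
  assumes "M \<in> carrier (mat_monoid n R)" "\<And>i. i < n \<Longrightarrow> t i \<in> carrier R" "i < n" "j < n"
  shows "(M \<otimes>\<^bsub>mat_monoid n R\<^esub> dmat n R t) (i, j) = M (i, j) \<otimes> t j"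
proof -
  have "(\<Oplus>l\<in>{..<n}. M (i, l) \<otimes> dmat n R t (l, j)) = (\<Oplus>l\<in>{..<n}. if l = j then M (i, l) \<otimes> t l else \<zero>)"
    using assms by (intro finsum_cong') auto
  also have "\<dots> = M (i, j) \<otimes> t j" using assms by (intro finsum_delta) auto
  finally show ?thesis using assms by (simp add: mat_mult_entry)
qed

lemma emat_mult_entry:
  assumes "M \<in> carrier (mat_monoid n R)" "r \<in> carrier R" "i < n" "j < n" "i \<noteq> j" "k < n" "l < n"
  shows "(emat n R i j r \<otimes>\<^bsub>mat_monoid n R\<^esub> M) (k, l) =
    (if k = i then M (i, l) \<oplus> r \<otimes> M (j, l) else M (k, l))"
proof -
  have "(\<Oplus>s\<in>{..<n}. emat n R i j r (k, s) \<otimes> M (s, l)) =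
      (\<Oplus>s\<in>{..<n}. (if s = k then M (s, l) else \<zero>) \<oplus> (if s = j then if k = i then r \<otimes> M (s, l) else \<zero> else \<zero>))"
    using assms by (intro finsum_cong') auto
  also have "\<dots> = (\<Oplus>s\<in>{..<n}. if s = k then M (s, l) else \<zero>)
      \<oplus> (\<Oplus>s\<in>{..<n}. if s = j then if k = i then r \<otimes> M (s, l) else \<zero> else \<zero>)"
    using assms by (intro finsum_addf) auto
  also have "(\<Oplus>s\<in>{..<n}. if s = k then M (s, l) else \<zero>) = M (k, l)"
    using assms by (intro finsum_delta) auto
  also have "(\<Oplus>s\<in>{..<n}. if s = j then if k = i then r \<otimes> M (s, l) else \<zero> else \<zero>) =
      (if k = i then r \<otimes> M (j, l) else \<zero>)"
    using assms by (intro finsum_delta) auto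
  finally show ?thesis using assms by (simp add: mat_mult_entry)
qed

lemma mult_emat_entry:
  assumes "M \<in> carrier (mat_monoid n R)" "r \<in> carrier R" "i < n" "j < n" "i \<noteq> j" "k < n" "l < n"
  shows "(M \<otimes>\<^bsub>mat_monoid n R\<^esub> emat n R i j r) (k, l) =
    (if l = j then M (k, j) \<oplus> M (k, i) \<otimes> r else M (k, l))"
proof -
  have "(\<Oplus>s\<in>{..<n}. M (k, s) \<otimes> emat n R i j r (s, l)) =
      (\<Oplus>s\<in>{..<n}. (if s = l then M (k, s) else \<zero>) \<oplus> (if s = i then if l = j then M (k, s) \<otimes> r else \<zero> else \<zero>))"
    using assms by (intro finsum_cong') auto
  also have "\<dots> = (\<Oplus>s\<in>{..<n}. if s = l then M (k, s) else \<zero>)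
      \<oplus> (\<Oplus>s\<in>{..<n}. if s = i then if l = j then M (k, s) \<otimes> r else \<zero> else \<zero>)"
    using assms by (intro finsum_addf) auto
  also have "(\<Oplus>s\<in>{..<n}. if s = l then M (k, s) else \<zero>) = M (k, l)"
    using assms by (intro finsum_delta) auto
  also have "(\<Oplus>s\<in>{..<n}. if s = i then if l = j then M (k, s) \<otimes> r else \<zero> else \<zero>) =
      (if l = j then M (k, i) \<otimes> r else \<zero>)"
    using assms by (intro finsum_delta) auto
  finally show ?thesis using assms by (simp add: mat_mult_entry)
qed

end

lemma ring_hom_finsum:
  assumes "cring R" "cring S" "h \<in> ring_hom R S" "\<And>x. x \<in> T \<Longrightarrow> f x \<in> carrier R"
  shows "h (finsum R f T) = (\<Oplus>\<^bsub>S\<^esub>x\<in>T. h (f x))"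
proof -
  interpret ring_hom_cring R S h by (rule ring_hom_cringI[OF assms(1-3)])
  show ?thesis using hom_finsum[of f T] assms(4) by (simp add: comp_def Pi_def)
qed

lemma ring_hom_finprod:
  assumes "cring R" "cring S" "h \<in> ring_hom R S" "\<And>x. x \<in> T \<Longrightarrow> f x \<in> carrier R"
  shows "h (finprod R f T) = (\<Otimes>\<^bsub>S\<^esub>x\<in>T. h (f x))"
proof -
  interpret ring_hom_cring R S h by (rule ring_hom_cringI[OF assms(1-3)])
  show ?thesis using hom_finprod[of f T] assms(4) by (simp add: comp_def Pi_def)
qed

lemma ring_hom_zero':
  assumes "cring R" "cring S" "h \<in> ring_hom R S"
  shows "h \<zero>\<^bsub>R\<^esub> = \<zero>\<^bsub>S\<^esub>"
proof -
  interpret ring_hom_cring R S h by (rule ring_hom_cringI[OF assms])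
  show ?thesis by (rule hom_zero)
qed

lemma ring_hom_add_pow_int:
  assumes "cring R" "cring S" "h \<in> ring_hom R S" "x \<in> carrier R"
  shows "h (add_pow R (c::int) x) = add_pow S c (h x)"
proof -
  interpret ring_hom_cring R S h by (rule ring_hom_cringI[OF assms(1-3)])
  show ?thesis
    using ring_hom_add_pow[OF assms, of "nat c"] ring_hom_add_pow[OF assms, of "nat (- c)"] assms(4)
    by (cases "c \<ge> 0") (simp_all add: add_pow_int_ge add_pow_int_lt)
qed

lemma mat_map_mult:
  assumes "cring R" "cring S" "h \<in> ring_hom R S"
    and M: "M \<in> carrier (mat_monoid n R)" and N: "N \<in> carrier (mat_monoid n R)"
  shows "mat_map n h (M \<otimes>\<^bsub>mat_monoid n R\<^esub> N) = mat_map n h M \<otimes>\<^bsub>mat_monoid n S\<^esub> mat_map n h N"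
proof -
  interpret R: cring R by fact
  interpret S: cring S by fact
  note cl = ring_hom_closed[OF assms(3)]
  show ?thesis
  proof (rule mat_eqI[of _ n S])
    fix i j assume ij: "i < n" "j < n"
    have "h (\<Oplus>\<^bsub>R\<^esub>l\<in>{..<n}. M (i, l) \<otimes>\<^bsub>R\<^esub> N (l, j)) = (\<Oplus>\<^bsub>S\<^esub>l\<in>{..<n}. h (M (i, l) \<otimes>\<^bsub>R\<^esub> N (l, j)))"
      using M N ij by (intro ring_hom_finsum assms) auto
    also have "\<dots> = (\<Oplus>\<^bsub>S\<^esub>l\<in>{..<n}. mat_map n h M (i, l) \<otimes>\<^bsub>S\<^esub> mat_map n h N (l, j))"
      using M N ij by (intro S.finsum_cong') (auto simp: ring_hom_mult[OF assms(3)] cl)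
    finally show "mat_map n h (M \<otimes>\<^bsub>mat_monoid n R\<^esub> N) (i, j) =
        (mat_map n h M \<otimes>\<^bsub>mat_monoid n S\<^esub> mat_map n h N) (i, j)"
      using ij by (simp add: mat_mult_entry)
  qed (intro S.mat_mult_closed R.mat_map_closed R.mat_mult_closed M N cl; assumption)+
qed

lemma mat_map_one:
  assumes "cring R" "cring S" "h \<in> ring_hom R S"
  shows "mat_map n h \<one>\<^bsub>mat_monoid n R\<^esub> = \<one>\<^bsub>mat_monoid n S\<^esub>"
  by (rule mat_eqI[of _ n S])
    (use assms in \<open>auto intro!: cring.mat_map_closed[of R] cring.mat_one_closed ring_hom_closed[OF assms(3)]
      simp: ring_hom_one[OF assms(3)] ring_hom_zero'[OF assms]\<close>)

lemma mat_det_map: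
  assumes "cring R" "cring S" "h \<in> ring_hom R S" and M: "M \<in> carrier (mat_monoid n R)"
  shows "mat_det n S (mat_map n h M) = h (mat_det n R M)"
proof -
  interpret R: cring R by fact
  interpret S: cring S by fact
  note cl = ring_hom_closed[OF assms(3)]
  let ?P = "{\<sigma>. \<sigma> permutes {..<n}}"
  have lt: "\<sigma> i < n" if "\<sigma> \<in> ?P" "i < n" for \<sigma> i
    using that permutes_in_image[of \<sigma> "{..<n}" i] by simp
  have pc: "(\<Otimes>\<^bsub>R\<^esub>i\<in>{..<n}. M (i, \<sigma> i)) \<in> carrier R" if "\<sigma> \<in> ?P" for \<sigma>
    using M lt[OF that] by (intro R.finprod_closed) auto
  have "h (mat_det n R M) = (\<Oplus>\<^bsub>S\<^esub>\<sigma>\<in>?P. h (add_pow R (sign \<sigma>) (\<Otimes>\<^bsub>R\<^esub>i\<in>{..<n}. M (i, \<sigma> i))))"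
    unfolding mat_det_def using pc by (intro ring_hom_finsum assms) auto
  also have "\<dots> = (\<Oplus>\<^bsub>S\<^esub>\<sigma>\<in>?P. add_pow S (sign \<sigma>) (\<Otimes>\<^bsub>S\<^esub>i\<in>{..<n}. mat_map n h M (i, \<sigma> i)))"
  proof (rule S.finsum_cong')
    show "(\<lambda>\<sigma>. add_pow S (sign \<sigma>) (\<Otimes>\<^bsub>S\<^esub>i\<in>{..<n}. mat_map n h M (i, \<sigma> i))) \<in> ?P \<rightarrow> carrier S"
      using M lt cl by (intro funcsetI S.add.int_pow_closed S.finprod_closed) auto
    fix \<sigma> assume s: "\<sigma> \<in> ?P"
    have "h (\<Otimes>\<^bsub>R\<^esub>i\<in>{..<n}. M (i, \<sigma> i)) = (\<Otimes>\<^bsub>S\<^esub>i\<in>{..<n}. h (M (i, \<sigma> i)))"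
      using M lt[OF s] by (intro ring_hom_finprod assms) auto
    also have "\<dots> = (\<Otimes>\<^bsub>S\<^esub>i\<in>{..<n}. mat_map n h M (i, \<sigma> i))"
      using M lt[OF s] cl by (intro S.finprod_cong') auto
    finally show "h (add_pow R (sign \<sigma>) (\<Otimes>\<^bsub>R\<^esub>i\<in>{..<n}. M (i, \<sigma> i))) =
        add_pow S (sign \<sigma>) (\<Otimes>\<^bsub>S\<^esub>i\<in>{..<n}. mat_map n h M (i, \<sigma> i))"
      using ring_hom_add_pow_int[OF assms(1-3) pc[OF s]] by simp
  qed simp
  finally show ?thesis by (simp add: mat_det_def)
qed

lemma type_ring_finprod [simp]: "finprod type_ring f S = prod f S" for f :: "'b \<Rightarrow> 'a::comm_ring_1"
proof -
  interpret cring "type_ring :: 'a ring" by (rule cring_type_ring)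
  show ?thesis by (induction S rule: infinite_finite_induct) auto
qed

lemma type_ring_add_pow_int [simp]: "add_pow type_ring (c::int) (x::'a::comm_ring_1) = of_int c * x"
  by (cases "c \<ge> 0") (simp_all add: add_pow_int_ge add_pow_int_lt)

abbreviation jmat :: "nat \<Rightarrow> 'a matr \<Rightarrow> 'a mat" where "jmat n M \<equiv> Matrix.mat n n M"

lemma jmat_mult:
  "jmat n (M \<otimes>\<^bsub>mat_monoid n (type_ring :: 'a::comm_ring_1 ring)\<^esub> N) = jmat n M * jmat n N"
  by (rule eq_matI) (simp_all add: mat_mult_entry scalar_prod_def atLeast0LessThan)

lemma jmat_one: "jmat n \<one>\<^bsub>mat_monoid n (type_ring :: 'a::comm_ring_1 ring)\<^esub> = 1\<^sub>m n"
  by (rule eq_matI) simp_all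

lemma jmat_inj:
  assumes "M \<in> carrier (mat_monoid n R)" "N \<in> carrier (mat_monoid n R)" "jmat n M = jmat n N"
  shows "M = N"
proof (rule mat_eqI[OF assms(1,2)])
  fix i j assume "i < n" "j < n"
  then show "M (i, j) = N (i, j)" using arg_cong[OF assms(3), of "\<lambda>B. B $$ (i, j)"] by simp
qed

lemma jmat_det: "Determinant.det (jmat n M) = mat_det n (type_ring :: 'a::comm_ring_1 ring) M"
proof -
  have "Determinant.det (jmat n M) =
      (\<Sum>p\<in>{p. p permutes {0..<n}}. signof p * (\<Prod>i=0..<n. jmat n M $$ (i, p i)))"
    by (rule det_def') simp
  also have "\<dots> = (\<Sum>p\<in>{p. p permutes {..<n}}. of_int (sign p) * (\<Prod>i<n. M (i, p i)))"
    unfolding atLeast0LessThan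
  proof (intro sum.cong refl arg_cong2[of _ _ _ _ "(*)"] prod.cong)
    fix p i assume "p \<in> {p. p permutes {..<n}}" "i \<in> {..<n}"
    then show "jmat n M $$ (i, p i) = M (i, p i)"
      using permutes_in_image[of p "{..<n}" i] by simp
  qed
  finally show ?thesis by (simp add: mat_det_def)
qed

text \<open>Matrices over any commutative ring are specializations of matrices of polynomials.  The
associative law, the multiplicativity of the determinant and the adjugate matrix are thus obtained from
the matrix theory over commutative ring types.\<close>

lemma mat_lift:
  assumes "cring R" "M1 \<in> carrier (mat_monoid n R)" "M2 \<in> carrier (mat_monoid n R)" "M3 \<in> carrier (mat_monoid n R)"
  obtains h N1 N2 N3 where "h \<in> ring_hom PR R" "N1 \<in> carrier (mat_monoid n PR)"
    "N2 \<in> carrier (mat_monoid n PR)" "N3 \<in> carrier (mat_monoid n PR)"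
    "M1 = mat_map n h N1" "M2 = mat_map n h N2" "M3 = mat_map n h N3"
proof -
  interpret R: cring R by fact
  let ?u = "\<lambda>(c::nat, i, j). if i < n \<and> j < n then (if c = 0 then M1 else if c = 1 then M2 else M3) (i, j) else \<zero>\<^bsub>R\<^esub>"
  have "?u c \<in> carrier R" for c using assms by (auto split: prod.splits)
  from generic_lift[where x = ?u, OF assms(1) this] obtain h Y where
    h: "h \<in> ring_hom PR R" and Y: "\<forall>c. h (Y c) = ?u c" by auto
  let ?N = "\<lambda>c. \<lambda>(i, j)\<in>{..<n} \<times> {..<n}. Y (c, i, j)"
  have N: "?N c \<in> carrier (mat_monoid n PR)" for c by (rule mat_closedI) simp_all
  have cl: "mat_map n h (?N c) \<in> carrier (mat_monoid n R)" for c
    by (rule cring.mat_map_closed[OF cring_type_ring ring_hom_closed[OF h] N])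
  show ?thesis
    by (rule that[OF h N[of 0] N[of 1] N[of 2]]; rule mat_eqI[OF assms(2) cl] mat_eqI[OF assms(3) cl] mat_eqI[OF assms(4) cl])
      (simp_all add: Y)
qed

context cring begin

lemma mat_monoid: "monoid (mat_monoid n R)"
proof (rule monoidI)
  note T = cring_type_ring
  fix M1 M2 M3 assume M: "M1 \<in> carrier (mat_monoid n R)" "M2 \<in> carrier (mat_monoid n R)" "M3 \<in> carrier (mat_monoid n R)"
  obtain h N1 N2 N3 where h: "h \<in> ring_hom PR R" and N: "N1 \<in> carrier (mat_monoid n PR)"
    "N2 \<in> carrier (mat_monoid n PR)" "N3 \<in> carrier (mat_monoid n PR)"
    and eq: "M1 = mat_map n h N1" "M2 = mat_map n h N2" "M3 = mat_map n h N3"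
    by (rule mat_lift[OF is_cring M])
  have "N1 \<otimes>\<^bsub>mat_monoid n PR\<^esub> N2 \<otimes>\<^bsub>mat_monoid n PR\<^esub> N3 = N1 \<otimes>\<^bsub>mat_monoid n PR\<^esub> (N2 \<otimes>\<^bsub>mat_monoid n PR\<^esub> N3)"
    by (rule jmat_inj[of _ n PR])
      (use N in \<open>auto simp: cring.mat_mult_closed[OF T] jmat_mult intro!: assoc_mult_mat\<close>)
  then show "M1 \<otimes>\<^bsub>mat_monoid n R\<^esub> M2 \<otimes>\<^bsub>mat_monoid n R\<^esub> M3 = M1 \<otimes>\<^bsub>mat_monoid n R\<^esub> (M2 \<otimes>\<^bsub>mat_monoid n R\<^esub> M3)"
    unfolding eq using N by (simp add: cring.mat_mult_closed[OF T] flip: mat_map_mult[OF T is_cring h])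
next
  note T = cring_type_ring
  fix M assume M: "M \<in> carrier (mat_monoid n R)"
  obtain h N N2 N3 where h: "h \<in> ring_hom PR R" and N: "N \<in> carrier (mat_monoid n PR)"
    "N2 \<in> carrier (mat_monoid n PR)" "N3 \<in> carrier (mat_monoid n PR)"
    and eq: "M = mat_map n h N" "M = mat_map n h N2" "M = mat_map n h N3"
    by (rule mat_lift[OF is_cring M M M])
  have one: "\<one>\<^bsub>mat_monoid n PR\<^esub> \<in> carrier (mat_monoid n PR)" by (rule cring.mat_one_closed[OF T])
  have "\<one>\<^bsub>mat_monoid n PR\<^esub> \<otimes>\<^bsub>mat_monoid n PR\<^esub> N = N"
    by (rule jmat_inj[of _ n PR])
      (use N one in \<open>auto simp: cring.mat_mult_closed[OF T] jmat_mult jmat_one intro!: left_mult_one_mat\<close>)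
  moreover have "N \<otimes>\<^bsub>mat_monoid n PR\<^esub> \<one>\<^bsub>mat_monoid n PR\<^esub> = N"
    by (rule jmat_inj[of _ n PR])
      (use N one in \<open>auto simp: cring.mat_mult_closed[OF T] jmat_mult jmat_one intro!: right_mult_one_mat\<close>)
  ultimately show "\<one>\<^bsub>mat_monoid n R\<^esub> \<otimes>\<^bsub>mat_monoid n R\<^esub> M = M" "M \<otimes>\<^bsub>mat_monoid n R\<^esub> \<one>\<^bsub>mat_monoid n R\<^esub> = M"
    unfolding eq(1) using N one
    by (simp_all flip: mat_map_mult[OF T is_cring h] mat_map_one[OF T is_cring h])
qed simp_all

lemma mat_det_closed [simp]:
  assumes M: "M \<in> carrier (mat_monoid n R)"
  shows "mat_det n R M \<in> carrier R"
proof -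
  obtain h N N2 N3 where h: "h \<in> ring_hom PR R" and N: "N \<in> carrier (mat_monoid n PR)"
    "N2 \<in> carrier (mat_monoid n PR)" "N3 \<in> carrier (mat_monoid n PR)"
    and eq: "M = mat_map n h N" "M = mat_map n h N2" "M = mat_map n h N3"
    by (rule mat_lift[OF is_cring M M M])
  show ?thesis unfolding eq(1) mat_det_map[OF cring_type_ring is_cring h N(1)]
    by (rule ring_hom_closed[OF h]) simp
qed

lemma mat_det_mult:
  assumes M: "M1 \<in> carrier (mat_monoid n R)" "M2 \<in> carrier (mat_monoid n R)"
  shows "mat_det n R (M1 \<otimes>\<^bsub>mat_monoid n R\<^esub> M2) = mat_det n R M1 \<otimes> mat_det n R M2"
proof -
  note T = cring_type_ring
  obtain h N1 N2 N3 where h: "h \<in> ring_hom PR R" and N: "N1 \<in> carrier (mat_monoid n PR)"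
    "N2 \<in> carrier (mat_monoid n PR)" "N3 \<in> carrier (mat_monoid n PR)"
    and eq: "M1 = mat_map n h N1" "M2 = mat_map n h N2" "M2 = mat_map n h N3"
    by (rule mat_lift[OF is_cring M M(2)])
  have "mat_det n PR (N1 \<otimes>\<^bsub>mat_monoid n PR\<^esub> N2) = mat_det n PR N1 * mat_det n PR N2"
    unfolding jmat_det[symmetric] jmat_mult by (rule det_mult[of _ n]) simp_all
  then have "h (mat_det n PR (N1 \<otimes>\<^bsub>mat_monoid n PR\<^esub> N2)) = h (mat_det n PR N1) \<otimes> h (mat_det n PR N2)"
    using ring_hom_mult[OF h, of "mat_det n PR N1" "mat_det n PR N2"] by simp
  then show ?thesis
    unfolding eq(1,2) using N(1,2) cring.mat_mult_closed[OF T N(1,2)]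
    by (simp add: mat_det_map[OF T is_cring h] flip: mat_map_mult[OF T is_cring h])
qed

lemma mat_det_dmat:
  assumes t: "\<And>i. i < n \<Longrightarrow> t i \<in> carrier R"
  shows "mat_det n R (dmat n R t) = (\<Otimes>i\<in>{..<n}. t i)"
proof -
  note T = cring_type_ring
  have "(if i < n then t i else \<zero>) \<in> carrier R" for i using t by simp
  from generic_lift[where x = "\<lambda>i. if i < n then t i else \<zero>", OF is_cring this] obtain h Y where
    h: "h \<in> ring_hom PR R" and Y: "\<forall>i. h (Y i) = (if i < n then t i else \<zero>)" by auto
  have cl: "dmat n PR Y \<in> carrier (mat_monoid n PR)" by (rule cring.dmat_closed[OF T]) simp
  have 1: "dmat n R t = mat_map n h (dmat n PR Y)"
    by (rule mat_eqI[of _ n R])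
      (use t cl in \<open>auto intro!: dmat_closed cring.mat_map_closed[OF T] ring_hom_closed[OF h] simp: Y ring_hom_zero'[OF T is_cring h, simplified]\<close>)
  have "Determinant.det (jmat n (dmat n PR Y)) = prod_list (diag_mat (jmat n (dmat n PR Y)))"
    by (rule det_upper_triangular[of _ n]) (auto intro!: upper_triangularI)
  also have "\<dots> = (\<Prod>i<n. Y i)"
    by (simp add: diag_mat_def prod.distinct_set_conv_list[symmetric] atLeast0LessThan)
  finally have "mat_det n PR (dmat n PR Y) = (\<Prod>i<n. Y i)" by (simp add: jmat_det)
  then have "mat_det n R (dmat n R t) = h (finprod PR Y {..<n})"
    unfolding 1 mat_det_map[OF T is_cring h cl] by simp
  also have "\<dots> = (\<Otimes>i\<in>{..<n}. h (Y i))" by (rule ring_hom_finprod[OF T is_cring h]) simp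
  also have "\<dots> = (\<Otimes>i\<in>{..<n}. t i)" using t by (intro finprod_cong') (auto simp: Y)
  finally show ?thesis .
qed

lemma mat_det_one: "mat_det n R \<one>\<^bsub>mat_monoid n R\<^esub> = \<one>"
proof -
  have "\<one>\<^bsub>mat_monoid n R\<^esub> = dmat n R (\<lambda>_. \<one>)"
    by (rule mat_eqI[of _ n R]) (auto intro: dmat_closed)
  then show ?thesis by (simp add: mat_det_dmat)
qed

lemma mat_det_emat:
  assumes r: "r \<in> carrier R" and ij: "i < n" "j < n" "i \<noteq> j"
  shows "mat_det n R (emat n R i j r) = \<one>"
proof -
  note T = cring_type_ring
  from generic_lift[where x = "\<lambda>_::nat. r", OF is_cring r] obtain h Y where
    h: "h \<in> ring_hom PR R" and Y: "\<forall>i::nat. h (Y i) = r" by auto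
  have cl: "emat n PR i j (Y 0) \<in> carrier (mat_monoid n PR)" by (rule cring.emat_closed[OF T]) simp
  have 1: "emat n R i j r = mat_map n h (emat n PR i j (Y 0))"
    by (rule mat_eqI[of _ n R])
      (use r cl in \<open>auto intro!: emat_closed cring.mat_map_closed[OF T] ring_hom_closed[OF h]
        simp: Y ring_hom_zero'[OF T is_cring h, simplified] ring_hom_one[OF h, simplified]\<close>)
  have "jmat n (emat n PR i j (Y 0)) = addrow_mat n (Y 0) i j"
    by (rule eq_matI) (use ij in auto)
  then have "mat_det n PR (emat n PR i j (Y 0)) = 1"
    using det_addrow_mat[OF ij(3), of n "Y 0"] by (simp add: jmat_det[symmetric])
  then show ?thesis unfolding 1 mat_det_map[OF T is_cring h cl] using ring_hom_one[OF h] by simp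
qed

text \<open>The adjugate matrix, divided by the determinant, is the inverse.\<close>

lemma mat_unitI:
  assumes M: "M \<in> carrier (mat_monoid n R)" and d: "mat_det n R M \<in> Units R"
  shows "M \<in> Units (mat_monoid n R)"
proof -
  note T = cring_type_ring
  interpret MM: monoid "mat_monoid n R" by (rule mat_monoid)
  obtain h N N2 N3 where h: "h \<in> ring_hom PR R" and N: "N \<in> carrier (mat_monoid n PR)"
    "N2 \<in> carrier (mat_monoid n PR)" "N3 \<in> carrier (mat_monoid n PR)"
    and eq: "M = mat_map n h N" "M = mat_map n h N2" "M = mat_map n h N3"
    by (rule mat_lift[OF is_cring M M M])
  let ?d = "mat_det n PR N"
  let ?B = "\<lambda>(i, j)\<in>{..<n} \<times> {..<n}. adj_mat (jmat n N) $$ (i, j)"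
  have B: "?B \<in> carrier (mat_monoid n PR)" by (rule mat_closedI) simp_all
  have jB: "jmat n ?B = adj_mat (jmat n N)"
    using adj_mat(1)[of "jmat n N" n] by (intro eq_matI) auto
  have D: "dmat n PR (\<lambda>_. ?d) \<in> carrier (mat_monoid n PR)" by (rule cring.dmat_closed[OF T]) simp
  have jD: "jmat n (dmat n PR (\<lambda>_. ?d)) = ?d \<cdot>\<^sub>m 1\<^sub>m n" by (rule eq_matI) simp_all
  have NB: "N \<otimes>\<^bsub>mat_monoid n PR\<^esub> ?B = dmat n PR (\<lambda>_. ?d)"
    by (rule jmat_inj[of _ n PR]) (use N B D adj_mat(2)[of "jmat n N" n] in
      \<open>simp_all only: jmat_mult jB jD cring.mat_mult_closed[OF T] jmat_det mat_carrier\<close>)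
  have BN: "?B \<otimes>\<^bsub>mat_monoid n PR\<^esub> N = dmat n PR (\<lambda>_. ?d)"
    by (rule jmat_inj[of _ n PR]) (use N B D adj_mat(3)[of "jmat n N" n] in
      \<open>simp_all only: jmat_mult jB jD cring.mat_mult_closed[OF T] jmat_det mat_carrier\<close>)
  have hd: "h ?d = mat_det n R M" unfolding eq(1) by (rule mat_det_map[OF T is_cring h N(1), symmetric])
  define u where "u = mat_det n R M"
  have u: "u \<in> Units R" "u \<in> carrier R" "inv u \<in> carrier R" using d by (auto simp: u_def)
  let ?C = "mat_map n h ?B"
  have C: "?C \<in> carrier (mat_monoid n R)"
    by (rule cring.mat_map_closed[OF T ring_hom_closed[OF h] B])
  have Du: "mat_map n h (dmat n PR (\<lambda>_. ?d)) = dmat n R (\<lambda>_. u)"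
    by (rule mat_eqI[of _ n R])
      (use u D in \<open>auto intro!: dmat_closed cring.mat_map_closed[OF T] ring_hom_closed[OF h]
        simp: hd u_def ring_hom_zero'[OF T is_cring h, simplified]\<close>)
  have MC: "M \<otimes>\<^bsub>mat_monoid n R\<^esub> ?C = dmat n R (\<lambda>_. u)" "?C \<otimes>\<^bsub>mat_monoid n R\<^esub> M = dmat n R (\<lambda>_. u)"
    unfolding eq(1) mat_map_mult[OF T is_cring h N(1) B, symmetric]
      mat_map_mult[OF T is_cring h B N(1), symmetric] NB BN Du by (rule refl)+
  let ?E = "dmat n R (\<lambda>_. inv u)"
  have E: "?E \<in> carrier (mat_monoid n R)" "dmat n R (\<lambda>_. u) \<in> carrier (mat_monoid n R)"
    using u by (auto intro!: dmat_closed)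
  have DE: "dmat n R (\<lambda>_. u) \<otimes>\<^bsub>mat_monoid n R\<^esub> ?E = \<one>\<^bsub>mat_monoid n R\<^esub>"
    by (rule mat_eqI[of _ n R]) (use u E in \<open>auto simp: dmat_mult_entry Units_r_inv\<close>)
  have ED: "?E \<otimes>\<^bsub>mat_monoid n R\<^esub> dmat n R (\<lambda>_. u) = \<one>\<^bsub>mat_monoid n R\<^esub>"
    by (rule mat_eqI[of _ n R]) (use u E in \<open>auto simp: dmat_mult_entry Units_l_inv\<close>)
  have r: "M \<otimes>\<^bsub>mat_monoid n R\<^esub> (?C \<otimes>\<^bsub>mat_monoid n R\<^esub> ?E) = \<one>\<^bsub>mat_monoid n R\<^esub>"
    using MM.m_assoc[OF M C E(1)] MC(1) DE by simp
  have l: "(?E \<otimes>\<^bsub>mat_monoid n R\<^esub> ?C) \<otimes>\<^bsub>mat_monoid n R\<^esub> M = \<one>\<^bsub>mat_monoid n R\<^esub>"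
    using MM.m_assoc[OF E(1) C M] MC(2) ED by simp
  have "?E \<otimes>\<^bsub>mat_monoid n R\<^esub> ?C = ?C \<otimes>\<^bsub>mat_monoid n R\<^esub> ?E"
    using MM.inv_unique[OF l r] M C E by simp
  then show ?thesis using l r M C E(1) MM.m_closed unfolding Units_def by auto
qed

lemma SL_carrier: "M \<in> carrier (SL n R) \<longleftrightarrow> M \<in> carrier (mat_monoid n R) \<and> mat_det n R M = \<one>"
  by (simp add: SL_def)

lemma SL_mult [simp]: "M \<otimes>\<^bsub>SL n R\<^esub> N = M \<otimes>\<^bsub>mat_monoid n R\<^esub> N" "\<one>\<^bsub>SL n R\<^esub> = \<one>\<^bsub>mat_monoid n R\<^esub>"
  by (simp_all add: SL_def)

lemma GL_simps [simp]: "carrier (GL n R) = Units (mat_monoid n R)"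
  "M \<otimes>\<^bsub>GL n R\<^esub> N = M \<otimes>\<^bsub>mat_monoid n R\<^esub> N" "\<one>\<^bsub>GL n R\<^esub> = \<one>\<^bsub>mat_monoid n R\<^esub>"
  by (simp_all add: GL_def units_of_def)

lemma SL_mult_closed:
  "M \<in> carrier (SL n R) \<Longrightarrow> N \<in> carrier (SL n R) \<Longrightarrow> M \<otimes>\<^bsub>mat_monoid n R\<^esub> N \<in> carrier (SL n R)"
  by (simp add: SL_carrier mat_det_mult)

lemma SL_unit: "M \<in> carrier (SL n R) \<Longrightarrow> M \<in> Units (mat_monoid n R)"
  by (auto simp: SL_carrier intro: mat_unitI)

lemma emat_SL: "r \<in> carrier R \<Longrightarrow> i < n \<Longrightarrow> j < n \<Longrightarrow> i \<noteq> j \<Longrightarrow> emat n R i j r \<in> carrier (SL n R)"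
  by (simp add: SL_carrier emat_closed mat_det_emat)

lemma emat_add:
  assumes "r \<in> carrier R" "s \<in> carrier R" "i < n" "j < n" "i \<noteq> j"
  shows "emat n R i j r \<otimes>\<^bsub>mat_monoid n R\<^esub> emat n R i j s = emat n R i j (r \<oplus> s)"
  by (rule mat_eqI[of _ n R]) (use assms in \<open>auto simp: emat_mult_entry emat_closed a_comm\<close>)

lemma emat_zero: "i \<noteq> j \<Longrightarrow> emat n R i j \<zero> = \<one>\<^bsub>mat_monoid n R\<^esub>"
  by (rule mat_eqI[of _ n R]) (auto simp: emat_closed)

end

section \<open>Generation of the special linear group by elementary matrices\<close>

context cring begin

lemma SL_inverse:
  assumes M: "M \<in> carrier (SL n R)"
  shows "inv\<^bsub>mat_monoid n R\<^esub> M \<in> carrier (SL n R)"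
    "inv\<^bsub>mat_monoid n R\<^esub> M \<otimes>\<^bsub>mat_monoid n R\<^esub> M = \<one>\<^bsub>mat_monoid n R\<^esub>"
proof -
  interpret MM: monoid "mat_monoid n R" by (rule mat_monoid)
  let ?N = "inv\<^bsub>mat_monoid n R\<^esub> M"
  have u: "M \<in> Units (mat_monoid n R)" by (rule SL_unit[OF M])
  show 1: "?N \<otimes>\<^bsub>mat_monoid n R\<^esub> M = \<one>\<^bsub>mat_monoid n R\<^esub>" by (rule MM.Units_l_inv[OF u])
  have N: "?N \<in> carrier (mat_monoid n R)" by (rule MM.Units_inv_closed[OF u])
  have MC: "M \<in> carrier (mat_monoid n R)" "mat_det n R M = \<one>" using M by (simp_all add: SL_carrier)
  have "mat_det n R ?N \<otimes> mat_det n R M = \<one>" unfolding mat_det_mult[OF N MC(1), symmetric] 1 by (rule mat_det_one)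
  then show "?N \<in> carrier (SL n R)" using N MC by (simp add: SL_carrier)
qed

lemma SL_GL_hom: "(\<lambda>g. g) \<in> hom (SL n R) (GL n R)"
  by (rule homI) (simp_all add: SL_unit)

lemma emat_cancel_left:
  assumes "M \<in> carrier (mat_monoid n R)" "r \<in> carrier R" "i < n" "j < n" "i \<noteq> j"
  shows "emat n R i j (\<ominus> r) \<otimes>\<^bsub>mat_monoid n R\<^esub> (emat n R i j r \<otimes>\<^bsub>mat_monoid n R\<^esub> M) = M"
proof -
  interpret MM: monoid "mat_monoid n R" by (rule mat_monoid)
  have "emat n R i j (\<ominus> r) \<otimes>\<^bsub>mat_monoid n R\<^esub> emat n R i j r = \<one>\<^bsub>mat_monoid n R\<^esub>"
    using assms by (simp add: emat_add emat_zero l_neg)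
  then show ?thesis
    using MM.m_assoc[of "emat n R i j (\<ominus> r)" "emat n R i j r" M] assms by (simp add: emat_closed)
qed

lemma emat_cancel_right:
  assumes "M \<in> carrier (mat_monoid n R)" "r \<in> carrier R" "i < n" "j < n" "i \<noteq> j"
  shows "(M \<otimes>\<^bsub>mat_monoid n R\<^esub> emat n R i j r) \<otimes>\<^bsub>mat_monoid n R\<^esub> emat n R i j (\<ominus> r) = M"
proof -
  interpret MM: monoid "mat_monoid n R" by (rule mat_monoid)
  have "emat n R i j r \<otimes>\<^bsub>mat_monoid n R\<^esub> emat n R i j (\<ominus> r) = \<one>\<^bsub>mat_monoid n R\<^esub>"
    using assms by (simp add: emat_add emat_zero r_neg)
  then show ?thesis
    using MM.m_assoc[of M "emat n R i j r" "emat n R i j (\<ominus> r)"] assms by (simp add: emat_closed)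
qed

end

context complete_residue begin

text \<open>Otherwise the column vanishes in the residue field, against the invertibility of the matrix.\<close>

lemma unit_in_column:
  assumes M: "M \<in> carrier (SL n A)" and k: "k < n"
  shows "\<exists>i<n. M (i, k) \<in> Units A"
proof (rule ccontr)
  assume neg: "\<not> ?thesis"
  let ?N = "inv\<^bsub>mat_monoid n A\<^esub> M"
  have MC: "M \<in> carrier (mat_monoid n A)" and N: "?N \<in> carrier (mat_monoid n A)"
    using M A.SL_inverse(1)[OF M] by (simp_all add: A.SL_carrier)
  have z: "\<pi> (M (i, k)) = \<zero>\<^bsub>K\<^esub>" if "i < n" for i
    using neg that unit_iff[OF mat_entry[OF MC that k]] by blast
  have "(\<Oplus>\<^bsub>A\<^esub>l\<in>{..<n}. ?N (k, l) \<otimes>\<^bsub>A\<^esub> M (l, k)) = \<one>\<^bsub>A\<^esub>"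
    using A.SL_inverse(2)[OF M] mat_mult_entry[OF k k, of A ?N M] k by simp
  then have "\<one>\<^bsub>K\<^esub> = \<pi> (\<Oplus>\<^bsub>A\<^esub>l\<in>{..<n}. ?N (k, l) \<otimes>\<^bsub>A\<^esub> M (l, k))" using ring_hom_one[OF hom] by simp
  also have "\<dots> = (\<Oplus>\<^bsub>K\<^esub>l\<in>{..<n}. \<pi> (?N (k, l) \<otimes>\<^bsub>A\<^esub> M (l, k)))"
    by (rule ring_hom_finsum[OF A.is_cring K.is_cring hom]) (use MC N k in auto)
  also have "\<dots> = (\<Oplus>\<^bsub>K\<^esub>l\<in>{..<n}. \<zero>\<^bsub>K\<^esub>)"
  proof (rule K.finsum_cong')
    fix l assume "l \<in> {..<n}"
    then have l: "l < n" by simp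
    show "\<pi> (?N (k, l) \<otimes>\<^bsub>A\<^esub> M (l, k)) = \<zero>\<^bsub>K\<^esub>"
      unfolding ring_hom_mult[OF hom mat_entry[OF N k l] mat_entry[OF MC l k]] z[OF l]
      by (rule K.r_null[OF ring_hom_closed[OF hom mat_entry[OF N k l]]])
  qed simp_all
  finally show False using K.one_not_zero by simp
qed

text \<open>Gaussian elimination.  A matrix that agrees with the identity outside its upper left block of
size \<open>k + 1\<close> with \<open>k \<ge> 1\<close> is brought to size \<open>k\<close>: a unit in the last column of the block is used to make
the corner entry 1, and this entry clears the column and the row.  A block of size 1 is
the identity since the determinant is 1.\<close>

lemma SL_induct [consumes 1, case_names one left right]:
  assumes M: "M \<in> carrier (SL n A)"
    and one: "Q \<one>\<^bsub>mat_monoid n A\<^esub>"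
    and left: "\<And>i j r M. i < n \<Longrightarrow> j < n \<Longrightarrow> i \<noteq> j \<Longrightarrow> r \<in> carrier A \<Longrightarrow> M \<in> carrier (SL n A) \<Longrightarrow>
      Q M \<Longrightarrow> Q (emat n A i j r \<otimes>\<^bsub>mat_monoid n A\<^esub> M)"
    and right: "\<And>i j r M. i < n \<Longrightarrow> j < n \<Longrightarrow> i \<noteq> j \<Longrightarrow> r \<in> carrier A \<Longrightarrow> M \<in> carrier (SL n A) \<Longrightarrow>
      Q M \<Longrightarrow> Q (M \<otimes>\<^bsub>mat_monoid n A\<^esub> emat n A i j r)"
  shows "Q M"
proof -
  let ?\<delta> = "\<lambda>i j. if i = j then \<one>\<^bsub>A\<^esub> else \<zero>\<^bsub>A\<^esub>"
  have ent: "M (i, j) \<in> carrier A" if "M \<in> carrier (SL n A)" "i < n" "j < n" for M i j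
    using that mat_entry[of M n A i j] by (simp add: A.SL_carrier)
  have linv: "Q M" if "Q (emat n A i j r \<otimes>\<^bsub>mat_monoid n A\<^esub> M)" "M \<in> carrier (SL n A)"
    "i < n" "j < n" "i \<noteq> j" "r \<in> carrier A" for M i j r
  proof -
    have "emat n A i j r \<otimes>\<^bsub>mat_monoid n A\<^esub> M \<in> carrier (SL n A)"
      using that by (intro A.SL_mult_closed A.emat_SL)
    from left[OF that(3-5) A.a_inv_closed[OF that(6)] this that(1)] show ?thesis
      using that A.SL_carrier by (simp add: A.emat_cancel_left)
  qed
  have rinv: "Q M" if "Q (M \<otimes>\<^bsub>mat_monoid n A\<^esub> emat n A i j r)" "M \<in> carrier (SL n A)"
    "i < n" "j < n" "i \<noteq> j" "r \<in> carrier A" for M i j r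
  proof -
    have "M \<otimes>\<^bsub>mat_monoid n A\<^esub> emat n A i j r \<in> carrier (SL n A)"
      using that by (intro A.SL_mult_closed A.emat_SL)
    from right[OF that(3-5) A.a_inv_closed[OF that(6)] this that(1)] show ?thesis
      using that A.SL_carrier by (simp add: A.emat_cancel_right)
  qed
  have entL: "(emat n A i j r \<otimes>\<^bsub>mat_monoid n A\<^esub> M) (a, b) =
      (if a = i then M (i, b) \<oplus>\<^bsub>A\<^esub> r \<otimes>\<^bsub>A\<^esub> M (j, b) else M (a, b))"
    if "M \<in> carrier (SL n A)" "i < n" "j < n" "i \<noteq> j" "r \<in> carrier A" "a < n" "b < n" for M i j r a b
    using that A.SL_carrier by (simp add: A.emat_mult_entry)
  have entR: "(M \<otimes>\<^bsub>mat_monoid n A\<^esub> emat n A i j r) (a, b) =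
      (if b = j then M (a, j) \<oplus>\<^bsub>A\<^esub> M (a, i) \<otimes>\<^bsub>A\<^esub> r else M (a, b))"
    if "M \<in> carrier (SL n A)" "i < n" "j < n" "i \<noteq> j" "r \<in> carrier A" "a < n" "b < n" for M i j r a b
    using that A.SL_carrier by (simp add: A.mult_emat_entry)
  define block where "block k M \<longleftrightarrow> (\<forall>i<n. \<forall>j<n. k \<le> i \<or> k \<le> j \<longrightarrow> M (i, j) = ?\<delta> i j)" for k and M :: "'a matr"
  have blockD: "M (i, j) = ?\<delta> i j" if "block k M" "i < n" "j < n" "k \<le> i \<or> k \<le> j" for k M i j
    using that unfolding block_def by blast
  have "Q M" if "k \<le> n" "M \<in> carrier (SL n A)" "block k M" for k M
    using that
  proof (induction k arbitrary: M)
    case 0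
    have "M = \<one>\<^bsub>mat_monoid n A\<^esub>"
      by (rule mat_eqI[of _ n A]) (use 0 A.SL_carrier in \<open>auto simp: block_def\<close>)
    then show ?case using one by simp
  next
    case (Suc k)
    then have k: "k < n" by simp
    show ?case
    proof (cases "k = 0")
      case True
      let ?d = "M (0, 0)"
      have d: "?d \<in> carrier A" using Suc.prems(2) k True ent by simp
      let ?t = "\<lambda>i. if i = 0 then ?d else \<one>\<^bsub>A\<^esub>"
      have MD: "M = dmat n A ?t"
        by (rule mat_eqI[of _ n A])
          (use Suc.prems A.SL_carrier d True in \<open>auto simp: block_def intro!: A.dmat_closed\<close>)
      have "\<one>\<^bsub>A\<^esub> = mat_det n A (dmat n A ?t)" using Suc.prems(2) MD A.SL_carrier by simp
      also have "\<dots> = (\<Otimes>\<^bsub>A\<^esub>i\<in>{..<n}. ?t i)" by (rule A.mat_det_dmat) (use d in simp)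
      also have "\<dots> = (\<Otimes>\<^bsub>A\<^esub>i\<in>{..<n}. if 0 = i then ?d else \<one>\<^bsub>A\<^esub>)"
        by (rule A.finprod_cong') (use d in auto)
      also have "\<dots> = ?d" using A.finprod_singleton[of 0 "{..<n}" "\<lambda>_. ?d"] k d by simp
      finally have "?d = \<one>\<^bsub>A\<^esub>" by simp
      then have "dmat n A ?t = \<one>\<^bsub>mat_monoid n A\<^esub>"
        by (intro mat_eqI[of _ n A]) (auto intro!: A.dmat_closed)
      then have "M = \<one>\<^bsub>mat_monoid n A\<^esub>" using MD by simp
      then show ?thesis using one by simp
    next
      case False
      \<comment> \<open>Here the column is already cleared, and the entries of the row from position \<open>c\<close> on.\<close>
      have rows: "Q M" if "c \<le> k" "M \<in> carrier (SL n A)" "block (Suc k) M" "M (k, k) = \<one>\<^bsub>A\<^esub>"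
        "\<forall>i<k. M (i, k) = \<zero>\<^bsub>A\<^esub>" "\<forall>j<k. c \<le> j \<longrightarrow> M (k, j) = \<zero>\<^bsub>A\<^esub>" for c M
        using that
      proof (induction c arbitrary: M)
        case 0
        have "block k M"
          unfolding block_def
        proof (intro allI impI)
          fix i j assume ij: "i < n" "j < n" "k \<le> i \<or> k \<le> j"
          show "M (i, j) = ?\<delta> i j"
          proof (cases "Suc k \<le> i \<or> Suc k \<le> j")
            case True
            then show ?thesis by (intro blockD[OF 0(3)] ij)
          next
            case False
            then have "i = k \<and> j = k \<or> i = k \<and> j < k \<or> i < k \<and> j = k" using ij by auto
            then show ?thesis using 0 by auto
          qed
        qed
        then show ?case using Suc.IH[of M] 0 k by simp
      next
        case (Suc c)
        let ?r = "\<ominus>\<^bsub>A\<^esub> M (k, c)"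
        have c: "c < k" "c < n" using Suc.prems(1) k by auto
        have r: "?r \<in> carrier A" "M (k, c) \<in> carrier A" using ent[OF Suc.prems(2) k c(2)] by auto
        let ?M = "M \<otimes>\<^bsub>mat_monoid n A\<^esub> emat n A k c ?r"
        have e: "?M (a, b) = (if b = c then M (a, c) \<oplus>\<^bsub>A\<^esub> M (a, k) \<otimes>\<^bsub>A\<^esub> ?r else M (a, b))" if "a < n" "b < n" for a b
          using entR[OF Suc.prems(2) k c(2) _ r(1) that] c by simp
        have col: "M (a, k) = ?\<delta> a k" if "a < n" for a
          using Suc.prems(4,5) blockD[OF Suc.prems(3) that k] by (cases a k rule: linorder_cases) auto
        have e': "?M (a, b) = (if a = k \<and> b = c then \<zero>\<^bsub>A\<^esub> else M (a, b))" if "a < n" "b < n" for a b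
          using e[OF that] col[OF that(1)] r ent[OF Suc.prems(2) that(1) c(2)] by (auto simp: A.r_neg)
        have "Q ?M"
        proof (rule Suc.IH)
          show "?M \<in> carrier (SL n A)" using Suc.prems(2) r k c by (intro A.SL_mult_closed A.emat_SL) auto
          show "block (Suc k) ?M" unfolding block_def using blockD[OF Suc.prems(3)] e' c by auto
          show "?M (k, k) = \<one>\<^bsub>A\<^esub>" using e'[OF k k] c Suc.prems(4) by simp
          show "\<forall>i<k. ?M (i, k) = \<zero>\<^bsub>A\<^esub>" using e' k Suc.prems(5) by simp
          show "\<forall>j<k. c \<le> j \<longrightarrow> ?M (k, j) = \<zero>\<^bsub>A\<^esub>"
            using e'[OF k] k Suc.prems(6) by (auto simp: Suc_le_eq)
        qed (use c in simp)
        then show ?case using rinv[of M k c ?r] Suc.prems(2) k c r by simp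
      qed
      \<comment> \<open>Here the entries of the column from position \<open>c\<close> on are cleared.\<close>
      have cols: "Q M" if "c \<le> k" "M \<in> carrier (SL n A)" "block (Suc k) M" "M (k, k) = \<one>\<^bsub>A\<^esub>"
        "\<forall>i<k. c \<le> i \<longrightarrow> M (i, k) = \<zero>\<^bsub>A\<^esub>" for c M
        using that
      proof (induction c arbitrary: M)
        case 0
        then show ?case using rows[of k M] by simp
      next
        case (Suc c)
        let ?r = "\<ominus>\<^bsub>A\<^esub> M (c, k)"
        have c: "c < k" "c < n" using Suc.prems(1) k by auto
        have r: "?r \<in> carrier A" "M (c, k) \<in> carrier A" using ent[OF Suc.prems(2) c(2) k] by auto
        let ?M = "emat n A c k ?r \<otimes>\<^bsub>mat_monoid n A\<^esub> M"
        have e: "?M (a, b) = (if a = c then M (c, b) \<oplus>\<^bsub>A\<^esub> ?r \<otimes>\<^bsub>A\<^esub> M (k, b) else M (a, b))" if "a < n" "b < n" for a b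
          using entL[OF Suc.prems(2) c(2) k _ r(1) that] c by simp
        have ck: "?M (c, k) = \<zero>\<^bsub>A\<^esub>" using e[OF c(2) k] Suc.prems(4) r by (simp add: A.r_neg)
        have "Q ?M"
        proof (rule Suc.IH)
          show "?M \<in> carrier (SL n A)" using Suc.prems(2) r k c by (intro A.SL_mult_closed A.emat_SL) auto
          show "block (Suc k) ?M"
            unfolding block_def
          proof (intro allI impI)
            fix i j assume ij: "i < n" "j < n" "Suc k \<le> i \<or> Suc k \<le> j"
            have "M (i, j) = ?\<delta> i j" by (intro blockD[OF Suc.prems(3)] ij)
            moreover have "M (k, j) = \<zero>\<^bsub>A\<^esub>" if "i = c"
              using blockD[OF Suc.prems(3) k ij(2)] ij that c k by auto
            ultimately show "?M (i, j) = ?\<delta> i j" using e[OF ij(1,2)] r c by auto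
          qed
          show "?M (k, k) = \<one>\<^bsub>A\<^esub>" using e[OF k k] c Suc.prems(4) by simp
          show "\<forall>i<k. c \<le> i \<longrightarrow> ?M (i, k) = \<zero>\<^bsub>A\<^esub>"
            using e[OF _ k] ck k Suc.prems(5) by (auto simp: Suc_le_eq)
        qed (use c in simp)
        then show ?case using linv[of c k ?r M] Suc.prems(2) k c r by simp
      qed
      have above: "Q M" if M: "M \<in> carrier (SL n A)" "block (Suc k) M" and i: "i < k" "M (i, k) \<in> Units A" for i M
      proof -
        let ?r = "(\<one>\<^bsub>A\<^esub> \<ominus>\<^bsub>A\<^esub> M (k, k)) \<otimes>\<^bsub>A\<^esub> inv\<^bsub>A\<^esub> M (i, k)"
        have i': "i < n" using i k by simp
        have kk: "M (k, k) \<in> carrier A" "M (i, k) \<in> carrier A" using ent[OF M(1)] k i' by auto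
        have r: "?r \<in> carrier A" using kk i by simp
        let ?M = "emat n A k i ?r \<otimes>\<^bsub>mat_monoid n A\<^esub> M"
        have e: "?M (a, b) = (if a = k then M (k, b) \<oplus>\<^bsub>A\<^esub> ?r \<otimes>\<^bsub>A\<^esub> M (i, b) else M (a, b))" if "a < n" "b < n" for a b
          using entL[OF M(1) k i' _ r that] i by simp
        have "?r \<otimes>\<^bsub>A\<^esub> M (i, k) = \<one>\<^bsub>A\<^esub> \<ominus>\<^bsub>A\<^esub> M (k, k)" using kk i by (simp add: A.m_assoc)
        then have 1: "?M (k, k) = \<one>\<^bsub>A\<^esub>" using e[OF k k] kk by (simp add: a_minus_def A.a_lcomm A.r_neg)
        have SLM: "?M \<in> carrier (SL n A)" using M r k i i' by (intro A.SL_mult_closed A.emat_SL) auto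
        have "block (Suc k) ?M"
          unfolding block_def
        proof (intro allI impI)
          fix a j assume ij: "a < n" "j < n" "Suc k \<le> a \<or> Suc k \<le> j"
          have "M (a, j) = ?\<delta> a j" by (intro blockD[OF M(2)] ij)
          moreover have "M (i, j) = \<zero>\<^bsub>A\<^esub>" if "a = k"
            using blockD[OF M(2) i' ij(2)] ij that i k by auto
          ultimately show "?M (a, j) = ?\<delta> a j" using e[OF ij(1,2)] r by auto
        qed
        then have "Q ?M" using cols[of k ?M] SLM 1 by simp
        then show ?thesis using linv[of k i ?r M] M(1) k i i' r by simp
      qed
      obtain i where i: "i < n" "M (i, k) \<in> Units A" using unit_in_column[OF Suc.prems(2) k] by blast
      have "i \<le> k"
      proof (rule ccontr)
        assume "\<not> i \<le> k"
        then have "M (i, k) = \<zero>\<^bsub>A\<^esub>" using blockD[OF Suc.prems(3) i(1) k] by auto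
        then show False using i(2) unit_iff[of "\<zero>\<^bsub>A\<^esub>"] by simp
      qed
      show ?thesis
      proof (cases "i < k")
        case True
        then show ?thesis using above[OF Suc.prems(2,3)] i by blast
      next
        case False
        then have "i = k" using \<open>i \<le> k\<close> by simp
        then have u: "M (k, k) \<in> Units A" using i by simp
        \<comment> \<open>The only unit is in the corner: first create the unit 1 in row 0, which is above it since \<open>k > 0\<close>.\<close>
        let ?r = "(\<one>\<^bsub>A\<^esub> \<ominus>\<^bsub>A\<^esub> M (0, k)) \<otimes>\<^bsub>A\<^esub> inv\<^bsub>A\<^esub> M (k, k)"
        have n0: "0 < n" "0 < k" using k \<open>k \<noteq> 0\<close> by auto
        have kk: "M (k, k) \<in> carrier A" "M (0, k) \<in> carrier A" using ent[OF Suc.prems(2)] k n0 by auto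
        have r: "?r \<in> carrier A" using kk u by simp
        let ?M = "emat n A 0 k ?r \<otimes>\<^bsub>mat_monoid n A\<^esub> M"
        have e: "?M (a, b) = (if a = 0 then M (0, b) \<oplus>\<^bsub>A\<^esub> ?r \<otimes>\<^bsub>A\<^esub> M (k, b) else M (a, b))" if "a < n" "b < n" for a b
          using entL[OF Suc.prems(2) n0(1) k _ r that] n0 by simp
        have "?r \<otimes>\<^bsub>A\<^esub> M (k, k) = \<one>\<^bsub>A\<^esub> \<ominus>\<^bsub>A\<^esub> M (0, k)" using kk u by (simp add: A.m_assoc)
        then have 1: "?M (0, k) = \<one>\<^bsub>A\<^esub>" using e[OF n0(1) k] kk by (simp add: a_minus_def A.a_lcomm A.r_neg)
        have SLM: "?M \<in> carrier (SL n A)" using Suc.prems(2) r k n0 by (intro A.SL_mult_closed A.emat_SL) auto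
        have "block (Suc k) ?M"
          unfolding block_def
        proof (intro allI impI)
          fix a j assume ij: "a < n" "j < n" "Suc k \<le> a \<or> Suc k \<le> j"
          have "M (a, j) = ?\<delta> a j" by (intro blockD[OF Suc.prems(3)] ij)
          moreover have "M (k, j) = \<zero>\<^bsub>A\<^esub>" if "a = 0"
            using blockD[OF Suc.prems(3) k ij(2)] ij that n0 k by auto
          ultimately show "?M (a, j) = ?\<delta> a j" using e[OF ij(1,2)] r by auto
        qed
        then have "Q ?M" using above[of ?M 0] SLM 1 n0 by simp
        then show ?thesis using linv[of 0 k ?r M] Suc.prems(2) k n0 r by simp
      qed
    qed
  qed
  from this[of n M] M show ?thesis by (simp add: block_def)
qed

end

section \<open>The diagonal torus\<close>

lemma (in field) exists_pow_ne_one: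
  assumes "finite (carrier R)" "d \<noteq> 0" "d + 1 < card (carrier R)"
  shows "\<exists>a\<in>carrier R - {\<zero>}. a [^] d \<noteq> \<one>"
proof (rule ccontr)
  assume neg: "\<not> ?thesis"
  have "card (carrier R - {\<zero>}) \<le> card {x \<in> carrier R. x [^] d = \<one>}"
    using neg assms(1) by (intro card_mono) auto
  also have "\<dots> \<le> d" by (rule num_roots_le_deg[OF assms(1,2)])
  finally have "card (carrier R) - 1 \<le> d" by (simp only: card_Diff_singleton[OF zero_closed])
  then show False using assms(3) by linarith
qed

locale torus = K: field K for K :: "('k, 'd) ring_scheme" +
  fixes n :: nat
  assumes finK: "finite (carrier K)"
begin

text \<open>Parameters of the diagonal matrices of determinant 1 over the residue field; taken
extensional so that the set is finite.\<close>

definition T :: "(nat \<Rightarrow> 'k) set" where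
  "T = {t \<in> {..<n} \<rightarrow>\<^sub>E (carrier K - {\<zero>\<^bsub>K\<^esub>}). (\<Otimes>\<^bsub>K\<^esub>i\<in>{..<n}. t i) = \<one>\<^bsub>K\<^esub>}"

lemma T_entry: "t \<in> T \<Longrightarrow> i < n \<Longrightarrow> t i \<in> carrier K" "t \<in> T \<Longrightarrow> i < n \<Longrightarrow> t i \<noteq> \<zero>\<^bsub>K\<^esub>"
  by (auto simp: T_def PiE_def Pi_def)

lemma T_ext: "s \<in> T \<Longrightarrow> t \<in> T \<Longrightarrow> (\<And>i. i < n \<Longrightarrow> s i = t i) \<Longrightarrow> s = t"
  unfolding T_def by (blast intro: PiE_ext)

lemma TI:
  assumes "\<And>i. i < n \<Longrightarrow> t i \<in> carrier K" "\<And>i. i < n \<Longrightarrow> t i \<noteq> \<zero>\<^bsub>K\<^esub>" "(\<Otimes>\<^bsub>K\<^esub>i\<in>{..<n}. t i) = \<one>\<^bsub>K\<^esub>"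
  shows "restrict t {..<n} \<in> T"
proof -
  have "(\<Otimes>\<^bsub>K\<^esub>i\<in>{..<n}. restrict t {..<n} i) = (\<Otimes>\<^bsub>K\<^esub>i\<in>{..<n}. t i)"
    by (rule K.finprod_cong') (use assms(1) in auto)
  then have p: "(\<Otimes>\<^bsub>K\<^esub>i\<in>{..<n}. restrict t {..<n} i) = \<one>\<^bsub>K\<^esub>" unfolding assms(3) .
  have "restrict t {..<n} \<in> {..<n} \<rightarrow>\<^sub>E (carrier K - {\<zero>\<^bsub>K\<^esub>})" using assms(1,2) by auto
  with p show ?thesis unfolding T_def by blast
qed

definition tmul :: "(nat \<Rightarrow> 'k) \<Rightarrow> (nat \<Rightarrow> 'k) \<Rightarrow> nat \<Rightarrow> 'k" where
  "tmul s t = (\<lambda>i\<in>{..<n}. s i \<otimes>\<^bsub>K\<^esub> t i)"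

lemma tmul_entry [simp]: "i < n \<Longrightarrow> tmul s t i = s i \<otimes>\<^bsub>K\<^esub> t i"
  by (simp add: tmul_def)

lemma tmul_T: assumes "s \<in> T" "t \<in> T" shows "tmul s t \<in> T"
  unfolding tmul_def
proof (rule TI)
  fix i assume "i < n"
  then show "s i \<otimes>\<^bsub>K\<^esub> t i \<in> carrier K" "s i \<otimes>\<^bsub>K\<^esub> t i \<noteq> \<zero>\<^bsub>K\<^esub>"
    using T_entry[OF assms(1)] T_entry[OF assms(2)] K.integral[of "s i" "t i"] by auto
next
  have "(\<Otimes>\<^bsub>K\<^esub>i\<in>{..<n}. s i \<otimes>\<^bsub>K\<^esub> t i) = (\<Otimes>\<^bsub>K\<^esub>i\<in>{..<n}. s i) \<otimes>\<^bsub>K\<^esub> (\<Otimes>\<^bsub>K\<^esub>i\<in>{..<n}. t i)"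
    using T_entry[OF assms(1)] T_entry[OF assms(2)] by (intro K.finprod_multf) auto
  then show "(\<Otimes>\<^bsub>K\<^esub>i\<in>{..<n}. s i \<otimes>\<^bsub>K\<^esub> t i) = \<one>\<^bsub>K\<^esub>" using assms by (simp add: T_def)
qed

lemma K_inv:
  assumes "a \<in> carrier K" "a \<noteq> \<zero>\<^bsub>K\<^esub>"
  shows "inv\<^bsub>K\<^esub> a \<in> carrier K" "inv\<^bsub>K\<^esub> a \<noteq> \<zero>\<^bsub>K\<^esub>" "a \<otimes>\<^bsub>K\<^esub> inv\<^bsub>K\<^esub> a = \<one>\<^bsub>K\<^esub>" "inv\<^bsub>K\<^esub> a \<otimes>\<^bsub>K\<^esub> a = \<one>\<^bsub>K\<^esub>"
proof -
  have u: "a \<in> Units K" using assms K.field_Units by blast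
  show 1: "inv\<^bsub>K\<^esub> a \<in> carrier K" "a \<otimes>\<^bsub>K\<^esub> inv\<^bsub>K\<^esub> a = \<one>\<^bsub>K\<^esub>" "inv\<^bsub>K\<^esub> a \<otimes>\<^bsub>K\<^esub> a = \<one>\<^bsub>K\<^esub>"
    using K.Units_inv_closed[OF u] K.Units_r_inv[OF u] K.Units_l_inv[OF u] by blast+
  show "inv\<^bsub>K\<^esub> a \<noteq> \<zero>\<^bsub>K\<^esub>" using 1(2) assms(1) K.one_not_zero by (metis K.r_null)
qed

lemma finite_T: "finite T"
proof -
  have "finite ({..<n} \<rightarrow>\<^sub>E (carrier K - {\<zero>\<^bsub>K\<^esub>}))" using finK by (intro finite_PiE) auto
  then show ?thesis unfolding T_def by (rule rev_finite_subset) blast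
qed

lemma tmul_bij: assumes s: "s \<in> T" shows "bij_betw (tmul s) T T"
proof -
  have "inj_on (tmul s) T"
  proof (rule inj_onI)
    fix t u assume tu: "t \<in> T" "u \<in> T" "tmul s t = tmul s u"
    show "t = u"
    proof (rule T_ext[OF tu(1,2)])
      fix i assume i: "i < n"
      have "s i \<otimes>\<^bsub>K\<^esub> t i = s i \<otimes>\<^bsub>K\<^esub> u i" using fun_cong[OF tu(3), of i] i by simp
      then show "t i = u i"
        using K.m_lcancel[OF T_entry(2)[OF s i] T_entry(1)[OF s i] T_entry(1)[OF tu(1) i] T_entry(1)[OF tu(2) i]] by blast
    qed
  qed
  moreover have "tmul s ` T \<subseteq> T" using tmul_T[OF s] by blast
  ultimately show ?thesis using endo_inj_surj[OF finite_T] by (simp add: bij_betw_def)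
qed

text \<open>All entries but the last one are arbitrary, and the last one is determined by them.\<close>

lemma card_T:
  assumes n: "n \<ge> 1"
  shows "card T = (card (carrier K) - 1) ^ (n - 1)"
proof -
  obtain N where N: "n = Suc N" using n by (cases n) auto
  let ?S = "{..<N} \<rightarrow>\<^sub>E (carrier K - {\<zero>\<^bsub>K\<^esub>})"
  let ?p = "\<lambda>s. \<Otimes>\<^bsub>K\<^esub>i\<in>{..<N}. s i"
  let ?f = "\<lambda>s. \<lambda>i\<in>{..<n}. if i < N then s i else inv\<^bsub>K\<^esub> (?p s)"
  have p: "(\<Otimes>\<^bsub>K\<^esub>i\<in>I. s i) \<in> carrier K \<and> (\<Otimes>\<^bsub>K\<^esub>i\<in>I. s i) \<noteq> \<zero>\<^bsub>K\<^esub>"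
    if "finite I" "\<And>i. i \<in> I \<Longrightarrow> s i \<in> carrier K - {\<zero>\<^bsub>K\<^esub>}" for I :: "nat set" and s
    using that
  proof (induction I)
    case (insert x I)
    have s: "s x \<in> carrier K - {\<zero>\<^bsub>K\<^esub>}" "\<And>i. i \<in> I \<Longrightarrow> s i \<in> carrier K - {\<zero>\<^bsub>K\<^esub>}" using insert.prems by blast+
    have e: "(\<Otimes>\<^bsub>K\<^esub>i\<in>insert x I. s i) = s x \<otimes>\<^bsub>K\<^esub> (\<Otimes>\<^bsub>K\<^esub>i\<in>I. s i)"
      using insert.hyps s by (intro K.finprod_insert) auto
    show ?case unfolding e using insert.IH[OF s(2)] s(1) K.integral by auto
  qed simp
  have pS': "?p s \<in> carrier K \<and> ?p s \<noteq> \<zero>\<^bsub>K\<^esub>" if "s \<in> ?S" for s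
    by (rule p[OF finite_lessThan]) (rule PiE_mem[OF that])
  have pS: "?p s \<in> carrier K" "?p s \<noteq> \<zero>\<^bsub>K\<^esub>" if "s \<in> ?S" for s
    using pS'[OF that] by simp_all
  have sm: "s i \<in> carrier K" "s i \<noteq> \<zero>\<^bsub>K\<^esub>" if "s \<in> ?S" "i < N" for s i
    using PiE_mem[OF that(1), of i] that(2) by blast+
  have split: "(\<Otimes>\<^bsub>K\<^esub>i\<in>{..<n}. t i) = t N \<otimes>\<^bsub>K\<^esub> ?p t" if "\<And>i. i < n \<Longrightarrow> t i \<in> carrier K" for t
    unfolding N lessThan_Suc using that N by (intro K.finprod_insert) auto
  have "bij_betw ?f ?S T"
  proof (rule bij_betw_byWitness[where f' = "\<lambda>t. restrict t {..<N}"])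
    show "\<forall>s\<in>?S. restrict (?f s) {..<N} = s"
    proof
      fix s assume "s \<in> ?S"
      then have "s \<in> extensional {..<N}" by (auto simp: PiE_def)
      then show "restrict (?f s) {..<N} = s" using N by (auto simp: fun_eq_iff restrict_def extensional_def)
    qed
    show "?f ` ?S \<subseteq> T"
    proof safe
      fix s assume s: "s \<in> ?S"
      show "?f s \<in> T"
      proof (rule TI)
        fix i assume "i < n"
        show "(if i < N then s i else inv\<^bsub>K\<^esub> (?p s)) \<in> carrier K" "(if i < N then s i else inv\<^bsub>K\<^esub> (?p s)) \<noteq> \<zero>\<^bsub>K\<^esub>"
          using sm[OF s] K_inv[OF pS[OF s]] by simp_all
      next
        let ?t = "\<lambda>i. if i < N then s i else inv\<^bsub>K\<^esub> (?p s)"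
        have t: "?t i \<in> carrier K" for i using sm[OF s] K_inv[OF pS[OF s]] by simp
        have "(\<Otimes>\<^bsub>K\<^esub>i\<in>{..<n}. ?t i) = ?t N \<otimes>\<^bsub>K\<^esub> ?p ?t" by (rule split) (rule t)
        also have "?t N = inv\<^bsub>K\<^esub> (?p s)" by simp
        also have "?p ?t = ?p s" by (rule K.finprod_cong') (use sm[OF s] in simp_all)
        also have "inv\<^bsub>K\<^esub> (?p s) \<otimes>\<^bsub>K\<^esub> ?p s = \<one>\<^bsub>K\<^esub>" by (rule K_inv(4)[OF pS[OF s]])
        finally show "(\<Otimes>\<^bsub>K\<^esub>i\<in>{..<n}. ?t i) = \<one>\<^bsub>K\<^esub>" .
      qed
    qed
    show r: "(\<lambda>t. restrict t {..<N}) ` T \<subseteq> ?S"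
    proof
      fix s assume "s \<in> (\<lambda>t. restrict t {..<N}) ` T"
      then obtain t where t: "t \<in> T" "s = restrict t {..<N}" by blast
      have "t i \<in> carrier K - {\<zero>\<^bsub>K\<^esub>}" if "i \<in> {..<N}" for i
        using T_entry[OF t(1), of i] that N by simp
      then show "s \<in> ?S" unfolding t(2) by (simp add: restrict_PiE_iff)
    qed
    show "\<forall>t\<in>T. ?f (restrict t {..<N}) = t"
    proof
      fix t assume t: "t \<in> T"
      have rS: "restrict t {..<N} \<in> ?S" using r t by blast
      have pr: "?p (restrict t {..<N}) = ?p t"
        by (rule K.finprod_cong') (use T_entry[OF t] N in simp_all)
      have "t N \<otimes>\<^bsub>K\<^esub> ?p t = \<one>\<^bsub>K\<^esub>" using split[of t] T_entry[OF t] t by (auto simp: T_def)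
      then have "inv\<^bsub>K\<^esub> (?p t) = t N"
        using K.comm_inv_char[of "?p t" "t N"] pS[OF rS] T_entry(1)[OF t, of N] N
        unfolding pr by (simp add: K.m_comm)
      then have "?f (restrict t {..<N}) i = t i" if "i < n" for i
        unfolding pr using that N by (auto simp: less_Suc_eq)
      moreover have "?f (restrict t {..<N}) i = t i" if "\<not> i < n" for i
        using t that by (auto simp: T_def PiE_def extensional_def)
      ultimately show "?f (restrict t {..<N}) = t" by blast
    qed
  qed
  then have "card T = card ?S" by (simp add: bij_betw_same_card)
  also have "\<dots> = (\<Prod>i\<in>{..<N}. card (carrier K - {\<zero>\<^bsub>K\<^esub>}))" by (rule card_PiE) simp
  also have "\<dots> = (card (carrier K) - 1) ^ N" by (simp add: card_Diff_singleton)
  finally show ?thesis using N by simp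
qed

text \<open>The order of the torus is \<open>(q - 1) ^ (n - 1)\<close>, which is congruent to 1 or -1 modulo \<open>p\<close>; so averages
over the torus can be formed.\<close>

lemma card_T_nonzero:
  assumes n: "n \<ge> 1"
  shows "add_pow K (card T) \<one>\<^bsub>K\<^esub> \<noteq> \<zero>\<^bsub>K\<^esub>"
proof -
  let ?q = "card (carrier K)"
  have "?q \<noteq> 0" using finK K.one_closed by (metis card_0_eq empty_iff)
  then have q: "?q = Suc (?q - 1)" by simp
  have "add_pow K ?q \<one>\<^bsub>K\<^esub> = \<zero>\<^bsub>K\<^esub>"
    using K.add.pow_order_eq_1[of "\<one>\<^bsub>K\<^esub>"] finK by (simp add: Coset.order_def)
  then have "add_pow K (?q - 1) \<one>\<^bsub>K\<^esub> \<oplus>\<^bsub>K\<^esub> \<one>\<^bsub>K\<^esub> = \<zero>\<^bsub>K\<^esub>"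
    using K.add.nat_pow_Suc[of "?q - 1" "\<one>\<^bsub>K\<^esub>"] q by simp
  then have ne: "add_pow K (?q - 1) \<one>\<^bsub>K\<^esub> \<noteq> \<zero>\<^bsub>K\<^esub>" using K.one_not_zero by auto
  have pow: "add_pow K (b ^ k) \<one>\<^bsub>K\<^esub> = (add_pow K b \<one>\<^bsub>K\<^esub>) [^]\<^bsub>K\<^esub> k" for b k :: nat
  proof (induction k)
    case (Suc k)
    have "add_pow K (b ^ Suc k) \<one>\<^bsub>K\<^esub> = add_pow K b (add_pow K (b ^ k) \<one>\<^bsub>K\<^esub> \<otimes>\<^bsub>K\<^esub> \<one>\<^bsub>K\<^esub>)"
      by (simp add: K.add.nat_pow_pow mult.commute)
    also have "\<dots> = add_pow K (b ^ k) \<one>\<^bsub>K\<^esub> \<otimes>\<^bsub>K\<^esub> add_pow K b \<one>\<^bsub>K\<^esub>"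
      by (rule K.add_pow_rdistr[symmetric]) simp_all
    finally show ?case using Suc by simp
  qed simp
  show ?thesis unfolding card_T[OF n] pow by (rule K.nat_pow_nonzero[OF _ ne]) simp
qed

text \<open>The coroot of the pair \<open>(i, j)\<close>.\<close>

definition tor :: "nat \<Rightarrow> nat \<Rightarrow> 'k \<Rightarrow> nat \<Rightarrow> 'k" where
  "tor i j a = (\<lambda>k\<in>{..<n}. if k = i then a else if k = j then inv\<^bsub>K\<^esub> a else \<one>\<^bsub>K\<^esub>)"

lemma tor_entry [simp]: "k < n \<Longrightarrow> tor i j a k = (if k = i then a else if k = j then inv\<^bsub>K\<^esub> a else \<one>\<^bsub>K\<^esub>)"
  by (simp add: tor_def)

lemma tor_T:
  assumes ij: "i < n" "j < n" "i \<noteq> j" and a: "a \<in> carrier K" "a \<noteq> \<zero>\<^bsub>K\<^esub>"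
  shows "tor i j a \<in> T"
  unfolding tor_def
proof (rule TI)
  note K_inv[OF a]
  then show "(if k = i then a else if k = j then inv\<^bsub>K\<^esub> a else \<one>\<^bsub>K\<^esub>) \<in> carrier K"
    "(if k = i then a else if k = j then inv\<^bsub>K\<^esub> a else \<one>\<^bsub>K\<^esub>) \<noteq> \<zero>\<^bsub>K\<^esub>" for k
    using a by auto
  have "(\<Otimes>\<^bsub>K\<^esub>k\<in>{..<n}. if k = i then a else if k = j then inv\<^bsub>K\<^esub> a else \<one>\<^bsub>K\<^esub>) =
    (\<Otimes>\<^bsub>K\<^esub>k\<in>{..<n}. (if i = k then a else \<one>\<^bsub>K\<^esub>) \<otimes>\<^bsub>K\<^esub> (if j = k then inv\<^bsub>K\<^esub> a else \<one>\<^bsub>K\<^esub>))"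
    using ij a K_inv[OF a] by (intro K.finprod_cong') auto
  also have "\<dots> = (\<Otimes>\<^bsub>K\<^esub>k\<in>{..<n}. if i = k then a else \<one>\<^bsub>K\<^esub>) \<otimes>\<^bsub>K\<^esub> (\<Otimes>\<^bsub>K\<^esub>k\<in>{..<n}. if j = k then inv\<^bsub>K\<^esub> a else \<one>\<^bsub>K\<^esub>)"
    using a K_inv[OF a] by (intro K.finprod_multf) auto
  also have "\<dots> = a \<otimes>\<^bsub>K\<^esub> inv\<^bsub>K\<^esub> a"
    using K.finprod_singleton[of i "{..<n}" "\<lambda>_. a"] K.finprod_singleton[of j "{..<n}" "\<lambda>_. inv\<^bsub>K\<^esub> a"]
      ij a K_inv[OF a] by simp
  also have "\<dots> = \<one>\<^bsub>K\<^esub>" using K_inv[OF a] by simp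
  finally show "(\<Otimes>\<^bsub>K\<^esub>k\<in>{..<n}. if k = i then a else if k = j then inv\<^bsub>K\<^esub> a else \<one>\<^bsub>K\<^esub>) = \<one>\<^bsub>K\<^esub>" .
qed

end

locale big_torus = torus +
  assumes n2: "n \<ge> 2" and card4: "card (carrier K) \<ge> 4"
    and not5: "n = 2 \<Longrightarrow> card (carrier K) \<noteq> 5" and not4: "n = 3 \<Longrightarrow> card (carrier K) \<noteq> 4"
begin

lemma exists_sq_ne_one: "\<exists>a\<in>carrier K. a \<noteq> \<zero>\<^bsub>K\<^esub> \<and> a \<otimes>\<^bsub>K\<^esub> a \<noteq> \<one>\<^bsub>K\<^esub>"
proof -
  obtain a where a: "a \<in> carrier K - {\<zero>\<^bsub>K\<^esub>}" "a [^]\<^bsub>K\<^esub> (2::nat) \<noteq> \<one>\<^bsub>K\<^esub>"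
    using K.exists_pow_ne_one[OF finK, of 2] card4 by auto
  then have "a \<otimes>\<^bsub>K\<^esub> a \<noteq> \<one>\<^bsub>K\<^esub>" by (simp add: numeral_2_eq_2)
  then show ?thesis using a(1) by blast
qed

lemma inv_ne:
  assumes "a \<in> carrier K" "a \<noteq> \<zero>\<^bsub>K\<^esub>" "a \<otimes>\<^bsub>K\<^esub> a \<noteq> \<one>\<^bsub>K\<^esub>"
  shows "a \<noteq> inv\<^bsub>K\<^esub> a"
  using K_inv(3)[OF assms(1,2)] assms(3) by metis

text \<open>If a further index is available, a coroot that moves \<open>k\<close> and fixes \<open>i\<close> and \<open>j\<close> will do.
Otherwise \<open>n = 3\<close> and \<open>l\<close> is one of \<open>i\<close>, \<open>j\<close>; the elements with \<open>t i = t j = a\<close> have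
\<open>t k\<close> equal to the inverse of \<open>a \<otimes> a\<close>, and an \<open>a\<close> whose cube is not 1 exists
unless the field has 4 elements.\<close>

lemma separate_aux:
  assumes lt: "i < n" "j < n" "k < n" "l < n" and "i \<noteq> j" "k \<noteq> l" and k: "k \<noteq> i" "k \<noteq> j"
  shows "\<exists>t\<in>T. t i = t j \<and> t k \<noteq> t l"
proof -
  obtain b where b: "b \<in> carrier K" "b \<noteq> \<zero>\<^bsub>K\<^esub>" "b \<otimes>\<^bsub>K\<^esub> b \<noteq> \<one>\<^bsub>K\<^esub>" using exists_sq_ne_one by blast
  have b1: "b \<noteq> \<one>\<^bsub>K\<^esub>" using b K.l_one[OF K.one_closed] by metis
  show ?thesis
  proof (cases "l = i \<or> l = j")
    case False
    show ?thesis
    proof (rule bexI[OF _ tor_T[OF lt(3,4) \<open>k \<noteq> l\<close> b(1,2)]])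
      show "tor k l b i = tor k l b j \<and> tor k l b k \<noteq> tor k l b l"
        using lt k False \<open>k \<noteq> l\<close> inv_ne[OF b] by auto
    qed
  next
    case True
    show ?thesis
    proof (cases "\<exists>m<n. m \<notin> {i, j, k}")
      case T: True
      then obtain m where m: "m < n" "m \<noteq> i" "m \<noteq> j" "k \<noteq> m" by blast
      show ?thesis
        by (rule bexI[OF _ tor_T[OF lt(3) m(1,4) b(1,2)]]) (use lt k m True b1 in auto)
    next
      case False
      then have "{..<n} = {i, j, k}" using lt by auto
      then have "card {..<n} = card {i, j, k}" by simp
      then have "n = 3" using \<open>i \<noteq> j\<close> k by (simp add: card_insert_if)
      then have "3 + 1 < card (carrier K)" using not4 card4 by linarith
      from K.exists_pow_ne_one[OF finK _ this] obtain a where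
        a: "a \<in> carrier K" "a \<noteq> \<zero>\<^bsub>K\<^esub>" "a [^]\<^bsub>K\<^esub> (3::nat) \<noteq> \<one>\<^bsub>K\<^esub>" by auto
      have a3: "a \<otimes>\<^bsub>K\<^esub> a \<otimes>\<^bsub>K\<^esub> a \<noteq> \<one>\<^bsub>K\<^esub>" using a by (simp add: numeral_3_eq_3)
      have ne: "inv\<^bsub>K\<^esub> a \<otimes>\<^bsub>K\<^esub> inv\<^bsub>K\<^esub> a \<noteq> a"
      proof
        assume e: "inv\<^bsub>K\<^esub> a \<otimes>\<^bsub>K\<^esub> inv\<^bsub>K\<^esub> a = a"
        have "a \<otimes>\<^bsub>K\<^esub> a \<otimes>\<^bsub>K\<^esub> (inv\<^bsub>K\<^esub> a \<otimes>\<^bsub>K\<^esub> inv\<^bsub>K\<^esub> a) = (a \<otimes>\<^bsub>K\<^esub> inv\<^bsub>K\<^esub> a) \<otimes>\<^bsub>K\<^esub> (a \<otimes>\<^bsub>K\<^esub> inv\<^bsub>K\<^esub> a)"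
          using a(1) K_inv(1)[OF a(1,2)] by (simp add: K.m_ac)
        then show False using a3 K_inv(3)[OF a(1,2)] e by simp
      qed
      let ?t = "tmul (tor i k a) (tor j k a)"
      have "?t \<in> T" using lt k a by (intro tmul_T tor_T) auto
      moreover have "?t i = a" "?t j = a" "?t k = inv\<^bsub>K\<^esub> a \<otimes>\<^bsub>K\<^esub> inv\<^bsub>K\<^esub> a"
        using lt k \<open>i \<noteq> j\<close> a by auto
      ultimately show ?thesis using True ne by metis
    qed
  qed
qed

lemma separate:
  assumes lt: "i < n" "j < n" "k < n" "l < n" and "i \<noteq> j" "k \<noteq> l" and kl: "\<not> (k \<in> {i, j} \<and> l \<in> {i, j})"
  shows "\<exists>t\<in>T. t i = t j \<and> t k \<noteq> t l"
proof (cases "k \<in> {i, j}")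
  case False
  then show ?thesis using separate_aux[OF assms(1-6)] by blast
next
  case True
  then have l: "l \<noteq> i" "l \<noteq> j" using kl by auto
  from separate_aux[OF lt(1,2,4,3) \<open>i \<noteq> j\<close> \<open>k \<noteq> l\<close>[symmetric] l] show ?thesis by metis
qed

lemma ratio_sq:
  assumes "i < n" "j < n" "i \<noteq> j" "a \<in> carrier K" "a \<noteq> \<zero>\<^bsub>K\<^esub>"
  shows "\<exists>t\<in>T. t i = (a \<otimes>\<^bsub>K\<^esub> a) \<otimes>\<^bsub>K\<^esub> t j"
proof (rule bexI[OF _ tor_T[OF assms]])
  show "tor i j a i = (a \<otimes>\<^bsub>K\<^esub> a) \<otimes>\<^bsub>K\<^esub> tor i j a j"
    using assms K_inv[OF assms(4,5)] by (simp add: K.m_assoc)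
qed

text \<open>For \<open>n = 2\<close> only squares occur as ratios, which requires a fourth power different from 1 and
excludes the field with 5 elements.  For larger \<open>n\<close> all ratios occur.\<close>

lemma ratio_big:
  assumes ij: "i < n" "j < n" "i \<noteq> j"
  shows "\<exists>c\<in>carrier K. c \<otimes>\<^bsub>K\<^esub> c \<noteq> \<one>\<^bsub>K\<^esub> \<and> (\<exists>t\<in>T. t i = c \<otimes>\<^bsub>K\<^esub> t j)"
proof (cases "n = 2")
  case False
  have "\<exists>m<n. m \<noteq> i \<and> m \<noteq> j"
  proof (rule ccontr)
    assume "\<not> ?thesis"
    then have "{..<n} \<subseteq> {i, j}" by auto
    then have "card {..<n} \<le> card {i, j}" by (intro card_mono) auto
    then show False using False n2 ij by simp
  qed
  then obtain m where m: "m < n" "m \<noteq> i" "m \<noteq> j" by blast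
  obtain a where a: "a \<in> carrier K" "a \<noteq> \<zero>\<^bsub>K\<^esub>" "a \<otimes>\<^bsub>K\<^esub> a \<noteq> \<one>\<^bsub>K\<^esub>" using exists_sq_ne_one by blast
  have "tor i m a \<in> T" "tor i m a i = a \<otimes>\<^bsub>K\<^esub> tor i m a j"
    using tor_T[OF ij(1) m(1) _ a(1,2)] m ij a by auto
  then show ?thesis using a by blast
next
  case True
  have "\<exists>a\<in>carrier K - {\<zero>\<^bsub>K\<^esub>}. a [^]\<^bsub>K\<^esub> (4::nat) \<noteq> \<one>\<^bsub>K\<^esub>"
  proof (cases "card (carrier K) = 4")
    case c4: True
    obtain a where a: "a \<in> carrier K" "a \<noteq> \<zero>\<^bsub>K\<^esub>" "a \<otimes>\<^bsub>K\<^esub> a \<noteq> \<one>\<^bsub>K\<^esub>" using exists_sq_ne_one by blast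
    then have "a \<noteq> \<one>\<^bsub>K\<^esub>" using K.l_one[OF K.one_closed] by metis
    then have "a [^]\<^bsub>K\<^esub> (4::nat) \<noteq> \<one>\<^bsub>K\<^esub>" using K.finite_field_pow_card[OF finK a(1)] unfolding c4 by simp
    then show ?thesis using a by blast
  next
    case False
    then have "4 + 1 < card (carrier K)" using card4 not5 True by linarith
    then show ?thesis by (intro K.exists_pow_ne_one[OF finK]) auto
  qed
  then obtain a where a: "a \<in> carrier K" "a \<noteq> \<zero>\<^bsub>K\<^esub>" "a [^]\<^bsub>K\<^esub> (4::nat) \<noteq> \<one>\<^bsub>K\<^esub>" by blast
  have "a [^]\<^bsub>K\<^esub> (4::nat) = (a \<otimes>\<^bsub>K\<^esub> a) \<otimes>\<^bsub>K\<^esub> (a \<otimes>\<^bsub>K\<^esub> a)"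
    using a(1) by (simp add: numeral_eq_Suc K.m_assoc)
  then show ?thesis using ratio_sq[OF ij a(1,2)] a by (intro bexI[of _ "a \<otimes>\<^bsub>K\<^esub> a"]) auto
qed

end

section \<open>Diagonalizing a lift on the torus\<close>

lemma (in complete_residue) tau_finprod:
  assumes "\<And>i. i \<in> I \<Longrightarrow> t i \<in> carrier K"
  shows "(\<Otimes>\<^bsub>A\<^esub>i\<in>I. tau (t i)) = tau (\<Otimes>\<^bsub>K\<^esub>i\<in>I. t i)"
  using assms
proof (induction I rule: infinite_finite_induct)
  case (insert x I)
  have t: "t x \<in> carrier K" "t \<in> I \<rightarrow> carrier K" "\<And>i. i \<in> I \<Longrightarrow> t i \<in> carrier K" using insert.prems by auto
  have "(\<Otimes>\<^bsub>A\<^esub>i\<in>insert x I. tau (t i)) = tau (t x) \<otimes>\<^bsub>A\<^esub> (\<Otimes>\<^bsub>A\<^esub>i\<in>I. tau (t i))"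
    using insert.hyps t tau_closed by (intro A.finprod_insert) auto
  also have "\<dots> = tau (t x) \<otimes>\<^bsub>A\<^esub> tau (\<Otimes>\<^bsub>K\<^esub>i\<in>I. t i)" using insert.IH[OF t(3)] by simp
  also have "\<dots> = tau (t x \<otimes>\<^bsub>K\<^esub> (\<Otimes>\<^bsub>K\<^esub>i\<in>I. t i))" using t by (intro tau_mult[symmetric] K.finprod_closed) auto
  also have "t x \<otimes>\<^bsub>K\<^esub> (\<Otimes>\<^bsub>K\<^esub>i\<in>I. t i) = (\<Otimes>\<^bsub>K\<^esub>i\<in>insert x I. t i)"
    using insert.hyps t by (intro K.finprod_insert[symmetric]) auto
  finally show ?case .
qed (simp_all add: tau_one)

definition mat_sum :: "nat \<Rightarrow> ('a, 'c) ring_scheme \<Rightarrow> ('t \<Rightarrow> 'a matr) \<Rightarrow> 't set \<Rightarrow> 'a matr" where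
  "mat_sum n R F T = (\<lambda>(k, l)\<in>{..<n} \<times> {..<n}. \<Oplus>\<^bsub>R\<^esub>t\<in>T. F t (k, l))"

lemma mat_sum_entry [simp]: "k < n \<Longrightarrow> l < n \<Longrightarrow> mat_sum n R F T (k, l) = (\<Oplus>\<^bsub>R\<^esub>t\<in>T. F t (k, l))"
  by (simp add: mat_sum_def)

context cring begin

lemma mat_sum_closed:
  assumes "\<And>t. t \<in> T \<Longrightarrow> F t \<in> carrier (mat_monoid n R)"
  shows "mat_sum n R F T \<in> carrier (mat_monoid n R)"
proof (rule mat_closedI)
  fix i j assume "i < n" "j < n"
  then show "mat_sum n R F T (i, j) \<in> carrier R"
    using mat_entry[OF assms] by (simp only: mat_sum_entry) (intro finsum_closed, blast)
qed (simp add: mat_sum_def)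

lemma mult_mat_sum_entry:
  assumes "finite T" and M: "M \<in> carrier (mat_monoid n R)"
    and F: "\<And>t. t \<in> T \<Longrightarrow> F t \<in> carrier (mat_monoid n R)" and kl: "k < n" "l < n"
  shows "(M \<otimes>\<^bsub>mat_monoid n R\<^esub> mat_sum n R F T) (k, l) = (\<Oplus>t\<in>T. (M \<otimes>\<^bsub>mat_monoid n R\<^esub> F t) (k, l))"
  using assms(1) F
proof (induction T)
  case empty
  have "(\<Oplus>z\<in>{..<n}. M (k, z) \<otimes> mat_sum n R F {} (z, l)) = (\<Oplus>z\<in>{..<n}. \<zero>)"
    using M kl by (intro finsum_cong') auto
  then show ?case using kl by (simp add: mat_mult_entry)
next
  case (insert x T)
  have F: "F x \<in> carrier (mat_monoid n R)" "\<And>t. t \<in> T \<Longrightarrow> F t \<in> carrier (mat_monoid n R)"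
    using insert.prems by blast+
  have S: "mat_sum n R F T \<in> carrier (mat_monoid n R)" by (rule mat_sum_closed[OF F(2)])
  have FC: "(M \<otimes>\<^bsub>mat_monoid n R\<^esub> F t) (k, l) \<in> carrier R" if "t = x \<or> t \<in> T" for t
    using that by (intro mat_entry[of _ n] mat_mult_closed M kl) (use F in blast)
  have "mat_sum n R F (insert x T) (z, l) = F x (z, l) \<oplus> mat_sum n R F T (z, l)" if "z < n" for z
    unfolding mat_sum_entry[OF that kl(2)]
    using insert.hyps mat_entry[OF F(1) that kl(2)] mat_entry[OF F(2) that kl(2)]
    by (intro finsum_insert) auto
  then have "(\<Oplus>z\<in>{..<n}. M (k, z) \<otimes> mat_sum n R F (insert x T) (z, l))
     = (\<Oplus>z\<in>{..<n}. M (k, z) \<otimes> F x (z, l) \<oplus> M (k, z) \<otimes> mat_sum n R F T (z, l))"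
    using mat_entry[OF M kl(1)] mat_entry[OF F(1) _ kl(2)] mat_entry[OF S _ kl(2)]
    by (intro finsum_cong') (auto simp: r_distr simp del: mat_sum_entry)
  also have "\<dots> = (\<Oplus>z\<in>{..<n}. M (k, z) \<otimes> F x (z, l)) \<oplus> (\<Oplus>z\<in>{..<n}. M (k, z) \<otimes> mat_sum n R F T (z, l))"
    using mat_entry[OF M kl(1)] mat_entry[OF F(1) _ kl(2)] mat_entry[OF S _ kl(2)]
    by (intro finsum_addf) (auto simp del: mat_sum_entry)
  finally have "(M \<otimes>\<^bsub>mat_monoid n R\<^esub> mat_sum n R F (insert x T)) (k, l)
     = (M \<otimes>\<^bsub>mat_monoid n R\<^esub> F x) (k, l) \<oplus> (M \<otimes>\<^bsub>mat_monoid n R\<^esub> mat_sum n R F T) (k, l)"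
    unfolding mat_mult_entry[OF kl] .
  also have "\<dots> = (M \<otimes>\<^bsub>mat_monoid n R\<^esub> F x) (k, l) \<oplus> (\<Oplus>t\<in>T. (M \<otimes>\<^bsub>mat_monoid n R\<^esub> F t) (k, l))"
    by (simp only: insert.IH[OF F(2)])
  also have "\<dots> = (\<Oplus>t\<in>insert x T. (M \<otimes>\<^bsub>mat_monoid n R\<^esub> F t) (k, l))"
    using insert.hyps FC by (intro finsum_insert[symmetric]) auto
  finally show ?case .
qed

end

locale coeff_pair = big_torus K n + R: p_residue R K \<pi>R p m + A: complete_residue A K \<pi>A
  for K :: "('k, 'd) ring_scheme" and n :: nat and R :: "('r, 'x) ring_scheme" and \<pi>R p m
    and A :: "('a, 'y) ring_scheme" and \<pi>A
begin

definition DR :: "(nat \<Rightarrow> 'k) \<Rightarrow> 'r matr" where "DR t = dmat n R (\<lambda>i. R.tau (t i))"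
definition DA :: "(nat \<Rightarrow> 'k) \<Rightarrow> 'a matr" where "DA t = dmat n A (\<lambda>i. A.tau (t i))"

lemma DR_closed: "t \<in> T \<Longrightarrow> DR t \<in> carrier (mat_monoid n R)"
  unfolding DR_def by (rule R.A.dmat_closed) (rule R.tau_closed[OF T_entry(1)])

lemma DA_closed: "t \<in> T \<Longrightarrow> DA t \<in> carrier (mat_monoid n A)"
  unfolding DA_def by (rule A.A.dmat_closed) (rule A.tau_closed[OF T_entry(1)])

lemma DR_SL: assumes t: "t \<in> T" shows "DR t \<in> carrier (SL n R)"
proof -
  have "mat_det n R (DR t) = (\<Otimes>\<^bsub>R\<^esub>i\<in>{..<n}. R.tau (t i))"
    unfolding DR_def by (rule R.A.mat_det_dmat) (rule R.tau_closed[OF T_entry(1)[OF t]])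
  also have "\<dots> = R.tau (\<Otimes>\<^bsub>K\<^esub>i\<in>{..<n}. t i)" using T_entry(1)[OF t] by (intro R.tau_finprod) auto
  also have "\<dots> = \<one>\<^bsub>R\<^esub>" using t R.tau_one by (simp add: T_def)
  finally show ?thesis using DR_closed[OF t] by (simp add: R.A.SL_carrier)
qed

lemma DR_mult:
  assumes s: "s \<in> T" and t: "t \<in> T"
  shows "DR s \<otimes>\<^bsub>mat_monoid n R\<^esub> DR t = DR (tmul s t)"
proof (rule mat_eqI[OF R.A.mat_mult_closed[OF DR_closed[OF s] DR_closed[OF t]] DR_closed[OF tmul_T[OF s t]]])
  fix i j assume ij: "i < n" "j < n"
  have cl: "R.tau (s i) \<in> carrier R" "R.tau (t i) \<in> carrier R" if "i < n" for i
    using R.tau_closed T_entry(1)[OF s that] T_entry(1)[OF t that] by blast+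
  have "(DR s \<otimes>\<^bsub>mat_monoid n R\<^esub> DR t) (i, j) = R.tau (s i) \<otimes>\<^bsub>R\<^esub> DR t (i, j)"
    unfolding DR_def[of s] by (rule R.A.dmat_mult_entry[OF DR_closed[OF t] cl(1) ij])
  also have "\<dots> = DR (tmul s t) (i, j)"
    using ij cl R.tau_mult[OF T_entry(1)[OF s ij(2)] T_entry(1)[OF t ij(2)]] by (simp add: DR_def)
  finally show "(DR s \<otimes>\<^bsub>mat_monoid n R\<^esub> DR t) (i, j) = DR (tmul s t) (i, j)" .
qed

end

locale lift_setup = coeff_pair K n R \<pi>R p m A \<pi>A
  for K :: "('k, 'd) ring_scheme" and n :: nat and R :: "('r, 'x) ring_scheme" and \<pi>R p m
    and A :: "('a, 'y) ring_scheme" and \<pi>A +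
  fixes \<rho> :: "'r matr \<Rightarrow> 'a matr"
  assumes rho_closed: "\<And>g. g \<in> carrier (SL n R) \<Longrightarrow> \<rho> g \<in> carrier (mat_monoid n A)"
    and rho_mult: "\<And>g h. g \<in> carrier (SL n R) \<Longrightarrow> h \<in> carrier (SL n R) \<Longrightarrow>
      \<rho> (g \<otimes>\<^bsub>mat_monoid n R\<^esub> h) = \<rho> g \<otimes>\<^bsub>mat_monoid n A\<^esub> \<rho> h"
    and rho_lift: "\<And>g k l. g \<in> carrier (SL n R) \<Longrightarrow> k < n \<Longrightarrow> l < n \<Longrightarrow> \<pi>A (\<rho> g (k, l)) = \<pi>R (g (k, l))"
begin

text \<open>The conjugating matrix is the average over the torus of \<open>\<rho> (DR t)\<close> times the inverse of
\<open>DA t\<close>.  Translation invariance of the average gives the intertwining property, and each summand reduces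
to the identity.\<close>

lemma diagonalize:
  "\<exists>P\<in>Units (mat_monoid n A). mat_map n \<pi>A P = \<one>\<^bsub>mat_monoid n K\<^esub> \<and>
     (\<forall>t\<in>T. \<rho> (DR t) \<otimes>\<^bsub>mat_monoid n A\<^esub> P = P \<otimes>\<^bsub>mat_monoid n A\<^esub> DA t)"
proof -
  interpret MM: monoid "mat_monoid n A" by (rule A.A.mat_monoid)
  let ?I = "\<lambda>t. dmat n A (\<lambda>i. A.tau (inv\<^bsub>K\<^esub> (t i)))"
  let ?F = "\<lambda>t. \<rho> (DR t) \<otimes>\<^bsub>mat_monoid n A\<^esub> ?I t"
  note Ti = T_entry
  have ti: "A.tau (inv\<^bsub>K\<^esub> (t i)) \<in> carrier A" if "t \<in> T" "i < n" for t i
    by (rule A.tau_closed[OF K_inv(1)[OF Ti(1)[OF that] Ti(2)[OF that]]])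
  have I: "?I t \<in> carrier (mat_monoid n A)" if "t \<in> T" for t
    by (rule A.A.dmat_closed[OF ti[OF that]])
  have r: "\<rho> (DR t) \<in> carrier (mat_monoid n A)" if "t \<in> T" for t by (rule rho_closed[OF DR_SL[OF that]])
  have F: "?F t \<in> carrier (mat_monoid n A)" if "t \<in> T" for t by (rule A.A.mat_mult_closed[OF r[OF that] I[OF that]])
  have Fe: "?F t (k, l) = \<rho> (DR t) (k, l) \<otimes>\<^bsub>A\<^esub> A.tau (inv\<^bsub>K\<^esub> (t l))" if "t \<in> T" "k < n" "l < n" for t k l
    by (rule A.A.mult_dmat_entry[OF r[OF that(1)] ti[OF that(1)] that(2,3)])
  have shift: "(\<rho> (DR s) \<otimes>\<^bsub>mat_monoid n A\<^esub> ?F t) (k, l) = ?F (tmul s t) (k, l) \<otimes>\<^bsub>A\<^esub> A.tau (s l)"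
    if s: "s \<in> T" and t: "t \<in> T" and kl: "k < n" "l < n" for s t k l
  proof -
    have st: "tmul s t \<in> T" by (rule tmul_T[OF s t])
    have "\<rho> (DR s) \<otimes>\<^bsub>mat_monoid n A\<^esub> ?F t = \<rho> (DR (tmul s t)) \<otimes>\<^bsub>mat_monoid n A\<^esub> ?I t"
      unfolding DR_mult[OF s t, symmetric] rho_mult[OF DR_SL[OF s] DR_SL[OF t]]
      by (rule MM.m_assoc[symmetric, OF r[OF s] r[OF t] I[OF t]])
    then have 1: "(\<rho> (DR s) \<otimes>\<^bsub>mat_monoid n A\<^esub> ?F t) (k, l) = \<rho> (DR (tmul s t)) (k, l) \<otimes>\<^bsub>A\<^esub> A.tau (inv\<^bsub>K\<^esub> (t l))"
      using A.A.mult_dmat_entry[OF r[OF st] ti[OF t] kl] by simp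
    note sl = Ti(1)[OF s kl(2)] Ti(2)[OF s kl(2)] and tl = Ti(1)[OF t kl(2)] Ti(2)[OF t kl(2)]
    have stl: "s l \<otimes>\<^bsub>K\<^esub> t l \<in> carrier K" "s l \<otimes>\<^bsub>K\<^esub> t l \<noteq> \<zero>\<^bsub>K\<^esub>"
      using Ti(1)[OF st kl(2)] Ti(2)[OF st kl(2)] kl(2) by simp_all
    note inv = K_inv[OF stl]
    have "t l \<otimes>\<^bsub>K\<^esub> (inv\<^bsub>K\<^esub> (s l \<otimes>\<^bsub>K\<^esub> t l) \<otimes>\<^bsub>K\<^esub> s l) = (s l \<otimes>\<^bsub>K\<^esub> t l) \<otimes>\<^bsub>K\<^esub> inv\<^bsub>K\<^esub> (s l \<otimes>\<^bsub>K\<^esub> t l)"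
      using sl tl inv(1) by (simp add: K.m_ac)
    then have "inv\<^bsub>K\<^esub> (t l) = inv\<^bsub>K\<^esub> (s l \<otimes>\<^bsub>K\<^esub> t l) \<otimes>\<^bsub>K\<^esub> s l"
      using K.comm_inv_char[of "t l" "inv\<^bsub>K\<^esub> (s l \<otimes>\<^bsub>K\<^esub> t l) \<otimes>\<^bsub>K\<^esub> s l"] sl tl inv by simp
    then have 2: "A.tau (inv\<^bsub>K\<^esub> (t l)) = A.tau (inv\<^bsub>K\<^esub> (s l \<otimes>\<^bsub>K\<^esub> t l)) \<otimes>\<^bsub>A\<^esub> A.tau (s l)"
      using A.tau_mult[OF inv(1) sl(1)] by simp
    have "?F (tmul s t) (k, l) \<otimes>\<^bsub>A\<^esub> A.tau (s l) = \<rho> (DR (tmul s t)) (k, l) \<otimes>\<^bsub>A\<^esub> (A.tau (inv\<^bsub>K\<^esub> (tmul s t l)) \<otimes>\<^bsub>A\<^esub> A.tau (s l))"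
      unfolding Fe[OF st kl] by (rule A.A.m_assoc[OF mat_entry[OF r[OF st] kl] ti[OF st kl(2)] A.tau_closed[OF sl(1)]])
    then show ?thesis unfolding 1 2 tmul_entry[OF kl(2)] by (rule sym)
  qed
  define P0 where "P0 = mat_sum n A ?F T"
  have P0: "P0 \<in> carrier (mat_monoid n A)" unfolding P0_def by (rule A.A.mat_sum_closed[OF F])
  have inter: "\<rho> (DR s) \<otimes>\<^bsub>mat_monoid n A\<^esub> P0 = P0 \<otimes>\<^bsub>mat_monoid n A\<^esub> DA s" if s: "s \<in> T" for s
  proof (rule mat_eqI[OF A.A.mat_mult_closed[OF r[OF s] P0] A.A.mat_mult_closed[OF P0 DA_closed[OF s]]])
    fix k l assume kl: "k < n" "l < n"
    have sl: "A.tau (s l) \<in> carrier A" if "l < n" for l by (rule A.tau_closed[OF Ti(1)[OF s that]])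
    have Fc: "?F t (k, l) \<in> carrier A" if "t \<in> T" for t by (rule mat_entry[OF F[OF that] kl])
    have "(\<rho> (DR s) \<otimes>\<^bsub>mat_monoid n A\<^esub> P0) (k, l) = (\<Oplus>\<^bsub>A\<^esub>t\<in>T. (\<rho> (DR s) \<otimes>\<^bsub>mat_monoid n A\<^esub> ?F t) (k, l))"
      unfolding P0_def by (rule A.A.mult_mat_sum_entry[OF finite_T r[OF s] F kl])
    also have "\<dots> = (\<Oplus>\<^bsub>A\<^esub>t\<in>T. ?F (tmul s t) (k, l) \<otimes>\<^bsub>A\<^esub> A.tau (s l))"
      by (rule A.A.finsum_cong') (use shift[OF s _ kl] Fc[OF tmul_T[OF s]] sl[OF kl(2)] in auto)
    also have "\<dots> = (\<Oplus>\<^bsub>A\<^esub>t\<in>T. ?F (tmul s t) (k, l)) \<otimes>\<^bsub>A\<^esub> A.tau (s l)"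
      by (rule A.A.finsum_ldistr[symmetric, OF finite_T sl[OF kl(2)]]) (use Fc[OF tmul_T[OF s]] in auto)
    also have "(\<Oplus>\<^bsub>A\<^esub>t\<in>T. ?F (tmul s t) (k, l)) = (\<Oplus>\<^bsub>A\<^esub>t\<in>tmul s ` T. ?F t (k, l))"
      by (rule A.A.add.finprod_reindex[symmetric])
        (use Fc tmul_bij[OF s] in \<open>auto simp: bij_betw_def\<close>)
    also have "tmul s ` T = T" using tmul_bij[OF s] by (simp add: bij_betw_def)
    also have "(\<Oplus>\<^bsub>A\<^esub>t\<in>T. ?F t (k, l)) = P0 (k, l)" unfolding P0_def mat_sum_entry[OF kl] ..
    also have "P0 (k, l) \<otimes>\<^bsub>A\<^esub> A.tau (s l) = (P0 \<otimes>\<^bsub>mat_monoid n A\<^esub> DA s) (k, l)"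
      unfolding DA_def by (rule A.A.mult_dmat_entry[symmetric, OF P0 sl kl])
    finally show "(\<rho> (DR s) \<otimes>\<^bsub>mat_monoid n A\<^esub> P0) (k, l) = (P0 \<otimes>\<^bsub>mat_monoid n A\<^esub> DA s) (k, l)" .
  qed
  define u where "u = add_pow A (card T) \<one>\<^bsub>A\<^esub>"
  have u: "u \<in> carrier A" by (simp add: u_def)
  have pu: "\<pi>A u = add_pow K (card T) \<one>\<^bsub>K\<^esub>"
    unfolding u_def ring_hom_add_pow[OF A.A.is_cring K.is_cring A.hom A.A.one_closed] ring_hom_one[OF A.hom] ..
  have "\<pi>A u \<noteq> \<zero>\<^bsub>K\<^esub>" unfolding pu using card_T_nonzero n2 by simp
  then have uU: "u \<in> Units A" using A.unit_iff[OF u] by blast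
  have v: "inv\<^bsub>A\<^esub> u \<in> carrier A" by (rule A.A.Units_inv_closed[OF uU])
  have pi0: "\<pi>A (P0 (k, l)) = (if k = l then \<pi>A u else \<zero>\<^bsub>K\<^esub>)" if kl: "k < n" "l < n" for k l
  proof -
    have pF: "\<pi>A (?F t (k, l)) = (if k = l then \<one>\<^bsub>K\<^esub> else \<zero>\<^bsub>K\<^esub>)" if t: "t \<in> T" for t
    proof -
      note tk = K_inv[OF Ti(1)[OF t kl(2)] Ti(2)[OF t kl(2)]]
      have "\<pi>A (?F t (k, l)) = \<pi>A (\<rho> (DR t) (k, l)) \<otimes>\<^bsub>K\<^esub> \<pi>A (A.tau (inv\<^bsub>K\<^esub> (t l)))"
        unfolding Fe[OF t kl] by (rule ring_hom_mult[OF A.hom mat_entry[OF r[OF t] kl] ti[OF t kl(2)]])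
      also have "\<dots> = \<pi>R (DR t (k, l)) \<otimes>\<^bsub>K\<^esub> inv\<^bsub>K\<^esub> (t l)"
        unfolding rho_lift[OF DR_SL[OF t] kl] A.pi_tau[OF tk(1)] ..
      also have "\<dots> = (if k = l then \<one>\<^bsub>K\<^esub> else \<zero>\<^bsub>K\<^esub>)"
        using kl tk R.pi_tau[OF Ti(1)[OF t kl(2)]] ring_hom_zero'[OF R.A.is_cring K.is_cring R.hom] by (simp add: DR_def)
      finally show ?thesis .
    qed
    have "\<pi>A (P0 (k, l)) = (\<Oplus>\<^bsub>K\<^esub>t\<in>T. \<pi>A (?F t (k, l)))"
      unfolding P0_def mat_sum_entry[OF kl]
      by (rule ring_hom_finsum[OF A.A.is_cring K.is_cring A.hom]) (rule mat_entry[OF F kl])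
    also have "\<dots> = (\<Oplus>\<^bsub>K\<^esub>t\<in>T. if k = l then \<one>\<^bsub>K\<^esub> else \<zero>\<^bsub>K\<^esub>)"
      by (rule K.finsum_cong') (simp_all add: pF)
    also have "\<dots> = (if k = l then \<pi>A u else \<zero>\<^bsub>K\<^esub>)"
      unfolding pu using K.add.finprod_const[of "\<one>\<^bsub>K\<^esub>" T] by simp
    finally show ?thesis .
  qed
  let ?S = "dmat n A (\<lambda>_. inv\<^bsub>A\<^esub> u)"
  have S: "?S \<in> carrier (mat_monoid n A)" by (rule A.A.dmat_closed[OF v])
  let ?P = "P0 \<otimes>\<^bsub>mat_monoid n A\<^esub> ?S"
  have P: "?P \<in> carrier (mat_monoid n A)" by (rule A.A.mat_mult_closed[OF P0 S])
  have mapP: "mat_map n \<pi>A ?P = \<one>\<^bsub>mat_monoid n K\<^esub>"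
  proof (rule mat_eqI[of _ n K])
    show "mat_map n \<pi>A ?P \<in> carrier (mat_monoid n K)"
      by (rule A.A.mat_map_closed[OF ring_hom_closed[OF A.hom] P])
    fix k l assume kl: "k < n" "l < n"
    have "\<pi>A (?P (k, l)) = \<pi>A (P0 (k, l)) \<otimes>\<^bsub>K\<^esub> \<pi>A (inv\<^bsub>A\<^esub> u)"
      unfolding A.A.mult_dmat_entry[OF P0 v kl] by (rule ring_hom_mult[OF A.hom mat_entry[OF P0 kl] v])
    also have "\<dots> = (if k = l then \<one>\<^bsub>K\<^esub> else \<zero>\<^bsub>K\<^esub>)"
      using ring_hom_mult[OF A.hom u v] A.A.Units_r_inv[OF uU] ring_hom_one[OF A.hom] ring_hom_closed[OF A.hom v]
      by (simp add: pi0[OF kl])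
    finally show "mat_map n \<pi>A ?P (k, l) = \<one>\<^bsub>mat_monoid n K\<^esub> (k, l)" using kl by simp
  qed (rule K.mat_one_closed)
  have "\<pi>A (mat_det n A ?P) = \<one>\<^bsub>K\<^esub>"
    using mat_det_map[OF A.A.is_cring K.is_cring A.hom P] K.mat_det_one unfolding mapP by simp
  then have "mat_det n A ?P \<in> Units A" using A.unit_iff[OF A.A.mat_det_closed[OF P]] K.one_not_zero by metis
  then have PU: "?P \<in> Units (mat_monoid n A)" by (rule A.A.mat_unitI[OF P])
  have "\<rho> (DR t) \<otimes>\<^bsub>mat_monoid n A\<^esub> ?P = ?P \<otimes>\<^bsub>mat_monoid n A\<^esub> DA t" if t: "t \<in> T" for t
  proof -
    have dt: "A.tau (t i) \<in> carrier A" if "i < n" for i by (rule A.tau_closed[OF Ti(1)[OF t that]])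
    have comm: "DA t \<otimes>\<^bsub>mat_monoid n A\<^esub> ?S = ?S \<otimes>\<^bsub>mat_monoid n A\<^esub> DA t"
    proof (rule mat_eqI[OF A.A.mat_mult_closed[OF DA_closed[OF t] S] A.A.mat_mult_closed[OF S DA_closed[OF t]]])
      fix k l assume kl: "k < n" "l < n"
      show "(DA t \<otimes>\<^bsub>mat_monoid n A\<^esub> ?S) (k, l) = (?S \<otimes>\<^bsub>mat_monoid n A\<^esub> DA t) (k, l)"
        unfolding A.A.mult_dmat_entry[OF DA_closed[OF t] v kl] A.A.dmat_mult_entry[OF DA_closed[OF t] v kl]
        by (rule A.A.m_comm[OF mat_entry[OF DA_closed[OF t] kl] v])
    qed
    have "\<rho> (DR t) \<otimes>\<^bsub>mat_monoid n A\<^esub> ?P = (\<rho> (DR t) \<otimes>\<^bsub>mat_monoid n A\<^esub> P0) \<otimes>\<^bsub>mat_monoid n A\<^esub> ?S"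
      by (rule MM.m_assoc[symmetric, OF r[OF t] P0 S])
    also have "\<dots> = P0 \<otimes>\<^bsub>mat_monoid n A\<^esub> (DA t \<otimes>\<^bsub>mat_monoid n A\<^esub> ?S)"
      unfolding inter[OF t] by (rule MM.m_assoc[OF P0 DA_closed[OF t] S])
    also have "\<dots> = ?P \<otimes>\<^bsub>mat_monoid n A\<^esub> DA t"
      unfolding comm by (rule MM.m_assoc[symmetric, OF P0 S DA_closed[OF t]])
    finally show ?thesis .
  qed
  with PU mapP show ?thesis by blast
qed

end

section \<open>Elementary matrices under a lift that is diagonal on the torus\<close>

context cring begin

lemma finsum_two:
  fixes a b n :: nat
  assumes "a < n" "b < n" "a \<noteq> b" "\<And>z. z < n \<Longrightarrow> f z \<in> carrier R"
    and "\<And>z. z < n \<Longrightarrow> z \<noteq> a \<Longrightarrow> z \<noteq> b \<Longrightarrow> f z = \<zero>"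
  shows "(\<Oplus>z\<in>{..<n}. f z) = f a \<oplus> f b"
proof -
  have "(\<Oplus>z\<in>{..<n}. f z) = (\<Oplus>z\<in>{..<n}. (if z = a then f z else \<zero>) \<oplus> (if z = b then f z else \<zero>))"
    using assms by (intro finsum_cong') auto
  also have "\<dots> = (\<Oplus>z\<in>{..<n}. if z = a then f z else \<zero>) \<oplus> (\<Oplus>z\<in>{..<n}. if z = b then f z else \<zero>)"
    using assms by (intro finsum_addf) auto
  also have "\<dots> = f a \<oplus> f b" by (simp only: finsum_delta[OF assms(1,4)] finsum_delta[OF assms(2,4)])
  finally show ?thesis .
qed

lemma finsum_one:
  fixes a n :: nat
  assumes "a < n" "\<And>z. z < n \<Longrightarrow> f z \<in> carrier R" "\<And>z. z < n \<Longrightarrow> z \<noteq> a \<Longrightarrow> f z = \<zero>"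
  shows "(\<Oplus>z\<in>{..<n}. f z) = f a"
proof -
  have "(\<Oplus>z\<in>{..<n}. f z) = (\<Oplus>z\<in>{..<n}. if z = a then f z else \<zero>)"
    using assms by (intro finsum_cong') auto
  then show ?thesis by (simp only: finsum_delta[OF assms(1,2)])
qed

end

locale normalized_lift = lift_setup K n R \<pi>R p m A \<pi>A \<rho>
  for K :: "('k, 'd) ring_scheme" and n :: nat and R :: "('r, 'x) ring_scheme" and \<pi>R p m
    and A :: "('a, 'y) ring_scheme" and \<pi>A \<rho> +
  assumes rho_torus: "\<And>t. t \<in> T \<Longrightarrow> \<rho> (DR t) = DA t"
begin

lemma rho_one: "\<rho> \<one>\<^bsub>mat_monoid n R\<^esub> = \<one>\<^bsub>mat_monoid n A\<^esub>"
proof -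
  let ?t = "restrict (\<lambda>_. \<one>\<^bsub>K\<^esub>) {..<n}"
  have t: "?t \<in> T" by (rule TI) simp_all
  have "DR ?t = \<one>\<^bsub>mat_monoid n R\<^esub>"
    by (rule mat_eqI[OF DR_closed[OF t] R.A.mat_one_closed]) (simp add: DR_def R.tau_one)
  moreover have "DA ?t = \<one>\<^bsub>mat_monoid n A\<^esub>"
    by (rule mat_eqI[OF DA_closed[OF t] A.A.mat_one_closed]) (simp add: DA_def A.tau_one)
  ultimately show ?thesis using rho_torus[OF t] by simp
qed

text \<open>The conjugation action of the torus on the entries of images: a relation in the source is read
off entry by entry, since the torus acts diagonally on both sides.\<close>

lemma equivariance:
  assumes g: "g \<in> carrier (SL n R)" and h: "h \<in> carrier (SL n R)" and s: "s \<in> T" and t: "t \<in> T"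
    and eq: "DR s \<otimes>\<^bsub>mat_monoid n R\<^esub> g = h \<otimes>\<^bsub>mat_monoid n R\<^esub> DR t" and kl: "k < n" "l < n"
  shows "A.tau (s k) \<otimes>\<^bsub>A\<^esub> \<rho> g (k, l) = \<rho> h (k, l) \<otimes>\<^bsub>A\<^esub> A.tau (t l)"
proof -
  have "DA s \<otimes>\<^bsub>mat_monoid n A\<^esub> \<rho> g = \<rho> h \<otimes>\<^bsub>mat_monoid n A\<^esub> DA t"
    using arg_cong[OF eq, of \<rho>]
    unfolding rho_mult[OF DR_SL[OF s] g] rho_mult[OF h DR_SL[OF t]] rho_torus[OF s] rho_torus[OF t] .
  then have "(DA s \<otimes>\<^bsub>mat_monoid n A\<^esub> \<rho> g) (k, l) = (\<rho> h \<otimes>\<^bsub>mat_monoid n A\<^esub> DA t) (k, l)" by simp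
  moreover have "(DA s \<otimes>\<^bsub>mat_monoid n A\<^esub> \<rho> g) (k, l) = A.tau (s k) \<otimes>\<^bsub>A\<^esub> \<rho> g (k, l)"
    unfolding DA_def by (rule A.A.dmat_mult_entry[OF rho_closed[OF g] A.tau_closed[OF T_entry(1)[OF s]] kl])
  moreover have "(\<rho> h \<otimes>\<^bsub>mat_monoid n A\<^esub> DA t) (k, l) = \<rho> h (k, l) \<otimes>\<^bsub>A\<^esub> A.tau (t l)"
    unfolding DA_def by (rule A.A.mult_dmat_entry[OF rho_closed[OF h] A.tau_closed[OF T_entry(1)[OF t]] kl])
  ultimately show ?thesis by simp
qed

lemma DR_mult_entry:
  assumes "t \<in> T" "M \<in> carrier (mat_monoid n R)" "k < n" "l < n"
  shows "(DR t \<otimes>\<^bsub>mat_monoid n R\<^esub> M) (k, l) = R.tau (t k) \<otimes>\<^bsub>R\<^esub> M (k, l)"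
    and "(M \<otimes>\<^bsub>mat_monoid n R\<^esub> DR t) (k, l) = M (k, l) \<otimes>\<^bsub>R\<^esub> R.tau (t l)"
proof -
  have c: "R.tau (t i) \<in> carrier R" if "i < n" for i by (rule R.tau_closed[OF T_entry(1)[OF assms(1) that]])
  show "(DR t \<otimes>\<^bsub>mat_monoid n R\<^esub> M) (k, l) = R.tau (t k) \<otimes>\<^bsub>R\<^esub> M (k, l)"
    unfolding DR_def by (rule R.A.dmat_mult_entry[OF assms(2) c assms(3,4)])
  show "(M \<otimes>\<^bsub>mat_monoid n R\<^esub> DR t) (k, l) = M (k, l) \<otimes>\<^bsub>R\<^esub> R.tau (t l)"
    unfolding DR_def by (rule R.A.mult_dmat_entry[OF assms(2) c assms(3,4)])
qed

abbreviation ER :: "nat \<Rightarrow> nat \<Rightarrow> 'r \<Rightarrow> 'r matr" where "ER \<equiv> emat n R"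
abbreviation EA :: "nat \<Rightarrow> nat \<Rightarrow> 'a \<Rightarrow> 'a matr" where "EA \<equiv> emat n A"

lemma E_equivariance:
  assumes ij: "i < n" "j < n" "i \<noteq> j" and r: "r \<in> carrier R" and c: "c \<in> carrier K"
    and t: "t \<in> T" "t i = c \<otimes>\<^bsub>K\<^esub> t j" and kl: "k < n" "l < n"
  shows "A.tau (t k) \<otimes>\<^bsub>A\<^esub> \<rho> (ER i j r) (k, l) = \<rho> (ER i j (R.tau c \<otimes>\<^bsub>R\<^esub> r)) (k, l) \<otimes>\<^bsub>A\<^esub> A.tau (t l)"
proof (rule equivariance[OF _ _ t(1) t(1) _ kl])
  have cr: "R.tau c \<otimes>\<^bsub>R\<^esub> r \<in> carrier R" by (rule R.A.m_closed[OF R.tau_closed[OF c] r])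
  show E: "ER i j r \<in> carrier (SL n R)" "ER i j (R.tau c \<otimes>\<^bsub>R\<^esub> r) \<in> carrier (SL n R)"
    by (rule R.A.emat_SL[OF r ij], rule R.A.emat_SL[OF cr ij])
  note EC = R.A.emat_closed[OF r, of n i j] R.A.emat_closed[OF cr, of n i j]
  show "DR t \<otimes>\<^bsub>mat_monoid n R\<^esub> ER i j r = ER i j (R.tau c \<otimes>\<^bsub>R\<^esub> r) \<otimes>\<^bsub>mat_monoid n R\<^esub> DR t"
  proof (rule mat_eqI[OF R.A.mat_mult_closed[OF DR_closed[OF t(1)] EC(1)] R.A.mat_mult_closed[OF EC(2) DR_closed[OF t(1)]]])
    fix a b assume ab: "a < n" "b < n"
    have ta: "R.tau (t a) \<in> carrier R" if "a < n" for a by (rule R.tau_closed[OF T_entry(1)[OF t(1) that]])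
    have ti: "R.tau (t i) = R.tau c \<otimes>\<^bsub>R\<^esub> R.tau (t j)"
      unfolding t(2) by (rule R.tau_mult[OF c T_entry(1)[OF t(1) ij(2)]])
    have "R.tau (t a) \<otimes>\<^bsub>R\<^esub> ER i j r (a, b) = ER i j (R.tau c \<otimes>\<^bsub>R\<^esub> r) (a, b) \<otimes>\<^bsub>R\<^esub> R.tau (t b)"
      using ab ta[OF ab(1)] ta[OF ab(2)] ta[OF ij(2)] ti ij r R.tau_closed[OF c]
      by (auto simp: R.A.m_ac)
    then show "(DR t \<otimes>\<^bsub>mat_monoid n R\<^esub> ER i j r) (a, b) = (ER i j (R.tau c \<otimes>\<^bsub>R\<^esub> r) \<otimes>\<^bsub>mat_monoid n R\<^esub> DR t) (a, b)"
      unfolding DR_mult_entry(1)[OF t(1) EC(1) ab] DR_mult_entry(2)[OF t(1) EC(2) ab] .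
  qed
qed

lemma tauA_unit: "t \<in> T \<Longrightarrow> k < n \<Longrightarrow> A.tau (t k) \<in> Units A"
  by (rule A.tau_unit[OF T_entry])

lemma tauA_closed: "t \<in> T \<Longrightarrow> k < n \<Longrightarrow> A.tau (t k) \<in> carrier A"
  by (rule A.tau_closed[OF T_entry(1)])

context
  fixes i j :: nat
  assumes ij: "i < n" "j < n" "i \<noteq> j"
begin

abbreviation E :: "'r \<Rightarrow> 'a matr" where "E r \<equiv> \<rho> (ER i j r)"

lemma ER_SL: "r \<in> carrier R \<Longrightarrow> ER i j r \<in> carrier (SL n R)"
  by (rule R.A.emat_SL[OF _ ij])

lemma E_closed: "r \<in> carrier R \<Longrightarrow> E r \<in> carrier (mat_monoid n A)"
  by (rule rho_closed[OF ER_SL])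

lemma E_entry: "r \<in> carrier R \<Longrightarrow> k < n \<Longrightarrow> l < n \<Longrightarrow> E r (k, l) \<in> carrier A"
  by (rule mat_entry[OF E_closed])

lemma E_add:
  assumes "r \<in> carrier R" "s \<in> carrier R"
  shows "E (r \<oplus>\<^bsub>R\<^esub> s) = E r \<otimes>\<^bsub>mat_monoid n A\<^esub> E s"
  unfolding R.A.emat_add[OF assms ij, symmetric] by (rule rho_mult[OF ER_SL ER_SL]; fact)

text \<open>A torus element that centralizes the elementary matrix but separates \<open>k\<close> from \<open>l\<close> acts on
this entry by a nontrivial scalar.\<close>

lemma E_offdiag:
  assumes r: "r \<in> carrier R" and kl: "k < n" "l < n" "k \<noteq> l" and ne: "\<not> (k \<in> {i, j} \<and> l \<in> {i, j})"
  shows "E r (k, l) = \<zero>\<^bsub>A\<^esub>"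
proof -
  obtain t where t: "t \<in> T" "t i = t j" "t k \<noteq> t l" using separate[OF ij(1,2) kl(1,2) ij(3) kl(3) ne] by blast
  have "t i = \<one>\<^bsub>K\<^esub> \<otimes>\<^bsub>K\<^esub> t j" using t T_entry(1)[OF t(1) ij(2)] by simp
  from E_equivariance[OF ij r K.one_closed t(1) this kl(1,2)]
  have "A.tau (t k) \<otimes>\<^bsub>A\<^esub> E r (k, l) = E r (k, l) \<otimes>\<^bsub>A\<^esub> A.tau (t l)"
    unfolding R.tau_one using r by simp
  also have "\<dots> = A.tau (t l) \<otimes>\<^bsub>A\<^esub> E r (k, l)"
    by (rule A.A.m_comm[OF E_entry[OF r kl(1,2)] tauA_closed[OF t(1) kl(2)]])
  finally show ?thesis
    by (rule A.tau_cancel[OF T_entry(1)[OF t(1) kl(1)] T_entry(1)[OF t(1) kl(2)] t(3) E_entry[OF r kl(1,2)]])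
qed

lemma E_upper_scale:
  assumes r: "r \<in> carrier R" and c: "c \<in> carrier K" and t: "t \<in> T" "t i = c \<otimes>\<^bsub>K\<^esub> t j"
  shows "E (R.tau c \<otimes>\<^bsub>R\<^esub> r) (i, j) = A.tau c \<otimes>\<^bsub>A\<^esub> E r (i, j)"
proof -
  have cr: "R.tau c \<otimes>\<^bsub>R\<^esub> r \<in> carrier R" by (rule R.A.m_closed[OF R.tau_closed[OF c] r])
  note cl = A.tau_closed[OF c] tauA_closed[OF t(1) ij(2)] E_entry[OF r ij(1,2)] E_entry[OF cr ij(1,2)]
  have ti: "A.tau (t i) = A.tau c \<otimes>\<^bsub>A\<^esub> A.tau (t j)"
    unfolding t(2) by (rule A.tau_mult[OF c T_entry(1)[OF t(1) ij(2)]])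
  have "A.tau (t j) \<otimes>\<^bsub>A\<^esub> E (R.tau c \<otimes>\<^bsub>R\<^esub> r) (i, j) = A.tau (t j) \<otimes>\<^bsub>A\<^esub> (A.tau c \<otimes>\<^bsub>A\<^esub> E r (i, j))"
    using E_equivariance[OF ij r c t ij(1,2)] cl unfolding ti by (simp add: A.A.m_ac)
  then show ?thesis using A.A.Units_l_cancel[OF tauA_unit[OF t(1) ij(2)]] cl by simp
qed

lemma E_lower_scale:
  assumes r: "r \<in> carrier R" and c: "c \<in> carrier K" and t: "t \<in> T" "t i = c \<otimes>\<^bsub>K\<^esub> t j"
  shows "E r (j, i) = A.tau c \<otimes>\<^bsub>A\<^esub> E (R.tau c \<otimes>\<^bsub>R\<^esub> r) (j, i)"
proof -
  have cr: "R.tau c \<otimes>\<^bsub>R\<^esub> r \<in> carrier R" by (rule R.A.m_closed[OF R.tau_closed[OF c] r])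
  note cl = A.tau_closed[OF c] tauA_closed[OF t(1) ij(2)] E_entry[OF r ij(2,1)] E_entry[OF cr ij(2,1)]
  have ti: "A.tau (t i) = A.tau c \<otimes>\<^bsub>A\<^esub> A.tau (t j)"
    unfolding t(2) by (rule A.tau_mult[OF c T_entry(1)[OF t(1) ij(2)]])
  have "A.tau (t j) \<otimes>\<^bsub>A\<^esub> E r (j, i) = A.tau (t j) \<otimes>\<^bsub>A\<^esub> (A.tau c \<otimes>\<^bsub>A\<^esub> E (R.tau c \<otimes>\<^bsub>R\<^esub> r) (j, i))"
    using E_equivariance[OF ij r c t ij(2,1)] cl unfolding ti by (simp add: A.A.m_ac)
  then show ?thesis using A.A.Units_l_cancel[OF tauA_unit[OF t(1) ij(2)]] cl by simp
qed

lemma E_diag_scale: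
  assumes r: "r \<in> carrier R" and c: "c \<in> carrier K" and t: "t \<in> T" "t i = c \<otimes>\<^bsub>K\<^esub> t j" and k: "k < n"
  shows "E (R.tau c \<otimes>\<^bsub>R\<^esub> r) (k, k) = E r (k, k)"
proof -
  have cr: "R.tau c \<otimes>\<^bsub>R\<^esub> r \<in> carrier R" by (rule R.A.m_closed[OF R.tau_closed[OF c] r])
  note cl = tauA_closed[OF t(1) k] E_entry[OF r k k] E_entry[OF cr k k]
  have "A.tau (t k) \<otimes>\<^bsub>A\<^esub> E (R.tau c \<otimes>\<^bsub>R\<^esub> r) (k, k) = A.tau (t k) \<otimes>\<^bsub>A\<^esub> E r (k, k)"
    using E_equivariance[OF ij r c t k k] A.A.m_comm[OF cl(3,1)] by simp
  then show ?thesis using A.A.Units_l_cancel[OF tauA_unit[OF t(1) k]] cl by simp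
qed

text \<open>Entry \<open>(i, i)\<close> of the relation that the images of two elementary matrices at the same position commute.\<close>

lemma E_swap:
  assumes r: "r \<in> carrier R" and s: "s \<in> carrier R"
  shows "E r (i, j) \<otimes>\<^bsub>A\<^esub> E s (j, i) = E s (i, j) \<otimes>\<^bsub>A\<^esub> E r (j, i)"
proof -
  have prod: "(E r \<otimes>\<^bsub>mat_monoid n A\<^esub> E s) (i, i) = E r (i, i) \<otimes>\<^bsub>A\<^esub> E s (i, i) \<oplus>\<^bsub>A\<^esub> E r (i, j) \<otimes>\<^bsub>A\<^esub> E s (j, i)"
    if "r \<in> carrier R" "s \<in> carrier R" for r s
    unfolding mat_mult_entry[OF ij(1,1)]
  proof (rule A.A.finsum_two[OF ij])
    fix z assume z: "z < n"
    show "E r (i, z) \<otimes>\<^bsub>A\<^esub> E s (z, i) \<in> carrier A"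
      by (rule A.A.m_closed[OF E_entry[OF that(1) ij(1) z] E_entry[OF that(2) z ij(1)]])
    assume "z \<noteq> i" "z \<noteq> j"
    then have "E r (i, z) = \<zero>\<^bsub>A\<^esub>" by (intro E_offdiag that ij z) auto
    then show "E r (i, z) \<otimes>\<^bsub>A\<^esub> E s (z, i) = \<zero>\<^bsub>A\<^esub>" using E_entry[OF that(2) z ij(1)] by simp
  qed
  have "E r \<otimes>\<^bsub>mat_monoid n A\<^esub> E s = E s \<otimes>\<^bsub>mat_monoid n A\<^esub> E r"
    unfolding E_add[OF r s, symmetric] E_add[OF s r, symmetric] R.A.a_comm[OF r s] ..
  then have "E r (i, i) \<otimes>\<^bsub>A\<^esub> E s (i, i) \<oplus>\<^bsub>A\<^esub> E r (i, j) \<otimes>\<^bsub>A\<^esub> E s (j, i) =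
      E s (i, i) \<otimes>\<^bsub>A\<^esub> E r (i, i) \<oplus>\<^bsub>A\<^esub> E s (i, j) \<otimes>\<^bsub>A\<^esub> E r (j, i)"
    using prod[OF r s] prod[OF s r] by simp
  then show ?thesis
    using A.A.m_comm[OF E_entry[OF r ij(1,1)] E_entry[OF s ij(1,1)]]
      E_entry[OF r] E_entry[OF s] ij A.A.add.l_cancel by simp
qed

lemma E_one_unit: "E \<one>\<^bsub>R\<^esub> (i, j) \<in> Units A"
proof -
  have "\<pi>A (E \<one>\<^bsub>R\<^esub> (i, j)) = \<one>\<^bsub>K\<^esub>"
    unfolding rho_lift[OF ER_SL[OF R.A.one_closed] ij(1,2)] using ij ring_hom_one[OF R.hom] by simp
  then show ?thesis using A.unit_iff[OF E_entry[OF R.A.one_closed ij(1,2)]] K.one_not_zero by simp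
qed

text \<open>The upper entry is scaled by \<open>c\<close> and the lower one by its inverse.  As
\<open>E_swap\<close> makes the lower entry proportional to the upper one, it is multiplied by \<open>c \<otimes> c\<close> as well
as fixed, and so vanishes.\<close>

lemma E_lower:
  assumes r: "r \<in> carrier R"
  shows "E r (j, i) = \<zero>\<^bsub>A\<^esub>"
proof -
  obtain c t where c: "c \<in> carrier K" "c \<otimes>\<^bsub>K\<^esub> c \<noteq> \<one>\<^bsub>K\<^esub>" and t: "t \<in> T" "t i = c \<otimes>\<^bsub>K\<^esub> t j"
    using ratio_big[OF ij] by blast
  note one = R.A.one_closed
  have c1: "R.tau c \<otimes>\<^bsub>R\<^esub> \<one>\<^bsub>R\<^esub> \<in> carrier R" by (rule R.A.m_closed[OF R.tau_closed[OF c(1)] one])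
  let ?y = "E \<one>\<^bsub>R\<^esub> (i, j)" and ?z = "E \<one>\<^bsub>R\<^esub> (j, i)" and ?z' = "E (R.tau c \<otimes>\<^bsub>R\<^esub> \<one>\<^bsub>R\<^esub>) (j, i)"
  note cl = E_entry[OF one ij(1,2)] E_entry[OF one ij(2,1)] E_entry[OF c1 ij(2,1)] A.tau_closed[OF c(1)]
  have "A.tau c \<otimes>\<^bsub>A\<^esub> ?y \<otimes>\<^bsub>A\<^esub> ?z = ?y \<otimes>\<^bsub>A\<^esub> ?z'"
    using E_swap[OF c1 one] unfolding E_upper_scale[OF one c(1) t] .
  then have "?y \<otimes>\<^bsub>A\<^esub> (A.tau c \<otimes>\<^bsub>A\<^esub> ?z) = ?y \<otimes>\<^bsub>A\<^esub> ?z'" using cl by (simp add: A.A.m_ac)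
  then have z': "A.tau c \<otimes>\<^bsub>A\<^esub> ?z = ?z'" using A.A.Units_l_cancel[OF E_one_unit] cl by simp
  have "?z = A.tau c \<otimes>\<^bsub>A\<^esub> ?z'" by (rule E_lower_scale[OF one c(1) t])
  also have "\<dots> = A.tau (c \<otimes>\<^bsub>K\<^esub> c) \<otimes>\<^bsub>A\<^esub> ?z"
    unfolding z'[symmetric] A.tau_mult[OF c(1) c(1)] using cl by (simp add: A.A.m_assoc)
  finally have "A.tau (c \<otimes>\<^bsub>K\<^esub> c) \<otimes>\<^bsub>A\<^esub> ?z = A.tau \<one>\<^bsub>K\<^esub> \<otimes>\<^bsub>A\<^esub> ?z"
    unfolding A.tau_one using cl by simp
  then have z0: "?z = \<zero>\<^bsub>A\<^esub>"
    by (intro A.tau_cancel[OF _ K.one_closed c(2) cl(2)]) (use c in simp)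
  have "?y \<otimes>\<^bsub>A\<^esub> E r (j, i) = \<zero>\<^bsub>A\<^esub>"
    using E_swap[OF one r] E_entry[OF r ij(1,2)] unfolding z0 by simp
  then show ?thesis by (rule A.unit_mult_zero[OF E_one_unit E_entry[OF r ij(2,1)]])
qed

lemma E_zero:
  assumes r: "r \<in> carrier R" and kl: "k < n" "l < n" "k \<noteq> l" "(k, l) \<noteq> (i, j)"
  shows "E r (k, l) = \<zero>\<^bsub>A\<^esub>"
proof (cases "k \<in> {i, j} \<and> l \<in> {i, j}")
  case True
  then have "k = j" "l = i" using kl by auto
  then show ?thesis using E_lower[OF r] by simp
qed (rule E_offdiag[OF r kl(1-3)])

text \<open>Once the lower entry vanishes, a diagonal entry is a homomorphism from the additive group of \<open>R\<close> to
the units of \<open>A\<close>.  It is invariant under multiplication of the argument by \<open>c\<close>, so it is trivial on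
multiples of \<open>c - 1\<close>, which is a unit.\<close>

lemma E_diag:
  assumes r: "r \<in> carrier R" and k: "k < n"
  shows "E r (k, k) = \<one>\<^bsub>A\<^esub>"
proof -
  obtain c t where c: "c \<in> carrier K" "c \<otimes>\<^bsub>K\<^esub> c \<noteq> \<one>\<^bsub>K\<^esub>" and t: "t \<in> T" "t i = c \<otimes>\<^bsub>K\<^esub> t j"
    using ratio_big[OF ij] by blast
  have c1: "c \<noteq> \<one>\<^bsub>K\<^esub>" using c by auto
  have u: "R.tau c \<ominus>\<^bsub>R\<^esub> \<one>\<^bsub>R\<^esub> \<in> Units R"
    using R.tau_diff_unit[OF c(1) K.one_closed c1] unfolding R.tau_one .
  \<comment> \<open>Chosen so that \<open>c s = r + s\<close>.\<close>
  define s where "s = inv\<^bsub>R\<^esub> (R.tau c \<ominus>\<^bsub>R\<^esub> \<one>\<^bsub>R\<^esub>) \<otimes>\<^bsub>R\<^esub> r"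
  have s: "s \<in> carrier R" unfolding s_def by (rule R.A.m_closed[OF R.A.Units_inv_closed[OF u] r])
  have tc: "R.tau c \<in> carrier R" by (rule R.tau_closed[OF c(1)])
  have "(R.tau c \<ominus>\<^bsub>R\<^esub> \<one>\<^bsub>R\<^esub>) \<otimes>\<^bsub>R\<^esub> s = r"
    unfolding s_def R.A.m_assoc[symmetric, OF R.A.Units_closed[OF u] R.A.Units_inv_closed[OF u] r]
      R.A.Units_r_inv[OF u] by (rule R.A.l_one[OF r])
  moreover have "R.tau c \<otimes>\<^bsub>R\<^esub> s = (R.tau c \<ominus>\<^bsub>R\<^esub> \<one>\<^bsub>R\<^esub>) \<otimes>\<^bsub>R\<^esub> s \<oplus>\<^bsub>R\<^esub> s" using tc s by algebra
  ultimately have rs: "R.tau c \<otimes>\<^bsub>R\<^esub> s = r \<oplus>\<^bsub>R\<^esub> s" by simp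
  have "(E r \<otimes>\<^bsub>mat_monoid n A\<^esub> E s) (k, k) = E r (k, k) \<otimes>\<^bsub>A\<^esub> E s (k, k)"
    unfolding mat_mult_entry[OF k k]
  proof (rule A.A.finsum_one[OF k])
    fix z assume z: "z < n"
    show "E r (k, z) \<otimes>\<^bsub>A\<^esub> E s (z, k) \<in> carrier A"
      by (rule A.A.m_closed[OF E_entry[OF r k z] E_entry[OF s z k]])
    assume zk: "z \<noteq> k"
    show "E r (k, z) \<otimes>\<^bsub>A\<^esub> E s (z, k) = \<zero>\<^bsub>A\<^esub>"
    proof (cases "(k, z) = (i, j)")
      case True
      then have "E s (z, k) = \<zero>\<^bsub>A\<^esub>" using E_lower[OF s] by simp
      then show ?thesis using E_entry[OF r k z] by simp
    next
      case False
      then have "E r (k, z) = \<zero>\<^bsub>A\<^esub>" using zk by (intro E_zero[OF r k z]) auto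
      then show ?thesis using E_entry[OF s z k] by simp
    qed
  qed
  then have "E r (k, k) \<otimes>\<^bsub>A\<^esub> E s (k, k) = E s (k, k)"
    using E_diag_scale[OF s c(1) t k] unfolding rs E_add[OF r s] by simp
  moreover have "E s (k, k) \<in> Units A"
  proof -
    have "\<pi>A (E s (k, k)) = \<one>\<^bsub>K\<^esub>"
      unfolding rho_lift[OF ER_SL[OF s] k k] using ij k ring_hom_one[OF R.hom] by auto
    then show ?thesis using A.unit_iff[OF E_entry[OF s k k]] K.one_not_zero by simp
  qed
  ultimately show ?thesis
    using A.A.Units_l_cancel[of "E s (k, k)" "E r (k, k)" "\<one>\<^bsub>A\<^esub>"] E_entry[OF r k k] E_entry[OF s k k]
    by (simp add: A.A.m_comm)
qed

lemma E_eq: assumes r: "r \<in> carrier R" shows "E r = EA i j (E r (i, j))"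
proof (rule mat_eqI[OF E_closed[OF r] A.A.emat_closed[OF E_entry[OF r ij(1,2)]]])
  fix k l assume "k < n" "l < n"
  then show "E r (k, l) = EA i j (E r (i, j)) (k, l)"
    using E_zero[OF r, of k l] E_diag[OF r, of k] ij by auto
qed

lemma E_upper_add:
  assumes r: "r \<in> carrier R" and s: "s \<in> carrier R"
  shows "E (r \<oplus>\<^bsub>R\<^esub> s) (i, j) = E r (i, j) \<oplus>\<^bsub>A\<^esub> E s (i, j)"
proof -
  note cl = E_entry[OF r ij(1,2)] E_entry[OF s ij(1,2)]
  have "E (r \<oplus>\<^bsub>R\<^esub> s) = EA i j (E r (i, j)) \<otimes>\<^bsub>mat_monoid n A\<^esub> EA i j (E s (i, j))"
    unfolding E_add[OF r s] E_eq[OF r, symmetric] E_eq[OF s, symmetric] ..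
  also have "\<dots> = EA i j (E r (i, j) \<oplus>\<^bsub>A\<^esub> E s (i, j))" by (rule A.A.emat_add[OF cl ij])
  finally show ?thesis using ij by simp
qed

lemma E_upper_square:
  assumes r: "r \<in> carrier R" and a: "a \<in> carrier K"
  shows "E (R.tau (a \<otimes>\<^bsub>K\<^esub> a) \<otimes>\<^bsub>R\<^esub> r) (i, j) = A.tau (a \<otimes>\<^bsub>K\<^esub> a) \<otimes>\<^bsub>A\<^esub> E r (i, j)"
proof (cases "a = \<zero>\<^bsub>K\<^esub>")
  case True
  have "E \<zero>\<^bsub>R\<^esub> = \<one>\<^bsub>mat_monoid n A\<^esub>" unfolding R.A.emat_zero[OF ij(3)] by (rule rho_one)
  then have "E \<zero>\<^bsub>R\<^esub> (i, j) = \<zero>\<^bsub>A\<^esub>" using ij by simp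
  then show ?thesis using True r R.tau_zero A.tau_zero E_entry[OF r ij(1,2)] by simp
next
  case False
  obtain t where "t \<in> T" "t i = (a \<otimes>\<^bsub>K\<^esub> a) \<otimes>\<^bsub>K\<^esub> t j" using ratio_sq[OF ij a False] by blast
  then show ?thesis using a by (intro E_upper_scale[OF r]) auto
qed

end

end

section \<open>The ring homomorphism attached to a lift\<close>

context normalized_lift begin

definition \<phi> :: "nat \<Rightarrow> nat \<Rightarrow> 'r \<Rightarrow> 'a" where "\<phi> i j r = \<rho> (ER i j r) (i, j)"

definition u :: "nat \<Rightarrow> nat \<Rightarrow> 'a" where "u i j = \<phi> i j \<one>\<^bsub>R\<^esub>"

text \<open>The upper entry at one chosen position, normalized to send 1 to 1.\<close>

definition f :: "'r \<Rightarrow> 'a" where "f r = inv\<^bsub>A\<^esub> (u 0 1) \<otimes>\<^bsub>A\<^esub> \<phi> 0 1 r"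

lemma n01: "0 < n" "1 < n" "(0::nat) \<noteq> 1" using n2 by auto

lemma phi_closed: "i < n \<Longrightarrow> j < n \<Longrightarrow> i \<noteq> j \<Longrightarrow> r \<in> carrier R \<Longrightarrow> \<phi> i j r \<in> carrier A"
  unfolding \<phi>_def by (rule E_entry)

lemma rho_emat: "i < n \<Longrightarrow> j < n \<Longrightarrow> i \<noteq> j \<Longrightarrow> r \<in> carrier R \<Longrightarrow> \<rho> (ER i j r) = EA i j (\<phi> i j r)"
  unfolding \<phi>_def by (rule E_eq)

lemma phi_add: "i < n \<Longrightarrow> j < n \<Longrightarrow> i \<noteq> j \<Longrightarrow> r \<in> carrier R \<Longrightarrow> s \<in> carrier R \<Longrightarrow>
    \<phi> i j (r \<oplus>\<^bsub>R\<^esub> s) = \<phi> i j r \<oplus>\<^bsub>A\<^esub> \<phi> i j s"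
  unfolding \<phi>_def by (rule E_upper_add)

lemma phi_square: "i < n \<Longrightarrow> j < n \<Longrightarrow> i \<noteq> j \<Longrightarrow> r \<in> carrier R \<Longrightarrow> a \<in> carrier K \<Longrightarrow>
    \<phi> i j (R.tau (a \<otimes>\<^bsub>K\<^esub> a) \<otimes>\<^bsub>R\<^esub> r) = A.tau (a \<otimes>\<^bsub>K\<^esub> a) \<otimes>\<^bsub>A\<^esub> \<phi> i j r"
  unfolding \<phi>_def by (rule E_upper_square)

lemma pi_phi: "i < n \<Longrightarrow> j < n \<Longrightarrow> i \<noteq> j \<Longrightarrow> r \<in> carrier R \<Longrightarrow> \<pi>A (\<phi> i j r) = \<pi>R r"
  unfolding \<phi>_def by (simp add: rho_lift[OF R.A.emat_SL])

lemma u_unit: "i < n \<Longrightarrow> j < n \<Longrightarrow> i \<noteq> j \<Longrightarrow> u i j \<in> Units A"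
  unfolding u_def \<phi>_def by (rule E_one_unit)

lemma u_closed: "i < n \<Longrightarrow> j < n \<Longrightarrow> i \<noteq> j \<Longrightarrow> u i j \<in> carrier A"
  by (rule A.A.Units_closed[OF u_unit])

lemma pi_u: "i < n \<Longrightarrow> j < n \<Longrightarrow> i \<noteq> j \<Longrightarrow> \<pi>A (u i j) = \<one>\<^bsub>K\<^esub>"
  unfolding u_def pi_phi[OF _ _ _ R.A.one_closed] by (rule ring_hom_one[OF R.hom])

lemma f_closed: "r \<in> carrier R \<Longrightarrow> f r \<in> carrier A"
  unfolding f_def by (rule A.A.m_closed[OF A.A.Units_inv_closed[OF u_unit[OF n01]] phi_closed[OF n01]])

lemma f_add:
  assumes r: "r \<in> carrier R" and s: "s \<in> carrier R"
  shows "f (r \<oplus>\<^bsub>R\<^esub> s) = f r \<oplus>\<^bsub>A\<^esub> f s"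
  unfolding f_def phi_add[OF n01 r s]
  by (rule A.A.r_distr[OF phi_closed[OF n01 r] phi_closed[OF n01 s] A.A.Units_inv_closed[OF u_unit[OF n01]]])

lemma f_one: "f \<one>\<^bsub>R\<^esub> = \<one>\<^bsub>A\<^esub>"
  unfolding f_def u_def[symmetric] by (rule A.A.Units_l_inv[OF u_unit[OF n01]])

lemma f_square:
  assumes r: "r \<in> carrier R" and a: "a \<in> carrier K"
  shows "f (R.tau (a \<otimes>\<^bsub>K\<^esub> a) \<otimes>\<^bsub>R\<^esub> r) = A.tau (a \<otimes>\<^bsub>K\<^esub> a) \<otimes>\<^bsub>A\<^esub> f r"
proof -
  have "A.tau (a \<otimes>\<^bsub>K\<^esub> a) \<in> carrier A" using a by (intro A.tau_closed) simp
  then show ?thesis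
    unfolding f_def phi_square[OF n01 r a]
    by (rule A.A.m_lcomm[OF A.A.Units_inv_closed[OF u_unit[OF n01]] _ phi_closed[OF n01 r]])
qed

lemma tau_sq_closed: "a \<in> carrier K \<Longrightarrow> R.tau (a \<otimes>\<^bsub>K\<^esub> a) \<in> carrier R" "a \<in> carrier K \<Longrightarrow> A.tau (a \<otimes>\<^bsub>K\<^esub> a) \<in> carrier A"
  by (rule R.tau_closed, simp) (rule A.tau_closed, simp)

lemma f_tau: "a \<in> carrier K \<Longrightarrow> f (R.tau (a \<otimes>\<^bsub>K\<^esub> a)) = A.tau (a \<otimes>\<^bsub>K\<^esub> a)"
  using f_square[OF R.A.one_closed, of a] f_one tau_sq_closed[of a] by simp

text \<open>Both sides are additive in \<open>r\<close> and agree at the Teichmueller representatives of squares.\<close>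

lemma f_mult:
  assumes r: "r \<in> carrier R" and s: "s \<in> carrier R"
  shows "f (r \<otimes>\<^bsub>R\<^esub> s) = f r \<otimes>\<^bsub>A\<^esub> f s"
proof (rule R.additive_eq[OF A.A.abelian_group_axioms _ _ _ _ _ r, of "\<lambda>r. f (r \<otimes>\<^bsub>R\<^esub> s)" "\<lambda>r. f r \<otimes>\<^bsub>A\<^esub> f s"])
  fix x assume x: "x \<in> carrier R"
  show "f (x \<otimes>\<^bsub>R\<^esub> s) \<in> carrier A" by (rule f_closed[OF R.A.m_closed[OF x s]])
  show "f x \<otimes>\<^bsub>A\<^esub> f s \<in> carrier A" by (rule A.A.m_closed[OF f_closed[OF x] f_closed[OF s]])
next
  fix x y assume x: "x \<in> carrier R" and y: "y \<in> carrier R"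
  show "f ((x \<oplus>\<^bsub>R\<^esub> y) \<otimes>\<^bsub>R\<^esub> s) = f (x \<otimes>\<^bsub>R\<^esub> s) \<oplus>\<^bsub>A\<^esub> f (y \<otimes>\<^bsub>R\<^esub> s)"
    unfolding R.A.l_distr[OF x y s] by (rule f_add[OF R.A.m_closed[OF x s] R.A.m_closed[OF y s]])
  show "f (x \<oplus>\<^bsub>R\<^esub> y) \<otimes>\<^bsub>A\<^esub> f s = f x \<otimes>\<^bsub>A\<^esub> f s \<oplus>\<^bsub>A\<^esub> f y \<otimes>\<^bsub>A\<^esub> f s"
    unfolding f_add[OF x y] by (rule A.A.l_distr[OF f_closed[OF x] f_closed[OF y] f_closed[OF s]])
next
  fix a assume a: "a \<in> carrier K"
  show "f (R.tau (a \<otimes>\<^bsub>K\<^esub> a) \<otimes>\<^bsub>R\<^esub> s) = f (R.tau (a \<otimes>\<^bsub>K\<^esub> a)) \<otimes>\<^bsub>A\<^esub> f s"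
    unfolding f_square[OF s a] f_tau[OF a] ..
qed

lemma f_hom: "f \<in> ring_hom R A"
  by (rule ring_hom_memI[OF f_closed f_mult f_add f_one])

lemma pi_f:
  assumes r: "r \<in> carrier R"
  shows "\<pi>A (f r) = \<pi>R r"
proof -
  note i = A.A.Units_inv_closed[OF u_unit[OF n01]]
  have "\<pi>A (u 0 1) \<otimes>\<^bsub>K\<^esub> \<pi>A (inv\<^bsub>A\<^esub> (u 0 1)) = \<one>\<^bsub>K\<^esub>"
    unfolding ring_hom_mult[OF A.hom u_closed[OF n01] i, symmetric] A.A.Units_r_inv[OF u_unit[OF n01]]
    by (rule ring_hom_one[OF A.hom])
  then have "\<pi>A (inv\<^bsub>A\<^esub> (u 0 1)) = \<one>\<^bsub>K\<^esub>" unfolding pi_u[OF n01] using ring_hom_closed[OF A.hom i] by simp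
  then show ?thesis
    unfolding f_def ring_hom_mult[OF A.hom i phi_closed[OF n01 r]] pi_phi[OF n01 r]
    using ring_hom_closed[OF R.hom r] by simp
qed

text \<open>Again both sides are additive and agree at the Teichmueller representatives of squares.\<close>

lemma phi_f:
  assumes ij: "i < n" "j < n" "i \<noteq> j" and r: "r \<in> carrier R"
  shows "\<phi> i j r = u i j \<otimes>\<^bsub>A\<^esub> f r"
proof (rule R.additive_eq[OF A.A.abelian_group_axioms _ _ _ _ _ r, of "\<phi> i j" "\<lambda>r. u i j \<otimes>\<^bsub>A\<^esub> f r"])
  note ui = u_closed[OF ij]
  fix x assume x: "x \<in> carrier R"
  show "\<phi> i j x \<in> carrier A" by (rule phi_closed[OF ij x])
  show "u i j \<otimes>\<^bsub>A\<^esub> f x \<in> carrier A" by (rule A.A.m_closed[OF ui f_closed[OF x]])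
  fix y assume y: "y \<in> carrier R"
  show "\<phi> i j (x \<oplus>\<^bsub>R\<^esub> y) = \<phi> i j x \<oplus>\<^bsub>A\<^esub> \<phi> i j y" by (rule phi_add[OF ij x y])
  show "u i j \<otimes>\<^bsub>A\<^esub> f (x \<oplus>\<^bsub>R\<^esub> y) = u i j \<otimes>\<^bsub>A\<^esub> f x \<oplus>\<^bsub>A\<^esub> u i j \<otimes>\<^bsub>A\<^esub> f y"
    unfolding f_add[OF x y] by (rule A.A.r_distr[OF f_closed[OF x] f_closed[OF y] ui])
next
  note ui = u_closed[OF ij]
  fix a assume a: "a \<in> carrier K"
  have "\<phi> i j (R.tau (a \<otimes>\<^bsub>K\<^esub> a) \<otimes>\<^bsub>R\<^esub> \<one>\<^bsub>R\<^esub>) = A.tau (a \<otimes>\<^bsub>K\<^esub> a) \<otimes>\<^bsub>A\<^esub> u i j"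
    unfolding u_def by (rule phi_square[OF ij R.A.one_closed a])
  then show "\<phi> i j (R.tau (a \<otimes>\<^bsub>K\<^esub> a)) = u i j \<otimes>\<^bsub>A\<^esub> f (R.tau (a \<otimes>\<^bsub>K\<^esub> a))"
    unfolding f_tau[OF a] A.A.m_comm[OF ui tau_sq_closed(2)[OF a]] using tau_sq_closed(1)[OF a] by simp
qed

text \<open>The Steinberg commutator relation at \<open>(i, j)\<close> and \<open>(j, k)\<close>, written without inverses.\<close>

lemma u_cocycle:
  assumes i: "i < n" and j: "j < n" and k: "k < n" and ne: "i \<noteq> j" "j \<noteq> k" "i \<noteq> k"
  shows "u i j \<otimes>\<^bsub>A\<^esub> u j k = u i k"
proof -
  note one = R.A.one_closed
  note SL = R.A.emat_SL[OF one i j ne(1)] R.A.emat_SL[OF one j k ne(2)] R.A.emat_SL[OF one i k ne(3)]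
  note EC = R.A.emat_closed[OF one, of n i j] R.A.emat_closed[OF one, of n j k] R.A.emat_closed[OF one, of n i k]
  note up = u_closed[OF i j ne(1)] u_closed[OF j k ne(2)] u_closed[OF i k ne(3)]
  have rel: "ER i j \<one>\<^bsub>R\<^esub> \<otimes>\<^bsub>mat_monoid n R\<^esub> ER j k \<one>\<^bsub>R\<^esub> =
      ER i k \<one>\<^bsub>R\<^esub> \<otimes>\<^bsub>mat_monoid n R\<^esub> (ER j k \<one>\<^bsub>R\<^esub> \<otimes>\<^bsub>mat_monoid n R\<^esub> ER i j \<one>\<^bsub>R\<^esub>)"
    by (rule mat_eqI[of _ n R])
      (use EC i j k ne in \<open>auto simp: R.A.emat_mult_entry\<close>)
  have E: "\<rho> (ER i j \<one>\<^bsub>R\<^esub>) = EA i j (u i j)" "\<rho> (ER j k \<one>\<^bsub>R\<^esub>) = EA j k (u j k)" "\<rho> (ER i k \<one>\<^bsub>R\<^esub>) = EA i k (u i k)"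
    unfolding u_def by (rule rho_emat[OF _ _ _ one]; fact)+
  note EAC = A.A.emat_closed[OF up(1), of n i j] A.A.emat_closed[OF up(2), of n j k] A.A.emat_closed[OF up(3), of n i k]
  have "EA i j (u i j) \<otimes>\<^bsub>mat_monoid n A\<^esub> EA j k (u j k) =
      EA i k (u i k) \<otimes>\<^bsub>mat_monoid n A\<^esub> (EA j k (u j k) \<otimes>\<^bsub>mat_monoid n A\<^esub> EA i j (u i j))"
    using arg_cong[OF rel, of \<rho>]
    unfolding rho_mult[OF SL(1,2)] rho_mult[OF SL(3) R.A.SL_mult_closed[OF SL(2,1)]] rho_mult[OF SL(2,1)] E .
  then have "(EA i j (u i j) \<otimes>\<^bsub>mat_monoid n A\<^esub> EA j k (u j k)) (i, k) =
      (EA i k (u i k) \<otimes>\<^bsub>mat_monoid n A\<^esub> (EA j k (u j k) \<otimes>\<^bsub>mat_monoid n A\<^esub> EA i j (u i j))) (i, k)" by simp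
  then show ?thesis using EAC up i j k ne by (simp add: A.A.emat_mult_entry)
qed

text \<open>The product \<open>w\<close> of three elementary matrices represents the transposition of \<open>i\<close> and \<open>j\<close> in
the Weyl group.  It conjugates the coroot to its inverse, hence entry \<open>(i, i)\<close> of its image is zero; on the
other hand this entry is \<open>1 - u i j * u j i\<close>.\<close>

lemma u_inverse:
  assumes i: "i < n" and j: "j < n" and ne: "i \<noteq> j"
  shows "u i j \<otimes>\<^bsub>A\<^esub> u j i = \<one>\<^bsub>A\<^esub>"
proof -
  note one = R.A.one_closed and none = R.A.a_inv_closed[OF R.A.one_closed] and ji = j i ne[symmetric]
  note SL = R.A.emat_SL[OF one i j ne] R.A.emat_SL[OF none ji]
  note EC = R.A.emat_closed[OF one, of n i j] R.A.emat_closed[OF none, of n j i]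
  obtain a where a: "a \<in> carrier K" "a \<noteq> \<zero>\<^bsub>K\<^esub>" "a \<otimes>\<^bsub>K\<^esub> a \<noteq> \<one>\<^bsub>K\<^esub>" using exists_sq_ne_one by blast
  note ai = K_inv(1)[OF a(1,2)]
  let ?s = "tor i j a" and ?t = "tor j i a"
  have s: "?s \<in> T" and t: "?t \<in> T" using tor_T[OF i j ne a(1,2)] tor_T[OF ji a(1,2)] by blast+
  let ?N = "ER j i (\<ominus>\<^bsub>R\<^esub> \<one>\<^bsub>R\<^esub>) \<otimes>\<^bsub>mat_monoid n R\<^esub> ER i j \<one>\<^bsub>R\<^esub>"
  let ?w = "ER i j \<one>\<^bsub>R\<^esub> \<otimes>\<^bsub>mat_monoid n R\<^esub> ?N"
  have N: "?N \<in> carrier (mat_monoid n R)" by (rule R.A.mat_mult_closed[OF EC(2,1)])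
  have wC: "?w \<in> carrier (mat_monoid n R)" by (rule R.A.mat_mult_closed[OF EC(1) N])
  have NSL: "?N \<in> carrier (SL n R)" by (rule R.A.SL_mult_closed[OF SL(2,1)])
  have wSL: "?w \<in> carrier (SL n R)" by (rule R.A.SL_mult_closed[OF SL(1) NSL])
  have Ne: "?N (k, l) = (if k = j then ER i j \<one>\<^bsub>R\<^esub> (j, l) \<oplus>\<^bsub>R\<^esub> \<ominus>\<^bsub>R\<^esub> \<one>\<^bsub>R\<^esub> \<otimes>\<^bsub>R\<^esub> ER i j \<one>\<^bsub>R\<^esub> (i, l) else ER i j \<one>\<^bsub>R\<^esub> (k, l))"
    if "k < n" "l < n" for k l
    by (rule R.A.emat_mult_entry[OF EC(1) none ji that])
  have we: "?w (k, l) = (if k = i then ?N (i, l) \<oplus>\<^bsub>R\<^esub> \<one>\<^bsub>R\<^esub> \<otimes>\<^bsub>R\<^esub> ?N (j, l) else ?N (k, l))"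
    if "k < n" "l < n" for k l
    by (rule R.A.emat_mult_entry[OF N one i j ne that])
  have w: "?w (k, l) = (if k = i then if l = j then \<one>\<^bsub>R\<^esub> else \<zero>\<^bsub>R\<^esub>
      else if k = j then if l = i then \<ominus>\<^bsub>R\<^esub> \<one>\<^bsub>R\<^esub> else \<zero>\<^bsub>R\<^esub>
      else if k = l then \<one>\<^bsub>R\<^esub> else \<zero>\<^bsub>R\<^esub>)" if kl: "k < n" "l < n" for k l
    unfolding we[OF kl] Ne[OF kl] Ne[OF i kl(2)] Ne[OF j kl(2)] using kl i j ne
    by (auto simp: R.A.r_neg R.A.l_neg)
  have comm: "DR ?s \<otimes>\<^bsub>mat_monoid n R\<^esub> ?w = ?w \<otimes>\<^bsub>mat_monoid n R\<^esub> DR ?t"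
  proof (rule mat_eqI[OF R.A.mat_mult_closed[OF DR_closed[OF s] wC] R.A.mat_mult_closed[OF wC DR_closed[OF t]]])
    fix k l assume kl: "k < n" "l < n"
    have cl: "R.tau a \<in> carrier R" "R.tau (inv\<^bsub>K\<^esub> a) \<in> carrier R"
      using R.tau_closed a(1) ai by blast+
    have "R.tau (?s k) \<otimes>\<^bsub>R\<^esub> ?w (k, l) = ?w (k, l) \<otimes>\<^bsub>R\<^esub> R.tau (?t l)"
      unfolding w[OF kl] using kl i j ne cl R.tau_one by (auto simp: R.A.l_minus R.A.r_minus)
    then show "(DR ?s \<otimes>\<^bsub>mat_monoid n R\<^esub> ?w) (k, l) = (?w \<otimes>\<^bsub>mat_monoid n R\<^esub> DR ?t) (k, l)"
      unfolding DR_mult_entry(1)[OF s wC kl] DR_mult_entry(2)[OF t wC kl] .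
  qed
  have rw: "\<rho> ?w (i, i) \<in> carrier A" by (rule mat_entry[OF rho_closed[OF wSL] i i])
  have "A.tau (?s i) \<otimes>\<^bsub>A\<^esub> \<rho> ?w (i, i) = \<rho> ?w (i, i) \<otimes>\<^bsub>A\<^esub> A.tau (?t i)"
    by (rule equivariance[OF wSL wSL s t comm i i])
  also have "\<dots> = A.tau (?t i) \<otimes>\<^bsub>A\<^esub> \<rho> ?w (i, i)" by (rule A.A.m_comm[OF rw tauA_closed[OF t i]])
  finally have "A.tau a \<otimes>\<^bsub>A\<^esub> \<rho> ?w (i, i) = A.tau (inv\<^bsub>K\<^esub> a) \<otimes>\<^bsub>A\<^esub> \<rho> ?w (i, i)" using i ne by simp
  then have w0: "\<rho> ?w (i, i) = \<zero>\<^bsub>A\<^esub>" by (rule A.tau_cancel[OF a(1) ai inv_ne[OF a] rw])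
  define v where "v = \<phi> j i (\<ominus>\<^bsub>R\<^esub> \<one>\<^bsub>R\<^esub>)"
  have v: "v \<in> carrier A" unfolding v_def by (rule phi_closed[OF ji none])
  note up = u_closed[OF i j ne] u_closed[OF ji]
  have f0: "f \<zero>\<^bsub>R\<^esub> = \<zero>\<^bsub>A\<^esub>" by (rule ring_hom_zero'[OF R.A.is_cring A.A.is_cring f_hom])
  have "f (\<ominus>\<^bsub>R\<^esub> \<one>\<^bsub>R\<^esub>) \<oplus>\<^bsub>A\<^esub> \<one>\<^bsub>A\<^esub> = \<zero>\<^bsub>A\<^esub>"
    using f_add[OF none one] f_one f0 by (simp add: R.A.l_neg)
  then have fm: "f (\<ominus>\<^bsub>R\<^esub> \<one>\<^bsub>R\<^esub>) = \<ominus>\<^bsub>A\<^esub> \<one>\<^bsub>A\<^esub>" using A.A.minus_equality[of _ "\<one>\<^bsub>A\<^esub>"] f_closed[OF none] by simp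
  have vu: "v = \<ominus>\<^bsub>A\<^esub> u j i" unfolding v_def phi_f[OF ji none] fm using up by (simp add: A.A.r_minus)
  have E: "\<rho> (ER i j \<one>\<^bsub>R\<^esub>) = EA i j (u i j)" "\<rho> (ER j i (\<ominus>\<^bsub>R\<^esub> \<one>\<^bsub>R\<^esub>)) = EA j i v"
    unfolding u_def v_def by (rule rho_emat[OF i j ne one], rule rho_emat[OF ji none])
  note EAC = A.A.emat_closed[OF up(1), of n i j] A.A.emat_closed[OF v, of n j i]
  have "\<rho> ?w = EA i j (u i j) \<otimes>\<^bsub>mat_monoid n A\<^esub> (EA j i v \<otimes>\<^bsub>mat_monoid n A\<^esub> EA i j (u i j))"
    unfolding rho_mult[OF SL(1) NSL] rho_mult[OF SL(2,1)] E ..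
  then have "\<rho> ?w (i, i) = (EA j i v \<otimes>\<^bsub>mat_monoid n A\<^esub> EA i j (u i j)) (i, i) \<oplus>\<^bsub>A\<^esub>
      u i j \<otimes>\<^bsub>A\<^esub> (EA j i v \<otimes>\<^bsub>mat_monoid n A\<^esub> EA i j (u i j)) (j, i)"
    using A.A.emat_mult_entry[OF A.A.mat_mult_closed[OF EAC(2,1)] up(1) i j ne i i] by simp
  also have "(EA j i v \<otimes>\<^bsub>mat_monoid n A\<^esub> EA i j (u i j)) (i, i) = \<one>\<^bsub>A\<^esub>"
    using A.A.emat_mult_entry[OF EAC(1) v ji i i] i j ne by simp
  also have "(EA j i v \<otimes>\<^bsub>mat_monoid n A\<^esub> EA i j (u i j)) (j, i) = v"
    using A.A.emat_mult_entry[OF EAC(1) v ji j i] i j ne v by simp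
  finally have "\<one>\<^bsub>A\<^esub> \<oplus>\<^bsub>A\<^esub> u i j \<otimes>\<^bsub>A\<^esub> v = \<zero>\<^bsub>A\<^esub>" using w0 by simp
  then have "\<one>\<^bsub>A\<^esub> \<ominus>\<^bsub>A\<^esub> u i j \<otimes>\<^bsub>A\<^esub> u j i = \<zero>\<^bsub>A\<^esub>"
    unfolding vu using up by (simp add: A.A.r_minus a_minus_def)
  then show ?thesis using up by simp
qed

text \<open>The unit cochain whose coboundary is \<open>u\<close>.\<close>

definition V :: "nat \<Rightarrow> 'a" where "V i = (if i = 0 then \<one>\<^bsub>A\<^esub> else u i 0)"

lemma V_unit: "i < n \<Longrightarrow> V i \<in> Units A"
  using u_unit[OF _ n01(1)] by (simp add: V_def)

lemma V_closed: "i < n \<Longrightarrow> V i \<in> carrier A"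
  by (rule A.A.Units_closed[OF V_unit])

lemma pi_V: "i < n \<Longrightarrow> \<pi>A (V i) = \<one>\<^bsub>K\<^esub>"
  using pi_u[OF _ n01(1)] ring_hom_one[OF A.hom] by (simp add: V_def)

lemma u_V:
  assumes ij: "i < n" "j < n" "i \<noteq> j"
  shows "u i j \<otimes>\<^bsub>A\<^esub> V j = V i"
proof (cases "j = 0")
  case True
  then show ?thesis using ij u_closed[OF ij] by (simp add: V_def)
next
  case j: False
  show ?thesis
  proof (cases "i = 0")
    case True
    then show ?thesis using j u_inverse[OF ij] by (simp add: V_def)
  next
    case False
    then show ?thesis using j u_cocycle[OF ij(1,2) n01(1) ij(3)] by (simp add: V_def)
  qed
qed

lemma conjugate_emat:
  assumes ij: "i < n" "j < n" "i \<noteq> j" and r: "r \<in> carrier R"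
  shows "\<rho> (ER i j r) \<otimes>\<^bsub>mat_monoid n A\<^esub> dmat n A V = dmat n A V \<otimes>\<^bsub>mat_monoid n A\<^esub> mat_map n f (ER i j r)"
proof -
  have D: "dmat n A V \<in> carrier (mat_monoid n A)" by (rule A.A.dmat_closed[OF V_closed])
  note p = phi_closed[OF ij r]
  have E: "EA i j (\<phi> i j r) \<in> carrier (mat_monoid n A)" by (rule A.A.emat_closed[OF p])
  have F: "mat_map n f (ER i j r) \<in> carrier (mat_monoid n A)"
    by (rule R.A.mat_map_closed[OF f_closed R.A.emat_closed[OF r]])
  have pV: "\<phi> i j r \<otimes>\<^bsub>A\<^esub> V j = V i \<otimes>\<^bsub>A\<^esub> f r"
    unfolding phi_f[OF ij r] u_V[OF ij, symmetric]
    using u_closed[OF ij] V_closed[OF ij(2)] f_closed[OF r] by (simp add: A.A.m_ac)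
  have f0: "f \<zero>\<^bsub>R\<^esub> = \<zero>\<^bsub>A\<^esub>" by (rule ring_hom_zero'[OF R.A.is_cring A.A.is_cring f_hom])
  show ?thesis
    unfolding rho_emat[OF ij r]
  proof (rule mat_eqI[OF A.A.mat_mult_closed[OF E D] A.A.mat_mult_closed[OF D F]])
    fix k l assume kl: "k < n" "l < n"
    have "(EA i j (\<phi> i j r) \<otimes>\<^bsub>mat_monoid n A\<^esub> dmat n A V) (k, l) = EA i j (\<phi> i j r) (k, l) \<otimes>\<^bsub>A\<^esub> V l"
      by (rule A.A.mult_dmat_entry[OF E V_closed kl])
    moreover have "(dmat n A V \<otimes>\<^bsub>mat_monoid n A\<^esub> mat_map n f (ER i j r)) (k, l) = V k \<otimes>\<^bsub>A\<^esub> mat_map n f (ER i j r) (k, l)"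
      by (rule A.A.dmat_mult_entry[OF F V_closed kl])
    ultimately show "(EA i j (\<phi> i j r) \<otimes>\<^bsub>mat_monoid n A\<^esub> dmat n A V) (k, l) = (dmat n A V \<otimes>\<^bsub>mat_monoid n A\<^esub> mat_map n f (ER i j r)) (k, l)"
      using kl ij pV f0 f_one V_closed[OF kl(1)] V_closed[OF kl(2)] by auto
  qed
qed

lemma conjugate:
  assumes g: "g \<in> carrier (SL n R)"
  shows "\<rho> g \<otimes>\<^bsub>mat_monoid n A\<^esub> dmat n A V = dmat n A V \<otimes>\<^bsub>mat_monoid n A\<^esub> mat_map n f g"
proof -
  interpret MM: monoid "mat_monoid n A" by (rule A.A.mat_monoid)
  have D: "dmat n A V \<in> carrier (mat_monoid n A)" by (rule A.A.dmat_closed[OF V_closed])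
  have F: "mat_map n f g \<in> carrier (mat_monoid n A)" if "g \<in> carrier (SL n R)" for g
    using that by (intro R.A.mat_map_closed[OF f_closed]) (simp_all add: R.A.SL_carrier)
  let ?Q = "\<lambda>g. \<rho> g \<otimes>\<^bsub>mat_monoid n A\<^esub> dmat n A V = dmat n A V \<otimes>\<^bsub>mat_monoid n A\<^esub> mat_map n f g"
  have mult: "?Q (g \<otimes>\<^bsub>mat_monoid n R\<^esub> h)" if g: "g \<in> carrier (SL n R)" and h: "h \<in> carrier (SL n R)"
    and Q: "?Q g" "?Q h" for g h
  proof -
    have "g \<in> carrier (mat_monoid n R)" "h \<in> carrier (mat_monoid n R)" using g h by (simp_all add: R.A.SL_carrier)
    note mm = mat_map_mult[OF R.A.is_cring A.A.is_cring f_hom this]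
    have "\<rho> (g \<otimes>\<^bsub>mat_monoid n R\<^esub> h) \<otimes>\<^bsub>mat_monoid n A\<^esub> dmat n A V = \<rho> g \<otimes>\<^bsub>mat_monoid n A\<^esub> (dmat n A V \<otimes>\<^bsub>mat_monoid n A\<^esub> mat_map n f h)"
      unfolding rho_mult[OF g h] MM.m_assoc[OF rho_closed[OF g] rho_closed[OF h] D] Q(2) ..
    also have "\<dots> = (dmat n A V \<otimes>\<^bsub>mat_monoid n A\<^esub> mat_map n f g) \<otimes>\<^bsub>mat_monoid n A\<^esub> mat_map n f h"
      unfolding MM.m_assoc[symmetric, OF rho_closed[OF g] D F[OF h]] Q(1) ..
    also have "\<dots> = dmat n A V \<otimes>\<^bsub>mat_monoid n A\<^esub> mat_map n f (g \<otimes>\<^bsub>mat_monoid n R\<^esub> h)"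
      unfolding mm by (rule MM.m_assoc[OF D F[OF g] F[OF h]])
    finally show ?thesis .
  qed
  from g show ?thesis
  proof (induction rule: R.SL_induct)
    case one
    show ?case
      unfolding rho_one mat_map_one[OF R.A.is_cring A.A.is_cring f_hom] MM.l_one[OF D] MM.r_one[OF D] ..
  next
    case (left i j r M)
    show ?case
      by (rule mult[OF R.A.emat_SL[OF left(4,1,2,3)] left(5) conjugate_emat[OF left(1-4)] left(6)])
  next
    case (right i j r M)
    show ?case
      by (rule mult[OF right(5) R.A.emat_SL[OF right(4,1,2,3)] right(6) conjugate_emat[OF right(1-4)]])
  qed
qed

end

section \<open>Universality\<close>

lemma (in lift_setup) lift_conjugate:
  "\<exists>f\<in>ring_hom R A. (\<forall>r\<in>carrier R. \<pi>A (f r) = \<pi>R r) \<and>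
    (\<exists>Q\<in>Units (mat_monoid n A). mat_map n \<pi>A Q = \<one>\<^bsub>mat_monoid n K\<^esub> \<and>
      (\<forall>g\<in>carrier (SL n R). \<rho> g \<otimes>\<^bsub>mat_monoid n A\<^esub> Q = Q \<otimes>\<^bsub>mat_monoid n A\<^esub> mat_map n f g))"
proof -
  interpret MM: monoid "mat_monoid n A" by (rule A.A.mat_monoid)
  interpret MK: monoid "mat_monoid n K" by (rule K.mat_monoid)
  obtain P where P: "P \<in> Units (mat_monoid n A)" and piP: "mat_map n \<pi>A P = \<one>\<^bsub>mat_monoid n K\<^esub>"
    and diag: "\<And>t. t \<in> T \<Longrightarrow> \<rho> (DR t) \<otimes>\<^bsub>mat_monoid n A\<^esub> P = P \<otimes>\<^bsub>mat_monoid n A\<^esub> DA t"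
    using diagonalize by blast
  let ?I = "inv\<^bsub>mat_monoid n A\<^esub> P"
  have PC: "P \<in> carrier (mat_monoid n A)" by (rule MM.Units_closed[OF P])
  have IC: "?I \<in> carrier (mat_monoid n A)" by (rule MM.Units_inv_closed[OF P])
  note mm = mat_map_mult[OF A.A.is_cring K.is_cring A.hom]
  have mc: "mat_map n \<pi>A M \<in> carrier (mat_monoid n K)" if "M \<in> carrier (mat_monoid n A)" for M
    by (rule A.A.mat_map_closed[OF ring_hom_closed[OF A.hom] that])
  have piI: "mat_map n \<pi>A ?I = \<one>\<^bsub>mat_monoid n K\<^esub>"
  proof -
    have "mat_map n \<pi>A ?I \<otimes>\<^bsub>mat_monoid n K\<^esub> \<one>\<^bsub>mat_monoid n K\<^esub> = \<one>\<^bsub>mat_monoid n K\<^esub>"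
      using mm[OF IC PC] MM.Units_l_inv[OF P] mat_map_one[OF A.A.is_cring K.is_cring A.hom, of n]
      unfolding piP by simp
    then show ?thesis using MK.r_one[OF mc[OF IC]] by simp
  qed
  define \<sigma> where "\<sigma> g = ?I \<otimes>\<^bsub>mat_monoid n A\<^esub> \<rho> g \<otimes>\<^bsub>mat_monoid n A\<^esub> P" for g
  have IrC: "?I \<otimes>\<^bsub>mat_monoid n A\<^esub> \<rho> g \<in> carrier (mat_monoid n A)" if "g \<in> carrier (SL n R)" for g
    by (rule A.A.mat_mult_closed[OF IC rho_closed[OF that]])
  have sigma_closed: "\<sigma> g \<in> carrier (mat_monoid n A)" if "g \<in> carrier (SL n R)" for g
    unfolding \<sigma>_def by (rule A.A.mat_mult_closed[OF IrC[OF that] PC])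
  have P_sigma: "P \<otimes>\<^bsub>mat_monoid n A\<^esub> \<sigma> g = \<rho> g \<otimes>\<^bsub>mat_monoid n A\<^esub> P" if g: "g \<in> carrier (SL n R)" for g
  proof -
    have "P \<otimes>\<^bsub>mat_monoid n A\<^esub> \<sigma> g = (P \<otimes>\<^bsub>mat_monoid n A\<^esub> ?I \<otimes>\<^bsub>mat_monoid n A\<^esub> \<rho> g) \<otimes>\<^bsub>mat_monoid n A\<^esub> P"
      unfolding \<sigma>_def MM.m_assoc[OF PC IC rho_closed[OF g]] by (rule MM.m_assoc[symmetric, OF PC IrC[OF g] PC])
    then show ?thesis unfolding MM.Units_r_inv[OF P] MM.l_one[OF rho_closed[OF g]] .
  qed
  interpret N: normalized_lift K n R \<pi>R p m A \<pi>A \<sigma>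
  proof unfold_locales
    show "\<sigma> g \<in> carrier (mat_monoid n A)" if "g \<in> carrier (SL n R)" for g by (rule sigma_closed[OF that])
    fix g h assume g: "g \<in> carrier (SL n R)" and h: "h \<in> carrier (SL n R)"
    have "\<sigma> (g \<otimes>\<^bsub>mat_monoid n R\<^esub> h) = ?I \<otimes>\<^bsub>mat_monoid n A\<^esub> \<rho> g \<otimes>\<^bsub>mat_monoid n A\<^esub> (\<rho> h \<otimes>\<^bsub>mat_monoid n A\<^esub> P)"
      unfolding \<sigma>_def rho_mult[OF g h] MM.m_assoc[symmetric, OF IC rho_closed[OF g] rho_closed[OF h]]
      by (rule MM.m_assoc[OF IrC[OF g] rho_closed[OF h] PC])
    also have "\<dots> = \<sigma> g \<otimes>\<^bsub>mat_monoid n A\<^esub> \<sigma> h"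
      unfolding P_sigma[OF h, symmetric] unfolding \<sigma>_def[of g]
      by (rule MM.m_assoc[symmetric, OF IrC[OF g] PC sigma_closed[OF h]])
    finally show "\<sigma> (g \<otimes>\<^bsub>mat_monoid n R\<^esub> h) = \<sigma> g \<otimes>\<^bsub>mat_monoid n A\<^esub> \<sigma> h" .
  next
    fix g k l assume g: "g \<in> carrier (SL n R)" and kl: "k < n" "l < n"
    have "mat_map n \<pi>A (\<sigma> g) = mat_map n \<pi>A (\<rho> g)"
      unfolding \<sigma>_def mm[OF IrC[OF g] PC] mm[OF IC rho_closed[OF g]] piI piP
        MK.l_one[OF mc[OF rho_closed[OF g]]] by (rule MK.r_one[OF mc[OF rho_closed[OF g]]])
    from fun_cong[OF this, of "(k, l)"] have "\<pi>A (\<sigma> g (k, l)) = \<pi>A (\<rho> g (k, l))" using kl by simp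
    then show "\<pi>A (\<sigma> g (k, l)) = \<pi>R (g (k, l))" unfolding rho_lift[OF g kl] .
  next
    fix t assume t: "t \<in> T"
    have "\<sigma> (DR t) = ?I \<otimes>\<^bsub>mat_monoid n A\<^esub> (P \<otimes>\<^bsub>mat_monoid n A\<^esub> DA t)"
      unfolding \<sigma>_def diag[OF t, symmetric] by (rule MM.m_assoc[OF IC rho_closed[OF DR_SL[OF t]] PC])
    also have "\<dots> = DA t"
      unfolding MM.m_assoc[symmetric, OF IC PC DA_closed[OF t]] MM.Units_l_inv[OF P] by (rule MM.l_one[OF DA_closed[OF t]])
    finally show "\<sigma> (DR t) = DA t" .
  qed
  let ?D = "dmat n A N.V"
  let ?Q = "P \<otimes>\<^bsub>mat_monoid n A\<^esub> ?D"
  have D: "?D \<in> carrier (mat_monoid n A)" by (rule A.A.dmat_closed[OF N.V_closed])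
  have piD: "mat_map n \<pi>A ?D = \<one>\<^bsub>mat_monoid n K\<^esub>"
    by (rule mat_eqI[OF mc[OF D] K.mat_one_closed])
      (simp add: N.pi_V ring_hom_zero'[OF A.A.is_cring K.is_cring A.hom])
  have "\<pi>A (mat_det n A ?D) = \<one>\<^bsub>K\<^esub>"
    using mat_det_map[OF A.A.is_cring K.is_cring A.hom D] K.mat_det_one unfolding piD by simp
  then have "mat_det n A ?D \<in> Units A" using A.unit_iff[OF A.A.mat_det_closed[OF D]] K.one_not_zero by metis
  then have DU: "?D \<in> Units (mat_monoid n A)" by (rule A.A.mat_unitI[OF D])
  have piQ: "mat_map n \<pi>A ?Q = \<one>\<^bsub>mat_monoid n K\<^esub>"
    unfolding mm[OF PC D] piP piD by (rule MK.l_one[OF K.mat_one_closed])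
  have "\<rho> g \<otimes>\<^bsub>mat_monoid n A\<^esub> ?Q = ?Q \<otimes>\<^bsub>mat_monoid n A\<^esub> mat_map n N.f g" if g: "g \<in> carrier (SL n R)" for g
  proof -
    have F: "mat_map n N.f g \<in> carrier (mat_monoid n A)"
      using g by (intro R.A.mat_map_closed[OF N.f_closed]) (simp_all add: R.A.SL_carrier)
    have "\<rho> g \<otimes>\<^bsub>mat_monoid n A\<^esub> ?Q = P \<otimes>\<^bsub>mat_monoid n A\<^esub> (\<sigma> g \<otimes>\<^bsub>mat_monoid n A\<^esub> ?D)"
      unfolding MM.m_assoc[symmetric, OF rho_closed[OF g] PC D] P_sigma[OF g, symmetric]
      by (rule MM.m_assoc[OF PC sigma_closed[OF g] D])
    also have "\<dots> = ?Q \<otimes>\<^bsub>mat_monoid n A\<^esub> mat_map n N.f g"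
      unfolding N.conjugate[OF g] by (rule MM.m_assoc[symmetric, OF PC D F])
    finally show ?thesis .
  qed
  then show ?thesis using N.f_hom N.pi_f MM.Units_m_closed[OF P DU] piQ by blast
qed

text \<open>Homomorphisms preserve Teichmueller representatives, and these determine additive maps.\<close>

lemma (in coeff_pair) residual_hom_unique:
  assumes f: "f \<in> ring_hom R A" "\<And>r. r \<in> carrier R \<Longrightarrow> \<pi>A (f r) = \<pi>R r"
    and g: "g \<in> ring_hom R A" "\<And>r. r \<in> carrier R \<Longrightarrow> \<pi>A (g r) = \<pi>R r"
    and r: "r \<in> carrier R"
  shows "f r = g r"
proof (rule R.additive_eq[OF A.A.abelian_group_axioms _ _ _ _ _ r])
  fix a assume "a \<in> carrier K"
  then have aa: "a \<otimes>\<^bsub>K\<^esub> a \<in> carrier K" by simp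
  have c: "complete_residue R K \<pi>R" "complete_residue A K \<pi>A" by unfold_locales
  show "f (R.tau (a \<otimes>\<^bsub>K\<^esub> a)) = g (R.tau (a \<otimes>\<^bsub>K\<^esub> a))"
    using hom_tau[OF c f aa] hom_tau[OF c g aa] by simp
qed (use ring_hom_closed[OF f(1)] ring_hom_closed[OF g(1)] ring_hom_add[OF f(1)] ring_hom_add[OF g(1)] in auto)

theorem mainTheorem2:
  fixes K :: "'k ring" and n m p :: nat
  assumes "n \<ge> 2" and "m \<ge> 1"
    and "field K" and "finite (carrier K)" and "has_char K p"
    and "card (carrier K) \<ge> 4"
    and "n = 2 \<Longrightarrow> card (carrier K) \<noteq> 5"
    and "n = 3 \<Longrightarrow> card (carrier K) \<noteq> 4"
  shows "universal_deformation_ring TYPE('a) n (SL n (witt_quot p m K)) K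
           (\<lambda>g. mat_map n witt_red g) (witt_quot p m K) witt_red (\<lambda>g. g)"
proof -
  interpret K: field K by fact
  interpret WQ: witt_quotient K m p by (rule witt_quotient.intro) fact+
  let ?R = "witt_quot p m K"
  interpret Rm: residue_map ?R K witt_red
    by (intro residue_map.intro residue_map_axioms.intro WQ.R_cring K.field_axioms WQ.red_hom WQ.red_surj)
  interpret R: p_residue ?R K witt_red p m
  proof (intro p_residue.intro p_residue_axioms.intro Rm.residue_map_axioms WQ.p_nilpotent assms(4))
    fix x assume "x \<in> a_kernel ?R K witt_red"
    then show "\<exists>y\<in>carrier ?R. x = add_pow ?R p y" unfolding Rm.mem_ker using WQ.red_ker by blast
  qed
  have cln: "cln_ring K ?R witt_red" by (rule R.cln_ring)
  have kerR: "a_kernel ?R K witt_red = max_ideal ?R"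
    by (rule complete_residue_cln_ring(2)[OF assms(3,4) cln])
  show ?thesis
    unfolding universal_deformation_ring_def
  proof (intro conjI allI impI)
    show "cln_ring K ?R witt_red" by (rule cln)
    show "is_lift n (SL n ?R) (mat_map n witt_red) ?R witt_red (\<lambda>g. g)"
      unfolding is_lift_def using Rm.A.SL_GL_hom by blast
  next
    fix A :: "'a ring" and \<pi>A and \<rho>A
    assume A: "cln_ring K A \<pi>A" and lift: "is_lift n (SL n ?R) (mat_map n witt_red) A \<pi>A \<rho>A"
    interpret A: complete_residue A K \<pi>A by (rule complete_residue_cln_ring(1)[OF assms(3,4) A])
    have kerA: "a_kernel A K \<pi>A = max_ideal A" by (rule complete_residue_cln_ring(2)[OF assms(3,4) A])
    interpret MM: monoid "mat_monoid n A" by (rule A.A.mat_monoid)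
    have hom: "\<rho>A \<in> hom (SL n ?R) (GL n A)"
      and red: "\<And>g. g \<in> carrier (SL n ?R) \<Longrightarrow> mat_map n \<pi>A (\<rho>A g) = mat_map n witt_red g"
      using lift unfolding is_lift_def by blast+
    have homc: "\<rho>A g \<in> carrier (GL n A)" if "g \<in> carrier (SL n ?R)" for g
      using hom that unfolding hom_def by blast
    have homm: "\<rho>A (g \<otimes>\<^bsub>SL n ?R\<^esub> h) = \<rho>A g \<otimes>\<^bsub>GL n A\<^esub> \<rho>A h"
      if "g \<in> carrier (SL n ?R)" "h \<in> carrier (SL n ?R)" for g h
      using hom that unfolding hom_def by blast
    interpret L: lift_setup K n ?R witt_red p m A \<pi>A \<rho>A
    proof unfold_locales
      fix g h assume g: "g \<in> carrier (SL n ?R)"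
      have "\<rho>A g \<in> carrier (GL n A)" by (rule homc[OF g])
      then show "\<rho>A g \<in> carrier (mat_monoid n A)" unfolding A.A.GL_simps by (rule MM.Units_closed)
      show "h \<in> carrier (SL n ?R) \<Longrightarrow> \<rho>A (g \<otimes>\<^bsub>mat_monoid n ?R\<^esub> h) = \<rho>A g \<otimes>\<^bsub>mat_monoid n A\<^esub> \<rho>A h"
        using homm[OF g, of h] unfolding A.A.GL_simps Rm.A.SL_mult .
      show "\<pi>A (\<rho>A g (k, l)) = witt_red (g (k, l))" if "k < n" "l < n" for k l
        using fun_cong[OF red[OF g], of "(k, l)"] that by simp
    qed (use assms in auto)
    obtain f Q where f: "f \<in> ring_hom ?R A" and pif: "\<And>r. r \<in> carrier ?R \<Longrightarrow> \<pi>A (f r) = witt_red r"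
      and Q: "Q \<in> Units (mat_monoid n A)" "mat_map n \<pi>A Q = \<one>\<^bsub>mat_monoid n K\<^esub>"
      and conj: "\<And>g. g \<in> carrier (SL n ?R) \<Longrightarrow> \<rho>A g \<otimes>\<^bsub>mat_monoid n A\<^esub> Q = Q \<otimes>\<^bsub>mat_monoid n A\<^esub> mat_map n f g"
      using L.lift_conjugate by blast
    let ?f = "restrict f (carrier ?R)"
    have fh: "?f \<in> ring_hom ?R A"
      using ring_hom_closed[OF f] ring_hom_mult[OF f] ring_hom_add[OF f] ring_hom_one[OF f]
      by (intro ring_hom_memI) simp_all
    have fc: "?f \<in> cln_hom ?R witt_red A \<pi>A"
      unfolding cln_hom_def
    proof (intro CollectI conjI fh)
      show "\<forall>x\<in>carrier ?R. \<pi>A (?f x) = witt_red x" using pif by simp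
      show "?f ` max_ideal ?R \<subseteq> max_ideal A"
        unfolding kerR[symmetric] kerA[symmetric]
      proof
        fix y assume "y \<in> ?f ` a_kernel ?R K witt_red"
        then obtain x where x: "x \<in> carrier ?R" "witt_red x = \<zero>\<^bsub>K\<^esub>" "y = f x"
          unfolding Rm.mem_ker by (auto simp: Rm.mem_ker)
        then show "y \<in> a_kernel A K \<pi>A" unfolding A.mem_ker using ring_hom_closed[OF f x(1)] pif[OF x(1)] by simp
      qed
    qed simp
    have se: "strictly_equiv n (SL n ?R) K A \<pi>A (\<lambda>g. mat_map n ?f g) \<rho>A"
      unfolding strictly_equiv_def
    proof (intro bexI[of _ Q] conjI ballI)
      show "Q \<in> carrier (GL n A)" unfolding A.A.GL_simps by (rule Q(1))
      show "mat_map n \<pi>A Q = \<one>\<^bsub>GL n K\<^esub>" unfolding K.GL_simps by (rule Q(2))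
      fix g assume g: "g \<in> carrier (SL n ?R)"
      have gC: "g \<in> carrier (mat_monoid n ?R)" using g Rm.A.SL_carrier by blast
      have "mat_map n ?f g = mat_map n f g"
        unfolding mat_map_def
      proof (rule restrict_ext)
        fix ij assume "ij \<in> {..<n} \<times> {..<n}"
        then have "g ij \<in> carrier ?R" using mat_entry[OF gC, of "fst ij" "snd ij"] by auto
        then show "?f (g ij) = f (g ij)" by (rule restrict_apply')
      qed
      moreover have "inv\<^bsub>GL n A\<^esub> Q = inv\<^bsub>mat_monoid n A\<^esub> Q"
        unfolding GL_def by (rule MM.units_of_inv[OF Q(1)])
      moreover have "\<rho>A g = (\<rho>A g \<otimes>\<^bsub>mat_monoid n A\<^esub> Q) \<otimes>\<^bsub>mat_monoid n A\<^esub> inv\<^bsub>mat_monoid n A\<^esub> Q"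
        unfolding MM.m_assoc[OF L.rho_closed[OF g] MM.Units_closed[OF Q(1)] MM.Units_inv_closed[OF Q(1)]]
          MM.Units_r_inv[OF Q(1)] by (rule MM.r_one[OF L.rho_closed[OF g], symmetric])
      ultimately show "\<rho>A g = Q \<otimes>\<^bsub>GL n A\<^esub> mat_map n ?f g \<otimes>\<^bsub>GL n A\<^esub> inv\<^bsub>GL n A\<^esub> Q"
        unfolding A.A.GL_simps conj[OF g] by simp
    qed
    show "\<exists>!f. f \<in> cln_hom ?R witt_red A \<pi>A \<and> strictly_equiv n (SL n ?R) K A \<pi>A (\<lambda>g. mat_map n f g) \<rho>A"
    proof (rule ex1I[of _ ?f])
      fix h assume "h \<in> cln_hom ?R witt_red A \<pi>A \<and> strictly_equiv n (SL n ?R) K A \<pi>A (\<lambda>g. mat_map n h g) \<rho>A"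
      then have h: "h \<in> ring_hom ?R A" "h \<in> extensional (carrier ?R)"
        "\<And>x. x \<in> carrier ?R \<Longrightarrow> \<pi>A (h x) = witt_red x" unfolding cln_hom_def by blast+
      show "h = ?f"
      proof (rule extensionalityI[OF h(2)])
        fix x assume x: "x \<in> carrier ?R"
        show "h x = ?f x" using L.residual_hom_unique[OF h(1,3) f pif x] x by simp
      qed simp
    qed (use fc se in blast)
  qed
qed

end
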